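(* Let $n\ge1$, let $p_i,q_i$ ($1\le i\le n$) be positive integers, and let $D$ be the standard diagram of the closure $L$ of the alternating 3-braid $\sigma_1^{p_1}\sigma_2^{-q_1}\cdots\sigma_1^{p_n}\sigma_2^{-q_n}$. Put $P=p_1+\dots+p_n$ and $Q=q_1+\dots+q_n$, and let $A=(A_{i,j})$ be the $P\times Q$ matrix of coefficients of the refined Crowell polynomial $P_{\widetilde G_D,c_1}$. Then $$n\,A_{i,j+1}\ge A_{i,j}$$ (for all $i,j$ for which both entries are defined). Moreover, if $$\Delta_L(-t)=\sum_{0\le k\le P+Q-2}a_kt^k,$$ then $$a_{k+1}\ \ge\ \frac{a_k}{n}+A_{0,k+1}\ >\ \frac{a_k}{n}\qquad\text{for } k\in\{0,\dots,P-2\}.$$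
   Context: $\sigma_1,\sigma_2$ are the standard generators of the braid group on three strands. $\Delta_L$ is the single-variable Alexander polynomial of $L$; it is defined up to units $\pm t^m$ of $\mathbb{Z}[t,t^{-1}]$, and is normalized here so that $\Delta_L(-t)$ is a polynomial in $t$ with nonnegative coefficients and non-zero constant term. Refined Crowell graph. Let $c_1,\dots,c_P$ be the crossings coming from letters $\sigma_1$ and $c'_1,\dots,c'_Q$ those coming from letters $\sigma_2^{-1}$, each listed in order of appearance in the braid word (from top to bottom in the diagram). The refined Crowell graph $\widetilde G_D$ of the standard diagram $D$ is the directed weighted graph (multi-edges and loops allowed) with vertex set $\{c_1,\dots,c_P,c'_1,\dots,c'_Q\}$ and the following edges: (a) the edges of the oriented cycle $c_P\to c_{P-1}\to\dots\to c_1\to c_P$, of weight $x_1$; (b) the edges of the oriented cycle $c'_Q\to c'_{Q-1}\to\dots\to c'_1\to c'_Q$, of weight $x_4$; (c) the edges of the oriented cycle visiting all $P+Q$ crossings in the cyclic order of the braid word (from each letter to the next); such an edge has weight $x_2$ if it ends at some $c'_k$ and weight $x_3$ if it ends at some $c_k$. The refined Crowell polynomial $P_{\widetilde G_D,c_1}(x_1,x_2,x_3,x_4)$ is the sum, over all spanning trees of $\widetilde G_D$ rooted at $c_1$ and oriented away from the root (each vertex other than $c_1$ has exactly one incoming tree edge and is reachable from $c_1$), of the product of the weights of the edges of the tree. The integers $A_{i,j}$, for $0\le i\le P-1$ and $0\le j\le Q-1$, are defined by $$P_{\widetilde G_D,c_1}=\sum_{0\le i\le P-1,\ 0\le j\le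 Q-1}A_{i,j}\,x_1^{P-1-i}x_2^{Q-j}x_3^{i}x_4^{j};$$ equivalently, $A_{i,j}$ is the number of such trees with exactly $i$ edges of weight $x_3$ and $j$ edges of weight $x_4$. Setting $x_1=x_2=t$, $x_3=x_4=1$ recovers $\Delta_L(-t)$ up to units.
   Formalization: Printed strictness fails if P>Q (n=1, p=2, q=1, k=0: a_1=a_0=1). Here a_{k+1} ≥ a_k/n + A_{0,k+1} holds for all k ≤ P-2 (A_{0,k+1}=0 if k+1 ≥ Q), the middle ">" is claimed only for k+1 ≤ Q-1, and a_{k+1} > a_k/n also for k+1 ≥ Q if n ≥ 2. *)

theory Defs
  imports
    "HOL-Library.Poly_Mapping"
    "HOL-Computational_Algebra.Polynomial_Factorial"
    "Jordan_Normal_Form.Determinant"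
    "Graph_Theory.Digraph"
begin

section \<open>Braid words\<close>

text \<open>\<open>Sigma i\<close> and \<open>SigmaInv i\<close> are the braid generator
  with index \<open>i\<close> (counted from 1) and its inverse.\<close>

datatype braid_letter = Sigma nat | SigmaInv nat

definition alternating_3braid :: "nat \<Rightarrow> (nat \<Rightarrow> nat) \<Rightarrow> (nat \<Rightarrow> nat) \<Rightarrow> braid_letter list" where
  "alternating_3braid n p q =
     concat (map (\<lambda>i. replicate (p i) (Sigma 1) @ replicate (q i) (SigmaInv 2)) [1..<Suc n])"


section \<open>The Alexander polynomial of a closed braid\<close>

text \<open>The Alexander matrix comes from the Wirtinger presentation of the link group read off the
  standard diagram of the closure of an \<open>N\<close>-strand braid word \<open>w\<close> of length \<open>m\<close>, by Fox calculus
  and abelianization of all meridians to \<open>t\<close>.  The diagram is cut at \<open>m\<close> levels, level \<open>l\<close> just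
  above letter \<open>l\<close>, and level \<open>m\<close> is level \<open>0\<close> because of the closure.  There is a generator
  \<open>x l s\<close> for each level \<open>l\<close> and strand position \<open>s < N\<close> (positions counted from 0); it has
  column index \<open>l * N + s\<close>.  Letter \<open>l\<close> contributes \<open>N\<close> relations:

  \<^item> for \<open>Sigma i\<close> the strand from position \<open>i - 1\<close> to \<open>i\<close> passes over, and the other one gives
    \<open>x (l+1) (i-1) = x l (i-1) * x l i * inverse (x l (i-1))\<close>;

  \<^item> for \<open>SigmaInv i\<close> the strand from position \<open>i\<close> to \<open>i - 1\<close> passes over, and the other one gives
    \<open>x l (i-1) = x l i * x (l+1) i * inverse (x l i)\<close>;

  \<^item> a strand that does not pass under keeps its generator.

  The Fox derivative of \<open>z = o * y * inverse o\<close> is the row \<open>z - (1 - t) o - t y\<close>.  If \<open>m = 1\<close>,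
  both sides of a relation may involve the same generator, whence the sums of indicators.\<close>

definition alexander_matrix :: "nat \<Rightarrow> braid_letter list \<Rightarrow> int poly mat" where
  "alexander_matrix N w =
    (let m = length w; t = [:0, 1:] in
     mat (m * N) (m * N) (\<lambda>(r, c).
       (let l = r div N; s = r mod N;
            x = (\<lambda>l s. if c = (l mod m) * N + s then 1 else 0)
        in case w ! l of
             Sigma i \<Rightarrow>
               (if s = i then x (Suc l) i - x l (i - 1)
                else if s = i - 1 then x (Suc l) (i - 1) - (1 - t) * x l (i - 1) - t * x l i
                else x (Suc l) s - x l s)
           | SigmaInv i \<Rightarrow>
               (if s = i - 1 then x (Suc l) (i - 1) - x l i
                else if s = i then x l (i - 1) - (1 - t) * x l i - t * x (Suc l) i
                else x (Suc l) s - x l s))))"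

text \<open>The gcd of the minors of corank 1, i.e. a generator of the smallest principal ideal
  containing the first elementary ideal.  The gcd in \<open>\<int>[t]\<close> is also a gcd in the localization
  \<open>\<int>[t, 1/t]\<close>, where it is determined up to the units \<open>\<plusminus> t ^ k\<close>.\<close>

definition alexander_gcd :: "nat \<Rightarrow> braid_letter list \<Rightarrow> int poly" where
  "alexander_gcd N w =
     (let A = alexander_matrix N w in
      Gcd {det (mat_delete A r c) | r c. r < dim_row A \<and> c < dim_col A})"

definition equal_up_to_units :: "int poly \<Rightarrow> int poly \<Rightarrow> bool" where
  "equal_up_to_units f g \<longleftrightarrow>
     (\<exists>a b. monom 1 a * f = monom 1 b * g \<or> monom 1 a * f = - (monom 1 b * g))"

definition at_minus_t :: "int poly \<Rightarrow> int poly" where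
  "at_minus_t f = pcompose f [:0, -1:]"

text \<open>At most one representative satisfies the normalization; the value is meaningful only if
  there is one (as there is for alternating links).\<close>

definition alexander_poly :: "nat \<Rightarrow> braid_letter list \<Rightarrow> int poly" where
  "alexander_poly N w =
     (THE \<Delta>. equal_up_to_units \<Delta> (alexander_gcd N w) \<and>
        (\<forall>k. 0 \<le> coeff (at_minus_t \<Delta>) k) \<and> coeff (at_minus_t \<Delta>) 0 \<noteq> 0)"


section \<open>The refined Crowell graph and polynomial\<close>

text \<open>A crossing is represented by its position in the word \<open>w\<close> (from 0), so
  \<open>crossings w (Sigma 1)\<close> lists \<open>c\<^sub>1, \<dots>, c\<^sub>P\<close> and \<open>crossings w (SigmaInv 2)\<close> lists
  \<open>c'\<^sub>1, \<dots>, c'\<^sub>Q\<close>, both shifted to list indices from 0.\<close>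

definition crossings :: "braid_letter list \<Rightarrow> braid_letter \<Rightarrow> nat list" where
  "crossings w g = filter (\<lambda>l. w ! l = g) [0..<length w]"

datatype crowell_arc =
    Cycle1 nat  \<comment> \<open>the \<open>k\<close>-th arc of the cycle through the \<open>c\<^sub>k\<close>\<close>
  | Cycle2 nat  \<comment> \<open>the \<open>k\<close>-th arc of the cycle through the \<open>c'\<^sub>k\<close>\<close>
  | Around nat  \<comment> \<open>the arc leaving letter \<open>l\<close> in the cycle through all letters\<close>

definition crowell_graph :: "braid_letter list \<Rightarrow> (nat, crowell_arc) pre_digraph" where
  "crowell_graph w =
    (let m = length w; cs = crossings w (Sigma 1); ds = crossings w (SigmaInv 2) in
     \<lparr> verts = set cs \<union> set ds,
       arcs = Cycle1 ` {..<length cs} \<union> Cycle2 ` {..<length ds} \<union> Around ` {..<m},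
       tail = (\<lambda>e. case e of
           Cycle1 k \<Rightarrow> cs ! (Suc k mod length cs)
         | Cycle2 k \<Rightarrow> ds ! (Suc k mod length ds)
         | Around l \<Rightarrow> l),
       head = (\<lambda>e. case e of
           Cycle1 k \<Rightarrow> cs ! k
         | Cycle2 k \<Rightarrow> ds ! k
         | Around l \<Rightarrow> Suc l mod m) \<rparr>)"

datatype crowell_var = X1 | X2 | X3 | X4

definition crowell_weight :: "braid_letter list \<Rightarrow> crowell_arc \<Rightarrow> crowell_var" where
  "crowell_weight w e = (case e of
       Cycle1 k \<Rightarrow> X1
     | Cycle2 k \<Rightarrow> X4
     | Around l \<Rightarrow> (if w ! (Suc l mod length w) = SigmaInv 2 then X2 else X3))"

definition rooted_spanning_trees :: "('v, 'e) pre_digraph \<Rightarrow> 'v \<Rightarrow> 'e set set" where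
  "rooted_spanning_trees G r =
     {T. T \<subseteq> arcs G \<and>
         (\<forall>e\<in>T. head G e \<noteq> r) \<and>
         (\<forall>v\<in>verts G. v \<noteq> r \<longrightarrow> (\<exists>!e. e \<in> T \<and> head G e = v)) \<and>
         (\<forall>v\<in>verts G. (r, v) \<in> {(tail G e, head G e) | e. e \<in> T}\<^sup>*)}"

text \<open>Polynomials in \<open>x\<^sub>1, \<dots>, x\<^sub>4\<close> over the integers, as the monoid algebra of exponent vectors.\<close>

type_synonym mpoly4 = "(crowell_var \<Rightarrow>\<^sub>0 nat) \<Rightarrow>\<^sub>0 int"

definition Var :: "crowell_var \<Rightarrow> mpoly4" where
  "Var v = Poly_Mapping.single (Poly_Mapping.single v 1) 1"

definition crowell_poly :: "braid_letter list \<Rightarrow> mpoly4" where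
  "crowell_poly w =
     (\<Sum>T \<in> rooted_spanning_trees (crowell_graph w) (crossings w (Sigma 1) ! 0).
        \<Prod>e\<in>T. Var (crowell_weight w e))"

text \<open>The coefficient of \<open>x\<^sub>1^(P-1-i) x\<^sub>2^(Q-j) x\<^sub>3^i x\<^sub>4^j\<close>; used for \<open>i < P\<close> and \<open>j < Q\<close>.\<close>

definition crowell_coeff :: "braid_letter list \<Rightarrow> nat \<Rightarrow> nat \<Rightarrow> int" where
  "crowell_coeff w i j =
     (let P = length (crossings w (Sigma 1)); Q = length (crossings w (SigmaInv 2)) in
      Poly_Mapping.lookup (crowell_poly w)
        (Poly_Mapping.single X1 (P - 1 - i) + Poly_Mapping.single X2 (Q - j) +
         Poly_Mapping.single X3 i + Poly_Mapping.single X4 j))"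

end

theory Submission
  imports Defs "HOL-Library.Sublist"
begin

text \<open>The determinantal side enters only through a matrix-tree theorem for digraphs in which every
  vertex has two outgoing arcs.  Applied to the Wirtinger presentation of the closed braid it gives
  \<open>a k = (\<Sum>i\<le>k. A i (k - i))\<close> for \<open>k < P\<close>; applied to the Crowell graph it shows that the number
  \<open>N r a j\<close> of trees with root \<open>r\<close> in which \<open>a\<close> letters \<open>\<sigma>\<^sub>1\<close> and \<open>j\<close> letters \<open>\<sigma>\<^sub>2\<^sup>-\<^sup>1\<close> hang on
  the next letter of their kind does not depend on \<open>r\<close>, because the rows and the columns of the
  Laplacian both sum to zero.  Here \<open>A i j = N r (P - 1 - i) j\<close>.

  For \<open>A i j \<le> n * A i (j + 1)\<close>, some letter \<open>\<sigma>\<^sub>2\<^sup>-\<^sup>1\<close> of a tree can be hung on the next letter of its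
  kind without creating a cycle: one of maximal depth among those not yet hung there.  The block of this
  letter determines it, so the map is at most \<open>n\<close>-to-one.

  For the bound on \<open>a (k + 1)\<close> one needs \<open>A i j \<le> n * A (i + 1) j\<close> for \<open>i + j \<le> P - 2\<close>.  Take as root the
  first letter \<open>\<sigma>\<^sub>2\<^sup>-\<^sup>1\<close>, and let \<open>l\<close> be the letter \<open>\<sigma>\<^sub>1\<close> before it.  If \<open>l\<close> hangs on the next letter of
  its kind, moving the root to \<open>l\<close> is injective.  The other trees avoid the first block and correspond to
  subsequences of the rest of the word, with \<open>P - 1 - i\<close> letters \<open>\<sigma>\<^sub>1\<close> and \<open>j - 1\<close> letters \<open>\<sigma>\<^sub>2\<^sup>-\<^sup>1\<close>; such
  a subsequence has two adjacent letters \<open>\<sigma>\<^sub>1\<close>, and deleting one of them is at most \<open>(n - 1)\<close>-to-one.\<close>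

section \<open>A matrix-tree theorem\<close>

text \<open>Every exchange has to avoid cycles. Taking a letter out of \<open>S\<close> can close
  one: the letter before it in its block may hang on it, and it would hang back on that letter. The
  letter just before the first sigma_2^-1 escapes this by becoming the root itself, and that is why
  independence of the root is needed. The condition i + j <= P - 2 is a pigeonhole bound: it gives
  the words two more sigma_1 than sigma_2^-1. The factor n is 1 + (n - 1), from moving the root and
  from the runs of sigma_1 beyond the first block. In column j = 0 the second kind of tree does not
  occur, so the factor there is 1; this yields positivity of that column, and strictness for n >= 2
  once A 0 (k + 1) has left the matrix. On the side of the link, a Wirtinger generator that is not
  an overcrossing arc has a single outgoing arc of nonzero weight, so the digraph contracts to the
  Crowell graph. Its weights are 1 and -t, hence no cancellation occurs at -t.\<close>

inductive leads_to :: "('a \<Rightarrow> 'a) \<Rightarrow> 'a \<Rightarrow> 'a \<Rightarrow> bool" for f r where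
  here: "leads_to f r r"
| step: "leads_to f r (f v) \<Longrightarrow> leads_to f r v"

text \<open>Mostly used for refutation: a set closed under \<open>f\<close> that contains
  \<open>v\<close> and misses \<open>r\<close> traps the walk from \<open>v\<close>.\<close>

lemma leads_to_closed:
  assumes "leads_to f r v" and "v \<in> X" and "\<And>x. x \<in> X \<Longrightarrow> f x \<in> X"
  shows "r \<in> X"
  using assms(1,2) by induction (auto intro: assms(3))

lemma leads_to_funpow: "leads_to f r v \<longleftrightarrow> (\<exists>k. (f ^^ k) v = r)"
proof
  show "leads_to f r v \<Longrightarrow> \<exists>k. (f ^^ k) v = r"
  proof (induction rule: leads_to.induct)
    case here
    show ?case by (rule exI[of _ 0]) simp
  next
    case (step v)
    then obtain k where "(f ^^ k) (f v) = r" by blast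
    then show ?case by (intro exI[of _ "Suc k"]) (simp add: funpow_swap1)
  qed
  assume "\<exists>k. (f ^^ k) v = r"
  then obtain k where "(f ^^ k) v = r" ..
  then show "leads_to f r v"
    by (induction k arbitrary: v) (auto simp: funpow_swap1 intro: leads_to.intros)
qed

lemma leads_to_trans: "leads_to f s v \<Longrightarrow> leads_to f r s \<Longrightarrow> leads_to f r v"
  by (induction rule: leads_to.induct) (auto intro: leads_to.step)

text \<open>Only the identity permutation contributes to the determinant: a permutation moving \<open>v\<close>
  moves \<open>v\<close> to \<open>f v\<close>, hence it also moves \<open>f v\<close>, and so on up to the root.\<close>

lemma det_functional_graph:
  fixes f :: "nat \<Rightarrow> nat"
  assumes r: "r < n" and f: "\<And>v. v < n \<Longrightarrow> f v < n"
  defines "M \<equiv> mat n n (\<lambda>(v, c). if v = r then of_bool (c = r)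
                                else of_bool (c = v) - of_bool (c = f v) :: 'a :: idom)"
  shows "det M = of_bool (\<forall>v<n. leads_to f r v)"
proof (cases "\<forall>v<n. leads_to f r v")
  case True
  have M: "M \<in> carrier_mat n n" by (simp add: M_def)
  have ne: "f v \<noteq> v" if "v < n" "v \<noteq> r" for v
    using leads_to_closed[of f r v "{v}"] True that by auto
  have zero: "(\<Prod>i = 0..<n. M $$ (i, p i)) = 0" if p: "p permutes {0..<n}" "p \<noteq> id" for p
  proof (rule ccontr)
    assume nz: "(\<Prod>i = 0..<n. M $$ (i, p i)) \<noteq> 0"
    have pn: "p i < n" if "i < n" for i using permutes_in_image[OF p(1), of i] that by simp
    have entry: "M $$ (i, p i) \<noteq> 0" if "i < n" for i
      using nz that by (auto simp: prod_zero_iff)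
    have root: "p r = r" using entry[OF r] pn[OF r] r by (auto simp: M_def split: if_splits)
    have move: "p i = f i" if "i < n" "p i \<noteq> i" for i
      using entry[OF that(1)] pn[OF that(1)] that root by (auto simp: M_def split: if_splits)
    obtain v where v: "p v \<noteq> v" using p(2) by (auto simp: fun_eq_iff)
    then have vn: "v < n" using p(1) by (meson atLeastLessThan_iff permutes_not_in zero_le)
    have "r \<in> {v. v < n \<and> p v \<noteq> v}"
    proof (rule leads_to_closed)
      show "leads_to f r v" using True vn by blast
      show "v \<in> {v. v < n \<and> p v \<noteq> v}" using v vn by simp
      fix x assume x: "x \<in> {v. v < n \<and> p v \<noteq> v}"
      then have "p x = f x" using move by blast
      moreover have "p (p x) \<noteq> p x" using x permutes_inj[OF p(1)] by (auto dest: injD)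
      ultimately show "f x \<in> {v. v < n \<and> p v \<noteq> v}" using x f by auto
    qed
    then show False using root by simp
  qed
  have "det M = (\<Sum>p\<in>{p. p permutes {0..<n}}. if p = id then 1 else 0)"
    unfolding det_def'[OF M]
  proof (rule sum.cong[OF refl])
    fix p assume "p \<in> {p. p permutes {0..<n}}"
    moreover have "(\<Prod>i = 0..<n. M $$ (i, i)) = 1"
      by (rule prod.neutral) (use ne in \<open>force simp: M_def r\<close>)
    ultimately show "of_int (sign p) * (\<Prod>i = 0..<n. M $$ (i, p i)) = (if p = id then 1 else 0)"
      using zero[of p] by (auto simp: sign_id)
  qed
  also have "\<dots> = 1"
    by (simp add: finite_permutations permutes_id)
  finally show ?thesis using True by simp
next
  case False
  then obtain u where u: "u < n" "\<not> leads_to f r u" by blast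
  \<comment> \<open>The kernel vector is the indicator of the vertices that miss the root. A vertex
    other than \<open>r\<close> misses the root exactly when its image does, and \<open>r\<close>
    does not miss itself, so every row vanishes on it.\<close>
  define x where "x = vec n (\<lambda>v. of_bool (\<not> leads_to f r v) :: 'a)"
  have inv: "leads_to f r (f v) \<longleftrightarrow> leads_to f r v" if "v \<noteq> r" for v
    using that by (auto intro: leads_to.step elim: leads_to.cases)
  have M: "M \<in> carrier_mat n n" by (simp add: M_def)
  have "x \<noteq> 0\<^sub>v n"
  proof
    assume "x = 0\<^sub>v n"
    then have "x $ u = 0" using u by simp
    then show False using u by (simp add: x_def)
  qed
  moreover have "M *\<^sub>v x = 0\<^sub>v n"
  proof (rule eq_vecI)
    fix v assume "v < dim_vec (0\<^sub>v n :: 'a vec)"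
    then have v: "v < n" by simp
    have "(M *\<^sub>v x) $ v = (\<Sum>c = 0..<n. M $$ (v, c) * x $ c)"
      using v M by (simp add: scalar_prod_def x_def)
    also have "\<dots> = 0"
    proof (cases "v = r")
      case True
      then have "(\<Sum>c = 0..<n. M $$ (v, c) * x $ c) = (\<Sum>c = 0..<n. if c = r then x $ c else 0)"
        using v by (intro sum.cong) (auto simp: M_def)
      then show ?thesis using r by (simp add: x_def leads_to.here)
    next
      case nr: False
      have "(\<Sum>c = 0..<n. M $$ (v, c) * x $ c)
          = (\<Sum>c = 0..<n. (if c = v then x $ c else 0) - (if c = f v then x $ c else 0))"
        using v nr by (intro sum.cong) (auto simp: M_def)
      also have "\<dots> = x $ v - x $ f v"
        using v f[OF v] by (simp add: sum_subtractf)
      finally show ?thesis using v f[OF v] inv[OF nr] by (simp add: x_def)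
    qed
    finally show "(M *\<^sub>v x) $ v = 0\<^sub>v n $ v" using v by simp
  qed (simp add: M_def)
  moreover have "x \<in> carrier_vec n" by (simp add: x_def)
  ultimately have "det M = 0"
    using det_0_iff_vec_prod_zero[OF M] by blast
  then show ?thesis using False by simp
qed

text \<open>\<open>S\<close> is the set of vertices \<open>v\<close> whose chosen outgoing arc is the one to \<open>g v\<close>.\<close>

lemma matrix_tree:
  fixes f g :: "nat \<Rightarrow> nat" and \<alpha> \<beta> :: "nat \<Rightarrow> 'a :: idom"
  assumes r: "r < n" and f: "\<And>v. v < n \<Longrightarrow> f v < n" and g: "\<And>v. v < n \<Longrightarrow> g v < n"
  shows "det (mat n n (\<lambda>(v, c). if v = r then of_bool (c = r)
           else \<alpha> v * (of_bool (c = v) - of_bool (c = f v))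
              + \<beta> v * (of_bool (c = v) - of_bool (c = g v))))
       = (\<Sum>S | S \<subseteq> {..<n} - {r} \<and> (\<forall>v<n. leads_to (\<lambda>v. if v \<in> S then g v else f v) r v).
            \<Prod>v\<in>{..<n} - {r}. if v \<in> S then \<beta> v else \<alpha> v)"
proof -
  define step where "step S v = (if v \<in> S then g v else f v)" for S v
  define row where "row h v c = (if v = r then of_bool (c = r)
     else of_bool (c = v) - of_bool (c = h v) :: 'a)" for h :: "nat \<Rightarrow> nat" and v c
  define wt where "wt S v = (if v = r then 1 else if v \<in> S then \<beta> v else \<alpha> v)" for S v
  let ?M = "mat n n (\<lambda>(v, c). if v = r then of_bool (c = r)
           else \<alpha> v * (of_bool (c = v) - of_bool (c = f v))
              + \<beta> v * (of_bool (c = v) - of_bool (c = g v)))"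
  \<comment> \<open>The root gets the single choice \<open>False\<close>, so choice functions on all
    rows match the subsets that avoid \<open>r\<close>.\<close>
  let ?B = "\<lambda>v. if v = r then {False} else {False, True}"
  let ?Q = "{p. p permutes {0..<n}}"
  have M: "?M \<in> carrier_mat n n" by simp
  \<comment> \<open>Multilinearity in the rows, carried out inside the Leibniz sum: each non-root
    factor is the sum of its two arcs, and multiplying out chooses one arc per vertex.\<close>
  have entry: "(\<Prod>i = 0..<n. ?M $$ (i, p i))
      = (\<Sum>S \<in> Pow ({..<n} - {r}). (\<Prod>i=0..<n. wt S i) * (\<Prod>i=0..<n. row (step S) i (p i)))"
    if p: "p \<in> ?Q" for p
  proof -
    have pn: "p i < n" if "i < n" for i using permutes_in_image[of p "{0..<n}" i] p that by simp
    have "(\<Prod>i = 0..<n. ?M $$ (i, p i)) = (\<Prod>i = 0..<n. \<Sum>b\<in>?B i.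
        wt {v. b} i * row (step {v. b}) i (p i))"
      by (intro prod.cong refl) (auto simp: wt_def row_def step_def pn)
    also have "\<dots> = (\<Sum>h\<in>PiE {0..<n} ?B. \<Prod>i = 0..<n. wt {v. h i} i * row (step {v. h i}) i (p i))"
      by (rule prod_sum_PiE) auto
    also have "\<dots> = (\<Sum>S \<in> Pow ({..<n} - {r}). \<Prod>i=0..<n. wt S i * row (step S) i (p i))"
    proof (rule sum.reindex_bij_witness[where
          i = "\<lambda>S. \<lambda>v\<in>{0..<n}. v \<in> S" and j = "\<lambda>h. {v. v < n \<and> h v}"])
      fix h assume h: "h \<in> PiE {0..<n} ?B"
      have hr: "h r = False" using h r by (auto simp: PiE_iff Ball_def)
      show "(\<lambda>v\<in>{0..<n}. v \<in> {v. v < n \<and> h v}) = h"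
        using h by (auto simp: fun_eq_iff restrict_def PiE_iff extensional_def)
      show "{v. v < n \<and> h v} \<in> Pow ({..<n} - {r})" using hr by auto
      show "(\<Prod>i=0..<n. wt {v. v < n \<and> h v} i * row (step {v. v < n \<and> h v}) i (p i))
          = (\<Prod>i = 0..<n. wt {v. h i} i * row (step {v. h i}) i (p i))"
        by (intro prod.cong refl) (auto simp: wt_def row_def step_def)
    qed (auto simp: PiE_iff extensional_def restrict_def)
    finally show ?thesis by (simp add: prod.distrib)
  qed
  have "det ?M = (\<Sum>p\<in>?Q. \<Sum>S \<in> Pow ({..<n} - {r}).
      (\<Prod>i=0..<n. wt S i) * (of_int (sign p) * (\<Prod>i=0..<n. row (step S) i (p i))))"
    unfolding det_def'[OF M] by (intro sum.cong refl) (simp only: entry sum_distrib_left mult_ac)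
  also have "\<dots> = (\<Sum>S \<in> Pow ({..<n} - {r}). (\<Prod>i=0..<n. wt S i) *
      (\<Sum>p\<in>?Q. of_int (sign p) * (\<Prod>i=0..<n. row (step S) i (p i))))"
    by (subst sum.swap) (simp only: sum_distrib_left)
  also have "\<dots> = (\<Sum>S \<in> Pow ({..<n} - {r}). (\<Prod>i=0..<n. wt S i) *
      of_bool (\<forall>v<n. leads_to (step S) r v))"
  proof (rule sum.cong[OF refl])
    fix S
    have "(\<Sum>p\<in>?Q. of_int (sign p) * (\<Prod>i=0..<n. row (step S) i (p i)))
        = det (mat n n (\<lambda>(v, c). row (step S) v c))"
      unfolding det_def'[OF mat_carrier]
      by (intro sum.cong refl arg_cong2[where f = "(*)"] prod.cong) (auto simp: permutes_in_image)
    also have "\<dots> = of_bool (\<forall>v<n. leads_to (step S) r v)"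
      unfolding row_def using r f g by (intro det_functional_graph) (auto simp: step_def)
    finally show "(\<Prod>i=0..<n. wt S i) * (\<Sum>p\<in>?Q. of_int (sign p) * (\<Prod>i=0..<n. row (step S) i (p i)))
      = (\<Prod>i=0..<n. wt S i) * of_bool (\<forall>v<n. leads_to (step S) r v)" by simp
  qed
  also have "\<dots> = (\<Sum>S | S \<subseteq> {..<n} - {r} \<and> (\<forall>v<n. leads_to (step S) r v). \<Prod>i=0..<n. wt S i)"
    by (intro sum.mono_neutral_cong_right) auto
  also have "\<dots> = (\<Sum>S | S \<subseteq> {..<n} - {r} \<and> (\<forall>v<n. leads_to (step S) r v).
            \<Prod>v\<in>{..<n} - {r}. if v \<in> S then \<beta> v else \<alpha> v)"
  proof (rule sum.cong[OF refl])
    fix S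
    have "(\<Prod>i=0..<n. wt S i) = (\<Prod>i\<in>{..<n} - {r}. wt S i)"
      by (rule prod.mono_neutral_right) (auto simp: wt_def)
    also have "\<dots> = (\<Prod>v\<in>{..<n} - {r}. if v \<in> S then \<beta> v else \<alpha> v)"
      by (rule prod.cong) (auto simp: wt_def)
    finally show "(\<Prod>i=0..<n. wt S i) = (\<Prod>v\<in>{..<n} - {r}. if v \<in> S then \<beta> v else \<alpha> v)" .
  qed
  finally show ?thesis unfolding step_def .
qed

section \<open>Cofactors of a matrix with left and right null vectors\<close>

lemma det_unit_row:
  fixes A :: "'a :: comm_ring_1 mat"
  assumes A: "A \<in> carrier_mat n n" and r: "r < n" "c < n"
  shows "det (mat n n (\<lambda>(i, j). if i = r then of_bool (j = c) else A $$ (i, j))) = cofactor A r c"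
proof -
  let ?M = "mat n n (\<lambda>(i, j). if i = r then of_bool (j = c) else A $$ (i, j))"
  have "mat_delete ?M r j = mat_delete A r j" for j
    using A r by (intro eq_matI) (auto simp: mat_delete_def)
  then have cof: "cofactor ?M r j = cofactor A r j" for j
    by (simp add: cofactor_def)
  have "det ?M = (\<Sum>j<n. ?M $$ (r, j) * cofactor ?M r j)"
    by (rule laplace_expansion_row) (use r in auto)
  also have "\<dots> = (\<Sum>j<n. if j = c then cofactor A r j else 0)"
    by (intro sum.cong refl) (use r in \<open>auto simp: cof\<close>)
  finally show ?thesis using r by simp
qed

lemma det_eq_0_if_row_sums_0:
  fixes A :: "'a :: idom mat"
  assumes A: "A \<in> carrier_mat n n" and n: "0 < n" and "\<And>i. i < n \<Longrightarrow> (\<Sum>j<n. A $$ (i, j)) = 0"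
  shows "det A = 0"
proof -
  have "A *\<^sub>v vec n (\<lambda>_. 1) = 0\<^sub>v n"
    using A assms(3) by (intro eq_vecI) (auto simp: scalar_prod_def lessThan_atLeast0)
  moreover have "vec n (\<lambda>_. 1 :: 'a) \<noteq> 0\<^sub>v n"
  proof
    assume "vec n (\<lambda>_. 1 :: 'a) = 0\<^sub>v n"
    then have "vec n (\<lambda>_. 1 :: 'a) $ 0 = 0\<^sub>v n $ 0" by simp
    then show False using n by simp
  qed
  moreover have "vec n (\<lambda>_. 1 :: 'a) \<in> carrier_vec n" by simp
  ultimately show ?thesis using det_0_iff_vec_prod_zero[OF A] by blast
qed

text \<open>Expanding along row \<open>r\<close> with that row replaced by a difference of two unit vectors gives a
  matrix that still kills the all-ones vector.\<close>

lemma cofactor_col_indep: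
  fixes A :: "'a :: idom mat"
  assumes A: "A \<in> carrier_mat n n" and sums: "\<And>i. i < n \<Longrightarrow> (\<Sum>j<n. A $$ (i, j)) = 0"
    and r: "r < n" "c < n" "c' < n"
  shows "cofactor A r c = cofactor A r c'"
proof -
  let ?M = "mat n n (\<lambda>(i, j). if i = r then of_bool (j = c) - of_bool (j = c') else A $$ (i, j))"
  have "mat_delete ?M r j = mat_delete A r j" for j
    using A r by (intro eq_matI) (auto simp: mat_delete_def)
  then have cof: "cofactor ?M r j = cofactor A r j" for j
    by (simp add: cofactor_def)
  have "(0 :: 'a) = det ?M"
  proof (rule det_eq_0_if_row_sums_0[symmetric])
    fix i assume i: "i < n"
    show "(\<Sum>j<n. ?M $$ (i, j)) = 0"
      using i r sums[OF i] by (cases "i = r") (auto simp: sum_subtractf of_bool_def)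
  qed (use r in auto)
  also have "\<dots> = (\<Sum>j<n. ?M $$ (r, j) * cofactor ?M r j)"
    by (rule laplace_expansion_row) (use r in auto)
  also have "\<dots> = (\<Sum>j<n. (if j = c then cofactor A r j else 0) - (if j = c' then cofactor A r j else 0))"
    by (intro sum.cong refl) (use r in \<open>auto simp: cof\<close>)
  finally show ?thesis using r by (simp add: sum_subtractf)
qed

lemma cofactor_transpose:
  assumes A: "A \<in> carrier_mat n n" and "r < n" "c < n"
  shows "cofactor (transpose_mat A) c r = cofactor A r c"
proof -
  have "mat_delete (transpose_mat A) c r = transpose_mat (mat_delete A r c)"
    using A assms by (intro eq_matI) (auto simp: mat_delete_def)
  moreover have "mat_delete A r c \<in> carrier_mat (n - 1) (n - 1)"
    using A by (auto simp: mat_delete_def)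
  ultimately show ?thesis by (simp add: cofactor_def det_transpose add.commute)
qed

text \<open>Transposed and weighted counterpart of \<open>cofactor_col_indep\<close>: the new row of
  the transpose is chosen orthogonal to the left null vector \<open>w\<close>. Weights occur because
  the rows of the Alexander matrix are dependent only with coefficients that are powers of t up to
  sign.\<close>

lemma cofactor_row_proportional:
  fixes A :: "'a :: idom mat"
  assumes A: "A \<in> carrier_mat n n" and null: "\<And>j. j < n \<Longrightarrow> (\<Sum>i<n. w i * A $$ (i, j)) = 0"
    and w: "\<And>i. i < n \<Longrightarrow> w i \<noteq> 0"
    and r: "r < n" "r' < n" "c < n"
  shows "w r' * cofactor A r c = w r * cofactor A r' c"
proof -
  let ?M = "mat n n (\<lambda>(j, i). if j = c then w r' * of_bool (i = r) - w r * of_bool (i = r')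
                               else A $$ (i, j))"
  have "mat_delete ?M c i = mat_delete (transpose_mat A) c i" for i
    using A r by (intro eq_matI) (auto simp: mat_delete_def)
  then have cof: "cofactor ?M c i = cofactor A i c" if "i < n" for i
    using cofactor_transpose[OF A that r(3)] by (simp add: cofactor_def)
  have "?M *\<^sub>v vec n w = 0\<^sub>v n"
  proof (rule eq_vecI)
    fix j assume "j < dim_vec (0\<^sub>v n :: 'a vec)"
    then have j: "j < n" by simp
    have "(?M *\<^sub>v vec n w) $ j = (\<Sum>i<n. ?M $$ (j, i) * w i)"
      using j by (simp add: scalar_prod_def lessThan_atLeast0)
    also have "\<dots> = 0"
    proof (cases "j = c")
      case True
      have "(\<Sum>i<n. ?M $$ (j, i) * w i)
          = (\<Sum>i<n. (if i = r then w r' * w i else 0) - (if i = r' then w r * w i else 0))"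
        using j True by (intro sum.cong) auto
      then show ?thesis using r by (simp add: sum_subtractf)
    next
      case False
      then show ?thesis using null[OF j] j by (simp add: mult.commute)
    qed
    finally show "(?M *\<^sub>v vec n w) $ j = 0\<^sub>v n $ j" using j by simp
  qed simp
  moreover have "vec n w \<noteq> 0\<^sub>v n"
  proof
    assume "vec n w = 0\<^sub>v n"
    then have "vec n w $ r = 0\<^sub>v n $ r" by simp
    then show False using w r by simp
  qed
  moreover have "vec n w \<in> carrier_vec n" by simp
  ultimately have "det ?M = 0"
    using det_0_iff_vec_prod_zero[of ?M n] by (meson mat_carrier)
  then have "0 = det ?M" ..
  also have "\<dots> = (\<Sum>i<n. ?M $$ (c, i) * cofactor ?M c i)"
    by (rule laplace_expansion_row) (use r in auto)
  also have "\<dots> = (\<Sum>i<n. (if i = r then w r' * cofactor A i c else 0)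
                      - (if i = r' then w r * cofactor A i c else 0))"
    by (intro sum.cong refl) (use r in \<open>auto simp: cof\<close>)
  finally show ?thesis using r by (simp add: sum_subtractf)
qed

section \<open>Redirecting one arc of a functional graph, and depth\<close>

lemma leads_to_next: "leads_to f r v \<Longrightarrow> v \<noteq> r \<Longrightarrow> leads_to f r (f v)"
  by (erule leads_to.cases) auto

text \<open>A walk may end as soon as it meets \<open>r\<close>, so the value at \<open>r\<close> is
  free. This reconciles \<open>par\<close>, which fixes the root, with the step function in
  \<open>matrix_tree\<close>.\<close>

lemma leads_to_cong:
  assumes "leads_to f r v" and "\<And>x. x \<noteq> r \<Longrightarrow> f x = g x"
  shows "leads_to g r v"
  using assms(1)
proof induction
  case (step v)
  then show ?case using assms(2)[of v] by (cases "v = r") (auto intro: leads_to.intros)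
qed (rule leads_to.here)

text \<open>A new arc from \<open>v\<close> to \<open>x\<close> closes a cycle only if the old walk
  from \<open>x\<close> passes through \<open>v\<close>. Otherwise that walk survives unchanged and
  serves every walk that used to pass through \<open>v\<close>.\<close>

lemma leads_to_upd:
  assumes f: "leads_to f r u" and x: "leads_to f r x" and nx: "\<not> leads_to f v x"
  shows "leads_to (f(v := x)) r u"
proof -
  have avoid: "leads_to f r u \<Longrightarrow> \<not> leads_to f v u \<Longrightarrow> leads_to (f(v := x)) r u" for u
  proof (induction rule: leads_to.induct)
    case (step u)
    then have "u \<noteq> v" "\<not> leads_to f v (f u)" by (auto intro: leads_to.intros)
    then show ?case using step by (auto intro: leads_to.step)
  qed (rule leads_to.here)
  show ?thesis
    using f
  proof induction
    case (step u)
    show ?case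
    proof (cases "u = v")
      case True
      then have "leads_to (f(v := x)) r ((f(v := x)) u)" using avoid[OF x nx] by (simp only: fun_upd_same)
      then show ?thesis by (rule leads_to.step)
    next
      case False
      have "leads_to (f(v := x)) r ((f(v := x)) u)"
        unfolding fun_upd_other[OF False] by (rule step.IH)
      then show ?thesis by (rule leads_to.step)
    qed
  qed (rule leads_to.here)
qed

definition steps_to :: "('a \<Rightarrow> 'a) \<Rightarrow> 'a \<Rightarrow> 'a \<Rightarrow> nat" where
  "steps_to f r u = (LEAST k. (f ^^ k) u = r)"

text \<open>Since \<open>f r = r\<close>, the walk from \<open>u\<close> never leaves the root again
  and must meet \<open>v\<close> before arriving there; the steps from \<open>u\<close> to
  \<open>v\<close> come on top of the depth of \<open>v\<close>.\<close>

lemma steps_to_less: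
  assumes r: "f r = r" and u: "leads_to f r u" and vu: "leads_to f v u" and ne: "u \<noteq> v" "v \<noteq> r"
  shows "steps_to f r v < steps_to f r u"
proof -
  obtain k where k: "(f ^^ k) u = v" using vu leads_to_funpow by metis
  have "\<exists>k. (f ^^ k) u = r" using u leads_to_funpow by metis
  then have du: "(f ^^ steps_to f r u) u = r" unfolding steps_to_def by (rule LeastI_ex)
  have fix_r: "(f ^^ i) r = r" for i by (induction i) (simp_all add: r)
  have k0: "k \<noteq> 0" using k ne(1) by (metis funpow_0)
  have "k < steps_to f r u"
  proof (rule ccontr)
    assume "\<not> k < steps_to f r u"
    then obtain i where "k = i + steps_to f r u" by (metis add.commute le_Suc_ex not_less)
    then have "(f ^^ k) u = r" by (simp add: funpow_add du fix_r)
    then show False using k ne by simp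
  qed
  then obtain i where i: "steps_to f r u = i + k" by (metis add.commute less_imp_add_positive)
  then have "(f ^^ i) v = r" using du k by (simp add: funpow_add)
  then have "steps_to f r v \<le> i" unfolding steps_to_def by (rule Least_le)
  then show ?thesis using i k0 by simp
qed

section \<open>Subsequences\<close>

text \<open>Describes the leftmost embedding of a word: a skipped position never carries the letter
  that is selected next, for otherwise that letter could have been matched earlier.\<close>

fun greedy :: "('a \<Rightarrow> bool) \<Rightarrow> 'a set \<Rightarrow> 'a list \<Rightarrow> bool" where
  "greedy c S [] \<longleftrightarrow> True"
| "greedy c S (y # ys) \<longleftrightarrow> greedy c S ys \<and>
     (y \<in> S \<or> (case filter (\<lambda>x. x \<in> S) ys of [] \<Rightarrow> True | x # _ \<Rightarrow> c x \<noteq> c y))"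

lemma greedy_cong:
  assumes "\<And>y. y \<in> set ys \<Longrightarrow> y \<in> S \<longleftrightarrow> y \<in> S'"
  shows "greedy c S ys = greedy c S' ys"
  using assms
proof (induction ys)
  case (Cons y ys)
  have "filter (\<lambda>x. x \<in> S) ys = filter (\<lambda>x. x \<in> S') ys"
    using Cons.prems by (intro filter_cong) auto
  then show ?case using Cons by simp
qed simp

text \<open>A word has only one leftmost embedding: at the first position selected by just one of
  the two sets, the other set skips a letter equal to the one it selects next.\<close>

lemma greedy_inj:
  assumes "greedy c S ys" "greedy c S' ys"
    and "map c (filter (\<lambda>x. x \<in> S) ys) = map c (filter (\<lambda>x. x \<in> S') ys)"
    and "y \<in> set ys"
  shows "y \<in> S \<longleftrightarrow> y \<in> S'"
  using assms
proof (induction ys)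
  case (Cons z ys)
  have differ: False if "greedy c T' (z # ys)" "z \<in> T" "z \<notin> T'"
    "map c (filter (\<lambda>x. x \<in> T) (z # ys)) = map c (filter (\<lambda>x. x \<in> T') (z # ys))" for T T'
    using that by (cases "filter (\<lambda>x. x \<in> T') ys") auto
  have "z \<in> S \<longleftrightarrow> z \<in> S'"
    using differ[of S' S] differ[of S S'] Cons.prems(1-3) by metis
  then show ?case using Cons by (auto split: if_splits)
qed simp

text \<open>Match the first letter of \<open>v\<close> as soon as it occurs.\<close>

lemma greedy_ex:
  assumes "subseq v (map c ys)" "distinct ys"
  shows "\<exists>S \<subseteq> set ys. greedy c S ys \<and> map c (filter (\<lambda>x. x \<in> S) ys) = v"
  using assms
proof (induction ys arbitrary: v)
  case Nil
  then show ?case by (auto dest: list_emb_Nil2)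
next
  case (Cons y ys)
  show ?case
  proof (cases "v \<noteq> [] \<and> hd v = c y")
    case True
    then obtain v' where v: "v = c y # v'" by (cases v) auto
    then have "subseq v' (map c ys)" using Cons.prems(1) by simp
    then obtain S where S: "S \<subseteq> set ys" "greedy c S ys" "map c (filter (\<lambda>x. x \<in> S) ys) = v'"
      using Cons by auto
    have eq: "filter (\<lambda>x. x \<in> insert y S) ys = filter (\<lambda>x. x \<in> S) ys"
      using Cons.prems(2) by (intro filter_cong) auto
    have "greedy c (insert y S) ys"
      using S(2) Cons.prems(2) greedy_cong[of ys S "insert y S" c] by auto
    then show ?thesis using S eq v by (intro exI[of _ "insert y S"]) auto
  next
    case False
    then have "subseq v (map c ys)"
      using Cons.prems(1) by (cases v) auto
    then obtain S where S: "S \<subseteq> set ys" "greedy c S ys" "map c (filter (\<lambda>x. x \<in> S) ys) = v"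
      using Cons by auto
    have "y \<notin> S" using S(1) Cons.prems(2) by auto
    then show ?thesis using S False by (intro exI[of _ S]) (auto split: list.splits)
  qed
qed

text \<open>The flag \<open>p\<close> is the letter in front of the list; a run that is already
  going on there is not counted again.\<close>

fun nruns :: "bool \<Rightarrow> bool list \<Rightarrow> nat" where
  "nruns p [] = 0"
| "nruns p (x # xs) = of_bool (x \<and> \<not> p) + nruns x xs"

lemma nruns_change: "nruns p xs \<le> of_bool (x \<and> \<not> p) + nruns x xs"
  by (cases xs) auto

text \<open>If dropping a letter \<open>y\<close> makes the rest gain a run, then \<open>y\<close>
  itself had started one.\<close>

lemma nruns_subseq: "subseq v xs \<Longrightarrow> nruns p v \<le> nruns p xs"
proof (induction arbitrary: p rule: list_emb.induct)
  case (list_emb_Cons xs ys y)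
  have "nruns p xs \<le> of_bool (y \<and> \<not> p) + nruns y xs" by (rule nruns_change)
  also have "\<dots> \<le> of_bool (y \<and> \<not> p) + nruns y ys" using list_emb_Cons by simp
  finally show ?case by simp
qed auto

text \<open>\<open>dups p xs\<close> lists the words obtained by lengthening one of the runs of \<open>True\<close> in \<open>xs\<close>.\<close>

fun dups :: "bool \<Rightarrow> bool list \<Rightarrow> bool list list" where
  "dups p [] = []"
| "dups p (x # xs) = (if x \<and> \<not> p then [x # x # xs] else []) @ map ((#) x) (dups x xs)"

lemma length_dups: "length (dups p xs) = nruns p xs"
  by (induction p xs rule: dups.induct) auto

text \<open>Pigeonhole: \<open>j\<close> letters \<open>False\<close> leave \<open>j + 1\<close>
  gaps for at least \<open>j + 2\<close> letters \<open>True\<close>. The induction drops a leading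
  \<open>False\<close> or a leading \<open>True\<close>, \<open>False\<close>, neither of which
  lowers the surplus.\<close>

lemma dups_ex:
  assumes "length (filter Not v) + 2 \<le> length (filter (\<lambda>x. x) v)"
  shows "\<exists>v'. v \<in> set (dups False v') \<and> subseq v' v \<and>
    Suc (length (filter (\<lambda>x. x) v')) = length (filter (\<lambda>x. x) v) \<and> length (filter Not v') = length (filter Not v)"
  using assms
proof (induction v rule: induct_list012)
  case (3 x y zs)
  show ?case
  proof (cases x)
    case False
    then have "length (filter Not (y # zs)) + 2 \<le> length (filter (\<lambda>x. x) (y # zs))" using 3(3) by simp
    from 3(2)[OF this] obtain v' where "y # zs \<in> set (dups False v')" "subseq v' (y # zs)"
        "Suc (length (filter (\<lambda>x. x) v')) = length (filter (\<lambda>x. x) (y # zs))"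
        "length (filter Not v') = length (filter Not (y # zs))"
      by blast
    then show ?thesis using False by (intro exI[of _ "False # v'"]) auto
  next
    case x: True
    show ?thesis
    proof (cases y)
      case True
      then show ?thesis using x by (intro exI[of _ "True # zs"]) auto
    next
      case False
      then have "length (filter Not zs) + 2 \<le> length (filter (\<lambda>x. x) zs)" using 3(3) x by simp
      from 3(1)[OF this] obtain v' where "zs \<in> set (dups False v')" "subseq v' zs"
          "Suc (length (filter (\<lambda>x. x) v')) = length (filter (\<lambda>x. x) zs)"
          "length (filter Not v') = length (filter Not zs)"
        by blast
      then show ?thesis using False x by (intro exI[of _ "True # False # v'"]) auto
    qed
  qed
qed (auto split: if_splits)

definition words :: "bool list \<Rightarrow> nat \<Rightarrow> nat \<Rightarrow> bool list set" where
  "words ys a j = {v. subseq v ys \<and> length (filter (\<lambda>x. x) v) = a \<and> length (filter Not v) = j}"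

lemma finite_words: "finite (words ys a j)"
proof (rule finite_subset)
  show "words ys a j \<subseteq> set (subseqs ys)" by (auto simp: words_def set_subseqs_eq)
qed simp

text \<open>A word with more than enough letters \<open>True\<close> contains two adjacent ones; deleting one of them
  is at most as many-to-one as there are runs to put it back.\<close>

lemma card_words_Suc_le:
  assumes "j + 1 \<le> a"
  shows "card (words ys (Suc a) j) \<le> nruns False ys * card (words ys a j)"
proof -
  have "words ys (Suc a) j \<subseteq> (\<Union>v'\<in>words ys a j. set (dups False v'))"
  proof
    fix v assume v: "v \<in> words ys (Suc a) j"
    then have "length (filter Not v) + 2 \<le> length (filter (\<lambda>x. x) v)" using assms by (simp add: words_def)
    from dups_ex[OF this] obtain v' where v': "v \<in> set (dups False v')" "subseq v' v"
      "Suc (length (filter (\<lambda>x. x) v')) = length (filter (\<lambda>x. x) v)" "length (filter Not v') = length (filter Not v)"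
      by blast
    then have "v' \<in> words ys a j"
      using v subseq_order.order_trans[of v' v ys] by (simp add: words_def)
    then show "v \<in> (\<Union>v'\<in>words ys a j. set (dups False v'))" using v' by blast
  qed
  then have "card (words ys (Suc a) j) \<le> card (\<Union>v'\<in>words ys a j. set (dups False v'))"
    by (intro card_mono) (auto simp: finite_words)
  also have "\<dots> \<le> (\<Sum>v'\<in>words ys a j. card (set (dups False v')))"
    by (rule card_UN_le) (rule finite_words)
  also have "\<dots> \<le> (\<Sum>v'\<in>words ys a j. nruns False ys)"
  proof (rule sum_mono)
    fix v' assume "v' \<in> words ys a j"
    then have "nruns False v' \<le> nruns False ys" by (intro nruns_subseq) (simp add: words_def)
    then show "card (set (dups False v')) \<le> nruns False ys"
      using card_length[of "dups False v'"] by (simp add: length_dups)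
  qed
  finally show ?thesis by (simp add: mult.commute)
qed

section \<open>Trees in the Crowell graph of a cyclic word\<close>

text \<open>\<open>c v\<close> says that letter \<open>v\<close> of the cyclic word of length \<open>m\<close> is \<open>\<sigma>\<^sub>1\<close>.  A spanning tree with root
  \<open>r\<close> is encoded by the set \<open>S\<close> of those vertices other than \<open>r\<close> whose parent is the next letter of the
  same kind; the parent of any other vertex is the previous letter.\<close>

locale cyclic_word =
  fixes m :: nat and c :: "nat \<Rightarrow> bool"
  assumes c_first: "c 0" and c_last: "\<not> c (m - 1)"
begin

lemma m_ge_2: "2 \<le> m"
proof -
  have "m - 1 \<noteq> 0" using c_first c_last by metis
  then show ?thesis by simp
qed

definition pred :: "nat \<Rightarrow> nat" where
  "pred v = (if v = 0 then m - 1 else v - 1)"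

definition nxt :: "nat \<Rightarrow> nat" where
  "nxt v = (if \<exists>x>v. x < m \<and> c x = c v then LEAST x. v < x \<and> x < m \<and> c x = c v
            else LEAST x. x < m \<and> c x = c v)"

text \<open>The root is its own parent, so walks stay there and \<open>steps_to\<close> measures
  depth.\<close>

definition par :: "nat \<Rightarrow> nat set \<Rightarrow> nat \<Rightarrow> nat" where
  "par r S v = (if v = r then r else if v \<in> S then nxt v else pred v)"

definition tree :: "nat \<Rightarrow> nat set \<Rightarrow> bool" where
  "tree r S \<longleftrightarrow> S \<subseteq> {..<m} - {r} \<and> (\<forall>v<m. leads_to (par r S) r v)"

definition trees :: "nat \<Rightarrow> nat \<Rightarrow> nat \<Rightarrow> nat set set" where
  "trees r a j = {S. tree r S \<and> card {v \<in> S. c v} = a \<and> card {v \<in> S. \<not> c v} = j}"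

definition N :: "nat \<Rightarrow> nat \<Rightarrow> nat \<Rightarrow> nat" where
  "N r a j = card (trees r a j)"

text \<open>A block of sigma_1 is represented by its last letter; the word ends in the other kind,
  so every block has such a letter with a successor.\<close>

definition blocks :: "nat set" where
  "blocks = {v. Suc v < m \<and> c v \<and> \<not> c (Suc v)}"

definition first_d :: nat where
  "first_d = (LEAST x. x < m \<and> \<not> c x)"

lemma tree_sub: "tree r S \<Longrightarrow> x \<in> S \<Longrightarrow> x < m" "tree r S \<Longrightarrow> r \<notin> S"
  by (auto simp: tree_def)

lemma tree_finite: "tree r S \<Longrightarrow> finite S"
  by (auto simp: tree_def intro: finite_subset)

lemma finite_trees: "finite (trees r a j)"
  by (rule finite_subset[of _ "Pow {..<m}"]) (auto simp: trees_def tree_def)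

lemma tree_closed:
  assumes "tree r S" "v < m" "v \<in> X" "\<And>x. x \<in> X \<Longrightarrow> par r S x \<in> X"
  shows "r \<in> X"
  using assms leads_to_closed[of "par r S" r v X] by (auto simp: tree_def)

lemma first_d: "first_d < m" "\<not> c first_d" "0 < first_d" "x < first_d \<Longrightarrow> c x"
proof -
  have ex: "m - 1 < m \<and> \<not> c (m - 1)" using m_ge_2 c_last by simp
  have "first_d < m \<and> \<not> c first_d" 
    unfolding first_d_def using LeastI[of "\<lambda>x. x < m \<and> \<not> c x", OF ex] .
  then show 1: "first_d < m" "\<not> c first_d" by auto
  then show "0 < first_d" using c_first by (cases first_d) auto
  show "c x" if "x < first_d"
    using not_less_Least[of x "\<lambda>x. x < m \<and> \<not> c x"] that 1 by (auto simp: first_d_def)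
qed

lemma nxt_later:
  assumes "v < x" "x < m" "c x = c v"
  shows "v < nxt v" "nxt v \<le> x" "c (nxt v) = c v"
proof -
  have eq: "nxt v = (LEAST x. v < x \<and> x < m \<and> c x = c v)" using assms by (auto simp: nxt_def)
  have "v < nxt v \<and> nxt v < m \<and> c (nxt v) = c v"
    unfolding eq by (rule LeastI[of _ x]) (use assms in simp)
  then show "v < nxt v" "c (nxt v) = c v" by auto
  show "nxt v \<le> x" unfolding eq by (rule Least_le) (use assms in simp)
qed

lemma nxt_wrap:
  assumes "v < m" "\<And>x. v < x \<Longrightarrow> x < m \<Longrightarrow> c x \<noteq> c v"
  shows "nxt v = (if c v then 0 else first_d)"
proof -
  have eq: "nxt v = (LEAST x. x < m \<and> c x = c v)" using assms by (auto simp: nxt_def)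
  show ?thesis
  proof (cases "c v")
    case True
    then show ?thesis unfolding eq using m_ge_2 c_first by (auto intro: Least_equality)
  next
    case False
    then show ?thesis unfolding eq first_d_def by simp
  qed
qed

lemma nxt_cases:
  assumes "v < m"
  obtains (later) "v < nxt v" "nxt v < m" "\<And>x. v < x \<Longrightarrow> x < nxt v \<Longrightarrow> c x \<noteq> c v"
  | (wrap) "\<And>x. v < x \<Longrightarrow> x < m \<Longrightarrow> c x \<noteq> c v" "nxt v = (if c v then 0 else first_d)" "nxt v \<le> v"
proof (cases "\<exists>x>v. x < m \<and> c x = c v")
  case True
  then obtain x where x: "v < x" "x < m" "c x = c v" by blast
  have "c y \<noteq> c v" if "v < y" "y < nxt v" for y
    using nxt_later(2)[of v y] nxt_later(2)[OF x] that x by auto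
  then show ?thesis using that(1) nxt_later[OF x] x by force
next
  case False
  then have eq: "nxt v = (if c v then 0 else first_d)" using nxt_wrap assms by blast
  have "first_d \<le> v" if "\<not> c v" using first_d(4) that not_le_imp_less by blast
  then show ?thesis using that(2) False eq by auto
qed

lemma nxt_lt:
  assumes "v < m"
  shows "nxt v < m"
  by (cases rule: nxt_cases[OF assms]) (use first_d(1) m_ge_2 in auto)

lemma c_nxt: "v < m \<Longrightarrow> c (nxt v) = c v"
proof (cases "\<exists>x>v. x < m \<and> c x = c v")
  case True
  then show ?thesis using nxt_later(3) by blast
next
  case False
  assume "v < m"
  with False have "nxt v = (if c v then 0 else first_d)" using nxt_wrap by blast
  then show ?thesis using c_first first_d by auto
qed

lemma pred_lt: "v < m \<Longrightarrow> pred v < m"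
  by (auto simp: pred_def)

lemma par_lt: "v < m \<Longrightarrow> par r S v < m"
  using nxt_lt pred_lt by (simp add: par_def)

text \<open>Injectivity makes \<open>nxt\<close> a permutation of the vertices, as needed for the
  column sums of the Laplacian.\<close>

lemma nxt_inj: "inj_on nxt {..<m}"
proof (rule linorder_inj_onI)
  fix v w assume vw: "v < w" "v \<in> {..<m}" "w \<in> {..<m}"
  show "nxt v \<noteq> nxt w"
  proof
    assume eq: "nxt v = nxt w"
    then have cc: "c w = c v" using c_nxt vw by (metis lessThan_iff)
    then have "v < nxt v" "nxt v \<le> w" using nxt_later[of v w] vw by auto
    moreover from vw(3) have "w < nxt w \<or> nxt w \<le> v"
      unfolding lessThan_iff
    proof (cases rule: nxt_cases)
      case wrap
      have "first_d \<le> v" if "\<not> c v" using first_d(4) that not_le_imp_less by blast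
      then show ?thesis using wrap(2) cc by (cases "c v") simp_all
    qed simp
    ultimately show False using eq by simp
  qed
qed auto

lemma pred_inj: "inj_on pred {..<m}"
  by (auto simp: inj_on_def pred_def split: if_splits)

text \<open>The walk from \<open>s\<close> jumps to \<open>nxt s\<close>, and the letters in
  between, all hanging on their predecessors, lead it back to \<open>s\<close>: a cycle that misses
  the root.\<close>

lemma no_backtrack:
  assumes t: "tree r S" and s: "s \<in> S" and z: "s < nxt s" "nxt s < m"
    and un: "\<And>x. s < x \<Longrightarrow> x \<le> nxt s \<Longrightarrow> x \<notin> S \<and> x \<noteq> r"
  shows False
proof -
  have "r \<in> {s..nxt s}"
  proof (rule tree_closed[OF t])
    fix x assume x: "x \<in> {s..nxt s}"
    show "par r S x \<in> {s..nxt s}"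
    proof (cases "x = s")
      case True
      then show ?thesis using s z tree_sub[OF t] by (auto simp: par_def)
    next
      case False
      then show ?thesis using un[of x] x by (auto simp: par_def pred_def)
    qed
  qed (use z in auto)
  moreover have "r \<noteq> s" using s tree_sub[OF t] by auto
  ultimately show False using un[of r] by auto
qed

lemma no_adjacent_backtrack:
  assumes "tree r S" "s \<in> S" "Suc s \<notin> S" "Suc s < m" "c (Suc s) = c s" "Suc s \<noteq> r"
  shows False
proof -
  have "nxt s = Suc s" using nxt_later[of s "Suc s"] assms by auto
  then show False using no_backtrack[OF assms(1,2)] assms by (metis Suc_leI le_antisym lessI)
qed

subsection \<open>Exchanging the arc at a letter of the second kind\<close>

text \<open>The letters of the second kind form a single orbit of \<open>nxt\<close>:
  \<open>up\<close> climbs to \<open>x\<close> directly, \<open>down\<close> climbs past the last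
  letter of the kind and continues at \<open>first_d\<close>.\<close>

lemma nxt_leads_d:
  assumes "v < m" "x < m" "\<not> c v" "\<not> c x"
  shows "leads_to nxt x v"
proof -
  have up: "leads_to nxt x v" if "v \<le> x" "v < m" "\<not> c v" for v
    using that
  proof (induction "x - v" arbitrary: v rule: less_induct)
    case less
    show ?case
    proof (cases "v = x")
      case True
      then show ?thesis by (simp add: leads_to.here)
    next
      case False
      then have vx: "v < x" using less.prems by simp
      then have n: "v < nxt v" "nxt v \<le> x" "c (nxt v) = c v"
        using nxt_later[of v x] less.prems assms by auto
      then have "leads_to nxt x (nxt v)"
        using less.hyps[of "nxt v"] vx assms less.prems by auto
      then show ?thesis by (rule leads_to.step)
    qed
  qed
  have down: "leads_to nxt x v" if "v < m" "\<not> c v" for v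
    using that
  proof (induction "m - v" arbitrary: v rule: less_induct)
    case less
    from less.prems(1) show ?case
    proof (cases rule: nxt_cases)
      case later
      then have "leads_to nxt x (nxt v)" using less.hyps[of "nxt v"] less.prems c_nxt[of v] by simp
      then show ?thesis by (rule leads_to.step)
    next
      case wrap
      have "first_d \<le> x" using first_d(4) assms(4) not_le_imp_less by blast
      then have "leads_to nxt x (nxt v)" using up[of first_d] first_d wrap less.prems by auto
      then show ?thesis by (rule leads_to.step)
    qed
  qed
  show ?thesis using down assms by blast
qed

text \<open>If every insertion closed a cycle, \<open>nxt v\<close> would descend from
  \<open>v\<close> for each candidate \<open>v\<close>. Below a candidate of maximal depth there is
  no other candidate, so all other letters of the second kind below it hang on their
  \<open>nxt\<close>. Following \<open>nxt\<close> from \<open>v\<close> then never leaves the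
  descendants of \<open>v\<close>, yet it visits the second candidate.\<close>

lemma tree_insert_ex:
  assumes t: "tree r S" and r: "r < m"
    and two: "card {v. v < m \<and> \<not> c v \<and> v \<notin> S \<and> v \<noteq> r} \<ge> 2"
  shows "\<exists>v<m. \<not> c v \<and> v \<notin> S \<and> v \<noteq> r \<and> tree r (insert v S)"
proof (rule ccontr)
  assume none: "\<not> ?thesis"
  define D where "D = {v. v < m \<and> \<not> c v \<and> v \<notin> S \<and> v \<noteq> r}"
  define f where "f = par r S"
  have D: "v < m" "\<not> c v" "v \<notin> S" "v \<noteq> r" if "v \<in> D" for v using that by (auto simp: D_def)
  have DI: "v \<in> D" if "v < m" "\<not> c v" "v \<notin> S" "v \<noteq> r" for v using that by (simp add: D_def)
  have all: "leads_to f r v" if "v < m" for v using t that by (simp add: tree_def f_def)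
  have bad: "leads_to f v (nxt v)" if v: "v \<in> D" for v
  proof (rule ccontr)
    assume nl: "\<not> leads_to f v (nxt v)"
    have eq: "par r (insert v S) = f(v := nxt v)" using D[OF v] by (auto simp: par_def f_def fun_eq_iff)
    have "leads_to (f(v := nxt v)) r u" if "u < m" for u
      by (rule leads_to_upd[OF all[OF that] all[OF nxt_lt] nl]) (use D[OF v] in simp)
    moreover have "insert v S \<subseteq> {..<m} - {r}" using t D[OF v] by (simp add: tree_def)
    ultimately have "tree r (insert v S)" unfolding tree_def eq by blast
    then show False using none D[OF v] by metis
  qed
  have fin: "finite D" by (simp add: D_def)
  have card: "card D \<ge> 2" using two by (simp add: D_def)
  then have ne: "D \<noteq> {}" by auto
  have "Max (steps_to f r ` D) \<in> steps_to f r ` D" using fin ne by (intro Max_in) auto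
  then obtain v where vm: "Max (steps_to f r ` D) = steps_to f r v" and v: "v \<in> D" by (rule imageE)
  have vmax: "steps_to f r u \<le> steps_to f r v" if "u \<in> D" for u
    unfolding vm[symmetric] using fin that by (intro Max_ge) simp_all
  have "\<not> D \<subseteq> {v}" using card card_mono[of "{v}" D] by auto
  then obtain x where x: "x \<in> D" "x \<noteq> v" by blast
  have rfix: "f r = r" by (simp add: par_def f_def)
  have max_desc: "u = v" if "u \<in> D" "leads_to f v u" for u
  proof (rule ccontr)
    assume "u \<noteq> v"
    then have "steps_to f r v < steps_to f r u"
      by (intro steps_to_less[OF rfix all that(2)]) (use D[OF that(1)] D[OF v] in auto)
    then show False using vmax[OF that(1)] by simp
  qed
  \<comment> \<open>Read backwards along the orbit: if \<open>nxt u\<close> does not descend from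
    \<open>v\<close>, neither does \<open>u\<close>. The induction starts at the second candidate
    \<open>x\<close> and ends with the absurd claim for \<open>v\<close> itself.\<close>
  have "u < m \<longrightarrow> \<not> c u \<longrightarrow> leads_to f v u \<longrightarrow> False" if "leads_to nxt x u" for u
    using that
  proof induction
    case here
    show ?case using max_desc[OF x(1)] x(2) by blast
  next
    case (step u)
    show ?case
    proof (intro impI)
      assume u: "u < m" "\<not> c u" "leads_to f v u"
      have "leads_to f v (nxt u)"
      proof (cases "u = v")
        case True
        then show ?thesis using bad[OF v] by simp
      next
        case False
        have "u \<noteq> r"
        proof
          assume "u = r"
          then have "v \<in> {r}" using leads_to_closed[OF u(3), of "{r}"] rfix by simp
          then show False using D(4)[OF v] by simp
        qed
        then have "u \<in> S" using max_desc[OF DI u(3)] u False by metis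
        then have "f u = nxt u" using \<open>u \<noteq> r\<close> by (simp add: par_def f_def)
        then show ?thesis using leads_to_next[OF u(3) False] by simp
      qed
      then show False using step.IH nxt_lt[OF u(1)] c_nxt[OF u(1)] u(2) by simp
    qed
  qed
  moreover have "leads_to nxt x v" using nxt_leads_d D[OF v] D[OF x(1)] by metis
  ultimately show False using D[OF v] leads_to.here by metis
qed

lemma card_not_c:
  assumes "S \<subseteq> {..<m}"
  shows "card {v. v < m \<and> \<not> c v \<and> v \<notin> S} + card {v \<in> S. \<not> c v} = card {v. v < m \<and> \<not> c v}"
proof -
  have "{v. v < m \<and> \<not> c v} = {v. v < m \<and> \<not> c v \<and> v \<notin> S} \<union> {v \<in> S. \<not> c v}" using assms by auto
  moreover have "finite {v \<in> S. \<not> c v}" using assms by (auto intro: finite_subset)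
  ultimately show ?thesis by (subst card_Un_disjoint[symmetric]) auto
qed

text \<open>In a tree the vertices of a \<open>\<sigma>\<^sub>2\<^sup>-\<^sup>1\<close>-block belonging to \<open>S\<close> form a final segment, so the block
  of the inserted vertex determines that vertex.\<close>

lemma N_Suc_d:
  assumes j: "j + 2 \<le> card {v. v < m \<and> \<not> c v}"
  shows "N 0 a j \<le> card blocks * N 0 a (Suc j)"
proof -
  \<comment> \<open>The block of \<open>v\<close> is named by the last sigma_1 before it, which
    exists because the word starts with sigma_1.\<close>
  define lab where "lab v = Max {x. x < v \<and> c x}" for v
  have lab: "lab v < v" "c (lab v)" "\<And>x. x < v \<Longrightarrow> lab v < x \<Longrightarrow> \<not> c x" "lab v \<in> blocks"
    if v: "v < m" "\<not> c v" for v
  proof -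
    have ne: "{x. x < v \<and> c x} \<noteq> {}" using v c_first by (cases v) auto
    have "lab v \<in> {x. x < v \<and> c x}" unfolding lab_def by (rule Max_in) (use ne in auto)
    then show 1: "lab v < v" "c (lab v)" by auto
    show 2: "\<not> c x" if "x < v" "lab v < x" for x
    proof
      assume "c x"
      moreover have "finite {x. x < v \<and> c x}" by simp
      ultimately have "x \<le> lab v" unfolding lab_def using that(1) by (intro Max_ge) auto
      then show False using that(2) by simp
    qed
    show "lab v \<in> blocks" using 1 2[of "Suc (lab v)"] v by (cases "Suc (lab v) = v") (auto simp: blocks_def)
  qed
  have "\<exists>v. v < m \<and> \<not> c v \<and> v \<notin> S \<and> tree 0 (insert v S)" if S: "S \<in> trees 0 a j" for S
  proof -
    \<comment> \<open>The root 0 is of the first kind and takes nothing from the candidates, so at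
      least two remain.\<close>
    have "{v. v < m \<and> \<not> c v \<and> v \<notin> S \<and> v \<noteq> 0} = {v. v < m \<and> \<not> c v \<and> v \<notin> S}"
      using c_first by (metis (lifting))
    moreover have "S \<subseteq> {..<m}" "card {v \<in> S. \<not> c v} = j" "tree 0 S"
      using S by (auto simp: trees_def tree_def)
    ultimately show ?thesis using tree_insert_ex[of 0 S] card_not_c[of S] j m_ge_2 by auto
  qed
  then obtain pick where pick: "\<And>S. S \<in> trees 0 a j \<Longrightarrow> pick S < m \<and> \<not> c (pick S) \<and> pick S \<notin> S \<and>
      tree 0 (insert (pick S) S)" by metis
  define \<phi> where "\<phi> S = (lab (pick S), insert (pick S) S)" for S
  have less_case: False if S: "S \<in> trees 0 a j" and T: "T \<in> trees 0 a j" and eq: "\<phi> S = \<phi> T"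
    and lt: "pick S < pick T" for S T
  proof -
    let ?v = "pick S" and ?w = "pick T"
    have t: "tree 0 T" using T by (simp add: trees_def)
    have vT: "?v \<in> T" using eq lt by (auto simp: \<phi>_def)
    have nc: "\<not> c x" if "?v \<le> x" "x \<le> ?w" for x
      using lab(3)[of ?w x] lab(1)[of ?v] pick[OF S] pick[OF T] eq that
      by (cases "x = ?w") (auto simp: \<phi>_def)
    \<comment> \<open>\<open>T\<close> contains \<open>?v\<close> but not \<open>?w\<close>; its
      last element before \<open>?w\<close> is followed by an omitted letter of the same
      block.\<close>
    let ?x = "Max {x \<in> T. ?v \<le> x \<and> x < ?w}"
    have fin: "finite {x \<in> T. ?v \<le> x \<and> x < ?w}" using tree_finite[OF t] by simp
    have x: "?x \<in> {x \<in> T. ?v \<le> x \<and> x < ?w}" by (rule Max_in[OF fin]) (use vT lt in auto)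
    have "Suc ?x \<notin> T"
    proof
      assume "Suc ?x \<in> T"
      moreover have "Suc ?x \<noteq> ?w" using calculation pick[OF T] by auto
      ultimately have "Suc ?x \<in> {x \<in> T. ?v \<le> x \<and> x < ?w}" using x by auto
      then have "Suc ?x \<le> ?x" by (rule Max_ge[OF fin])
      then show False by simp
    qed
    then show False using no_adjacent_backtrack[OF t, of ?x] x nc[of ?x] nc[of "Suc ?x"] pick[OF T] by auto
  qed
  have "inj_on \<phi> (trees 0 a j)"
  proof (rule inj_onI)
    fix S T assume ST: "S \<in> trees 0 a j" "T \<in> trees 0 a j" "\<phi> S = \<phi> T"
    have "pick S = pick T"
      using less_case[OF ST] less_case[OF ST(2,1) ST(3)[symmetric]]
      by (metis linorder_neqE_nat)
    then show "S = T" using ST(3) pick[OF ST(1)] pick[OF ST(2)] by (simp add: \<phi>_def insert_ident)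
  qed
  moreover have "\<phi> ` trees 0 a j \<subseteq> blocks \<times> trees 0 a (Suc j)"
  proof
    fix y assume "y \<in> \<phi> ` trees 0 a j"
    then obtain S where S: "S \<in> trees 0 a j" and y: "y = \<phi> S" by blast
    have fin: "finite {v \<in> S. \<not> c v}" using S tree_finite by (auto simp: trees_def)
    have "{v \<in> insert (pick S) S. c v} = {v \<in> S. c v}"
      "{v \<in> insert (pick S) S. \<not> c v} = insert (pick S) {v \<in> S. \<not> c v}" using pick[OF S] by auto
    then have "insert (pick S) S \<in> trees 0 a (Suc j)"
      using S pick[OF S] fin by (auto simp: trees_def)
    then show "y \<in> blocks \<times> trees 0 a (Suc j)" using lab(4) pick[OF S] y by (simp add: \<phi>_def)
  qed
  moreover have "finite blocks" by (rule finite_subset[of _ "{..<m}"]) (auto simp: blocks_def)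
  ultimately show ?thesis
    using card_inj_on_le[of \<phi> "trees 0 a j" "blocks \<times> trees 0 a (Suc j)"]
    by (simp add: N_def finite_trees card_cartesian_product)
qed

end

lemma sum_of_bool_bij:
  fixes g :: "nat \<Rightarrow> 'a :: comm_ring_1"
  assumes "inj_on h {..<n}" "\<And>v. v < n \<Longrightarrow> h v < n" and w: "w < n"
  shows "(\<Sum>v<n. g v * of_bool (h w = h v)) = g w"
proof -
  have "(\<Sum>v<n. g v * of_bool (h w = h v)) = (\<Sum>v<n. if v = w then g v else 0)"
    using assms by (intro sum.cong) (auto simp: inj_on_def)
  then show ?thesis using w by simp
qed

context cyclic_word
begin

subsection \<open>Independence of the root\<close>

lemma cofactor_laplacian:
  fixes \<alpha> \<beta> :: "nat \<Rightarrow> 'a :: idom"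
  assumes r: "r < m"
  shows "cofactor (mat m m (\<lambda>(v, k). \<alpha> v * (of_bool (k = v) - of_bool (k = pred v))
             + \<beta> v * (of_bool (k = v) - of_bool (k = nxt v)))) r r
       = (\<Sum>S | tree r S. \<Prod>v\<in>{..<m} - {r}. if v \<in> S then \<beta> v else \<alpha> v)"
    (is "cofactor ?L r r = _")
proof -
  have "cofactor ?L r r = det (mat m m (\<lambda>(i, j). if i = r then of_bool (j = r) else ?L $$ (i, j)))"
    using r by (intro det_unit_row[symmetric]) auto
  also have "mat m m (\<lambda>(i, j). if i = r then of_bool (j = r) else ?L $$ (i, j))
    = mat m m (\<lambda>(v, k). if v = r then of_bool (k = r)
           else \<alpha> v * (of_bool (k = v) - of_bool (k = pred v))
              + \<beta> v * (of_bool (k = v) - of_bool (k = nxt v)))"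
    by (intro eq_matI) auto
  also have "det \<dots> = (\<Sum>S | S \<subseteq> {..<m} - {r} \<and>
      (\<forall>v<m. leads_to (\<lambda>v. if v \<in> S then nxt v else pred v) r v).
      \<Prod>v\<in>{..<m} - {r}. if v \<in> S then \<beta> v else \<alpha> v)"
    by (rule matrix_tree[OF r pred_lt nxt_lt])
  also have "{S. S \<subseteq> {..<m} - {r} \<and>
      (\<forall>v<m. leads_to (\<lambda>v. if v \<in> S then nxt v else pred v) r v)} = {S. tree r S}"
  proof -
    have "leads_to (\<lambda>v. if v \<in> S then nxt v else pred v) r v \<longleftrightarrow> leads_to (par r S) r v" for S v
      by (rule iffI; erule leads_to_cong) (auto simp: par_def)
    then show ?thesis by (simp add: tree_def)
  qed
  finally show ?thesis .
qed

lemma N_root: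
  assumes r: "r < m" "r' < m"
  shows "N r a j = N r' a j"
proof -
  \<comment> \<open>One variable per kind, so that the coefficients recover both counts: the outer
    one marks the second kind, the inner one the first. The weight depends on the kind alone and so
    agrees at \<open>v\<close> and \<open>nxt v\<close>; this balances the columns.\<close>
  define \<beta> :: "nat \<Rightarrow> int poly poly" where
    "\<beta> v = (if c v then monom (monom 1 1) 0 else monom 1 1)" for v
  define L where "L = mat m m (\<lambda>(v, k). 1 * (of_bool (k = v) - of_bool (k = pred v))
             + \<beta> v * (of_bool (k = v) - of_bool (k = nxt v)))"
  have L: "L \<in> carrier_mat m m" by (simp add: L_def)
  have prod_S: "(\<Prod>v\<in>S. \<beta> v) = monom (monom 1 (card {v \<in> S. c v})) (card {v \<in> S. \<not> c v})"
    if "finite S" for S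
    using that
  proof induction
    case (insert x S)
    have "{v \<in> insert x S. c v} = (if c x then insert x {v \<in> S. c v} else {v \<in> S. c v})"
      "{v \<in> insert x S. \<not> c v} = (if c x then {v \<in> S. \<not> c v} else insert x {v \<in> S. \<not> c v})" by auto
    then show ?case using insert by (simp add: \<beta>_def mult_monom)
  qed (simp add: monom_0 one_pCons)
  have count: "coeff (coeff (cofactor L r r) j) a = int (N r a j)" if r: "r < m" for r
  proof -
    have fin: "finite {S. tree r S}"
      by (rule finite_subset[of _ "Pow {..<m}"]) (auto simp: tree_def)
    have "cofactor L r r = (\<Sum>S | tree r S. \<Prod>v\<in>{..<m} - {r}. if v \<in> S then \<beta> v else 1)"
      unfolding L_def by (rule cofactor_laplacian[OF r])
    also have "\<dots> = (\<Sum>S | tree r S. monom (monom 1 (card {v \<in> S. c v})) (card {v \<in> S. \<not> c v}))"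
    proof (rule sum.cong[OF refl])
      fix S assume "S \<in> {S. tree r S}"
      then have S: "S \<subseteq> {..<m} - {r}" "finite S" using tree_finite by (auto simp: tree_def)
      have "(\<Prod>v\<in>{..<m} - {r}. if v \<in> S then \<beta> v else 1) = (\<Prod>v\<in>S. \<beta> v)"
        using S by (intro prod.mono_neutral_cong_right) auto
      then show "(\<Prod>v\<in>{..<m} - {r}. if v \<in> S then \<beta> v else 1)
        = monom (monom 1 (card {v \<in> S. c v})) (card {v \<in> S. \<not> c v})" using prod_S S by simp
    qed
    finally have "coeff (coeff (cofactor L r r) j) a
        = (\<Sum>S | tree r S. of_bool (card {v \<in> S. c v} = a \<and> card {v \<in> S. \<not> c v} = j))"
      by (simp add: coeff_sum) (intro sum.cong refl, auto)
    also have "\<dots> = int (card {S \<in> {S. tree r S}. card {v \<in> S. c v} = a \<and> card {v \<in> S. \<not> c v} = j})"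
      using fin by (simp add: of_bool_def sum.If_cases Int_def)
    finally show ?thesis by (simp add: N_def trees_def)
  qed
  have row: "(\<Sum>k<m. L $$ (v, k)) = 0" if v: "v < m" for v
  proof -
    have "(\<Sum>k<m. L $$ (v, k)) = (\<Sum>k<m. (if k = v then 1 + \<beta> v else 0)
        - (if k = pred v then 1 else 0) - (if k = nxt v then \<beta> v else 0))"
      using v by (intro sum.cong) (auto simp: L_def algebra_simps)
    then show ?thesis using v pred_lt nxt_lt by (simp add: sum_subtractf)
  qed
  have col: "(\<Sum>v<m. 1 * L $$ (v, k)) = 0" if k: "k < m" for k
  proof -
    have sur: "h ` {..<m} = {..<m}" if "inj_on h {..<m}" "\<And>v. v < m \<Longrightarrow> h v < m" for h
      by (rule endo_inj_surj) (use that in auto)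
    obtain w where w: "w < m" "k = pred w" using sur[OF pred_inj pred_lt] k by blast
    obtain x where x: "x < m" "k = nxt x" using sur[OF nxt_inj nxt_lt] k by blast
    have "(\<Sum>v<m. 1 * L $$ (v, k)) = (\<Sum>v<m. (1 + \<beta> v) * of_bool (k = v))
        - (\<Sum>v<m. 1 * of_bool (k = pred v)) - (\<Sum>v<m. \<beta> v * of_bool (k = nxt v))"
      unfolding sum_subtractf[symmetric] using k by (intro sum.cong) (auto simp: L_def algebra_simps)
    also have "(\<Sum>v<m. (1 + \<beta> v) * of_bool (k = v)) = 1 + \<beta> k"
      using k by (simp add: of_bool_def if_distrib cong: if_cong)
    also have "(\<Sum>v<m. 1 * of_bool (k = pred v)) = (1 :: int poly poly)"
      unfolding w(2) by (rule sum_of_bool_bij[OF pred_inj pred_lt w(1)])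
    also have "(\<Sum>v<m. \<beta> v * of_bool (k = nxt v)) = \<beta> x"
      unfolding x(2) by (rule sum_of_bool_bij[OF nxt_inj nxt_lt x(1)])
    finally show ?thesis using c_nxt[OF x(1)] x(2) by (simp add: \<beta>_def)
  qed
  have "cofactor L r r = cofactor L r r'"
    by (rule cofactor_col_indep[OF L row]) (use r in auto)
  also have "1 * cofactor L r r' = 1 * cofactor L r' r'"
    by (rule cofactor_row_proportional[OF L col]) (use r in auto)
  finally have "cofactor L r r = cofactor L r' r'" by simp
  then have "int (N r a j) = int (N r' a j)" using count r by metis
  then show ?thesis by simp
qed

subsection \<open>Exchanging the arc at a letter of the first kind\<close>

text \<open>The arc at \<open>first_d - 1\<close> is dropped, and the old root, which lies outside
  \<open>S\<close>, now hangs on its predecessor, the new root. No other arc changes.\<close>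

lemma tree_move_root:
  assumes t: "tree first_d S" and l: "first_d - 1 \<in> S"
  shows "tree (first_d - 1) (S - {first_d - 1})"
proof -
  let ?l = "first_d - 1" and ?S = "S - {first_d - 1}"
  have root: "leads_to (par ?l ?S) ?l first_d"
  proof (rule leads_to.step)
    have "par ?l ?S first_d = ?l"
      using tree_sub(2)[OF t] first_d(3) by (auto simp: par_def pred_def)
    then show "leads_to (par ?l ?S) ?l (par ?l ?S first_d)" by (simp add: leads_to.here)
  qed
  have "leads_to (par ?l ?S) ?l v" if "leads_to (par first_d S) first_d v" for v
    using that
  proof induction
    case here
    show ?case by (rule root)
  next
    case (step v)
    show ?case
    proof (cases "v = ?l \<or> v = first_d")
      case True
      then show ?thesis using root leads_to.here by metis
    next
      case False
      then have "par first_d S v = par ?l ?S v" by (simp add: par_def)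
      then show ?thesis using step.IH leads_to.step by metis
    qed
  qed
  then show ?thesis using t by (auto simp: tree_def)
qed

lemma card_last_in_S:
  "card {S \<in> trees first_d (Suc a) j. first_d - 1 \<in> S} \<le> N (first_d - 1) a j"
  unfolding N_def
proof (rule card_inj_on_le)
  let ?l = "first_d - 1"
  have cl: "c ?l" using first_d(3,4) by simp
  show "inj_on (\<lambda>S. S - {?l}) {S \<in> trees first_d (Suc a) j. ?l \<in> S}"
    by (rule inj_onI) blast
  show "(\<lambda>S. S - {?l}) ` {S \<in> trees first_d (Suc a) j. ?l \<in> S} \<subseteq> trees ?l a j"
  proof (rule image_subsetI)
    fix S assume S: "S \<in> {S \<in> trees first_d (Suc a) j. ?l \<in> S}"
    then have t: "tree first_d S" by (simp add: trees_def)
    have "{v \<in> S - {?l}. c v} = {v \<in> S. c v} - {?l}" "{v \<in> S - {?l}. \<not> c v} = {v \<in> S. \<not> c v}"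
      using cl by auto
    then show "S - {?l} \<in> trees ?l a j"
      using S cl tree_finite[OF t] tree_move_root[OF t] by (simp add: trees_def card_Diff_singleton)
  qed
qed (rule finite_trees)

section \<open>Trees with root \<open>first_d\<close> that avoid the first block, as words\<close>

lemma finite_greatest:
  fixes S :: "nat set"
  assumes "finite S" "S \<noteq> {}"
  obtains x where "x \<in> S" "\<And>y. x < y \<Longrightarrow> y \<notin> S"
  using Max_in[OF assms] Max_ge[OF assms(1)] that by (meson not_le)

text \<open>Both claims look at a largest element of \<open>S\<close>, below the root or overall:
  the letters above it hang on their predecessors, so the jump from it comes back to it.\<close>

lemma stuck_tree:
  assumes t: "tree first_d S" and l: "first_d - 1 \<notin> S" and ne: "S \<noteq> {}"
  shows "m - 1 \<in> S" and "x < first_d \<Longrightarrow> x \<notin> S"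
proof -
  have fin: "finite S" by (rule tree_finite[OF t])
  have low: "x \<notin> S" if "x < first_d" for x
  proof
    assume "x \<in> S"
    then have "finite {x \<in> S. x < first_d}" "{x \<in> S. x < first_d} \<noteq> {}" using fin that by auto
    then obtain M where M: "M \<in> {x \<in> S. x < first_d}"
      and above: "\<And>y. M < y \<Longrightarrow> y \<notin> {x \<in> S. x < first_d}" by (rule finite_greatest) blast
    have "Suc M \<noteq> first_d"
    proof
      assume "Suc M = first_d"
      then have "first_d - 1 = M" by simp
      then show False using M l by simp
    qed
    then have M2: "Suc M < first_d" using M by simp
    then have "Suc M \<notin> S" using above[of "Suc M"] by simp
    then show False
      using no_adjacent_backtrack[OF t, of M] M M2 first_d(1) first_d(4)[of M] first_d(4)[of "Suc M"]
      by simp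
  qed
  then show "x < first_d \<Longrightarrow> x \<notin> S" .
  show "m - 1 \<in> S"
  proof (rule ccontr)
    assume last: "m - 1 \<notin> S"
    obtain x where x: "x \<in> S" and above: "\<And>y. x < y \<Longrightarrow> y \<notin> S"
      by (rule finite_greatest[OF fin ne]) blast
    have xm: "x < m" using tree_sub(1)[OF t x] .
    have "x \<noteq> first_d" using tree_sub(2)[OF t] x by blast
    then have xd: "first_d < x" using low[of x] x by (cases "x < first_d") auto
    have "x \<noteq> m - 1" using x last by blast
    then have xl: "x < m - 1" using xm by simp
    from xm show False
    proof (cases rule: nxt_cases)
      case later
      show False
        by (rule no_backtrack[OF t x later(1,2)]) (use above xd in simp)
    next
      case wrap
      then have n: "nxt x = 0" using wrap(1)[of "m - 1"] xl c_last m_ge_2 by simp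
      \<comment> \<open>The walk from \<open>x\<close> wraps to 0, runs on to \<open>m - 1\<close>
        and then down to \<open>x\<close>; the first block and this final stretch form a trap that
        misses the root.\<close>
      have "first_d \<in> {..<first_d} \<union> {x..<m}"
      proof (rule tree_closed[OF t])
        fix y assume y: "y \<in> {..<first_d} \<union> {x..<m}"
        show "par first_d S y \<in> {..<first_d} \<union> {x..<m}"
        proof (cases "y = x")
          case True
          then show ?thesis using n x xd first_d(3) by (simp add: par_def)
        next
          case False
          then have "y \<notin> S \<and> y \<noteq> first_d"
          proof (cases "y < first_d")
            case yes: True
            then show ?thesis using low[of y] by simp
          next
            case no: False
            then show ?thesis using above[of y] y False xd by simp
          qed
          then show ?thesis using y False xm by (auto simp: par_def pred_def)
        qed
      qed (use xm in auto)
      then show False using xd by simp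
    qed
  qed
qed

text \<open>Reversed because letters outside \<open>S\<close> hang on their predecessor: the
  selected letter following \<open>z\<close> in this list is the one that the walk from
  \<open>z\<close> meets first. The last letter is left out since it belongs to every nonempty tree
  of this kind, and the first block since it contributes nothing.\<close>

definition inner :: "nat list" where
  "inner = rev [Suc first_d..<m - 1]"

lemma set_inner: "set inner = {x. first_d < x \<and> x < m - 1}"
  by (auto simp: inner_def)

lemma case_filter_rev_upt:
  "(case filter (\<lambda>x. x \<in> S) (rev [A..<B]) of [] \<Rightarrow> True | x # _ \<Rightarrow> Q x) \<longleftrightarrow>
     (\<forall>s. A \<le> s \<and> s < B \<and> s \<in> S \<and> (\<forall>x. s < x \<and> x < B \<longrightarrow> x \<notin> S) \<longrightarrow> Q s)"
proof (induction B)
  case 0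
  show ?case by simp
next
  case (Suc B)
  show ?case
  proof (cases "A \<le> B")
    case False
    then show ?thesis by auto
  next
    case AB: True
    show ?thesis
    proof (cases "B \<in> S")
      case True
      then show ?thesis using AB by (auto simp: less_Suc_eq)
    next
      case False
      then have "filter (\<lambda>x. x \<in> S) (rev [A..<Suc B]) = filter (\<lambda>x. x \<in> S) (rev [A..<B])"
        using AB by simp
      then show ?thesis unfolding Suc.IH[symmetric] using False Suc.IH
        by (auto simp: less_Suc_eq)
    qed
  qed
qed

lemma greedy_rev_upt:
  "greedy c S (rev [A..<B]) \<longleftrightarrow> (\<forall>z<B. z \<notin> S \<longrightarrow>
     (\<forall>s. A \<le> s \<and> s < z \<and> s \<in> S \<and> (\<forall>x. s < x \<and> x < z \<longrightarrow> x \<notin> S) \<longrightarrow> c s \<noteq> c z))"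
proof (induction B)
  case 0
  show ?case by simp
next
  case (Suc B)
  show ?case
  proof (cases "A \<le> B")
    case True
    then have "rev [A..<Suc B] = B # rev [A..<B]" by simp
    then have "greedy c S (rev [A..<Suc B]) \<longleftrightarrow> greedy c S (rev [A..<B]) \<and>
      (B \<in> S \<or> (\<forall>s. A \<le> s \<and> s < B \<and> s \<in> S \<and> (\<forall>x. s < x \<and> x < B \<longrightarrow> x \<notin> S) \<longrightarrow> c s \<noteq> c B))"
      using case_filter_rev_upt[where S = S and A = A and B = B and Q = "\<lambda>x. c x \<noteq> c B"] by simp
    then show ?thesis unfolding Suc.IH All_less_Suc by blast
  next
    case False
    then have "\<not> (A \<le> s \<and> s < z)" if "z < Suc B" for s z using that by linarith
    then show ?thesis using False by auto
  qed
qed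

text \<open>If the last selected \<open>s\<close> before a skipped \<open>z\<close> had the kind of
  \<open>z\<close>, then \<open>nxt s\<close> would be at most \<open>z\<close> with only skipped
  letters after \<open>s\<close>: the cycle of \<open>no_backtrack\<close>.\<close>

lemma greedy_stuck_tree:
  assumes t: "tree first_d S"
  shows "greedy c S inner"
  unfolding inner_def greedy_rev_upt
proof (intro allI impI notI)
  fix z s
  assume z: "z < m - 1" "z \<notin> S"
    and s: "Suc first_d \<le> s \<and> s < z \<and> s \<in> S \<and> (\<forall>x. s < x \<and> x < z \<longrightarrow> x \<notin> S)"
    and eq: "c s = c z"
  have n: "s < nxt s" "nxt s \<le> z" using nxt_later[of s z] z s eq by auto
  have un: "x \<notin> S \<and> x \<noteq> first_d" if "s < x" "x \<le> nxt s" for x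
  proof (cases "x = z")
    case False
    then have "x < z" using that n by simp
    then show ?thesis using s that by simp
  qed (use s z in simp)
  have "s \<in> S" "nxt s < m" using s n z by auto
  then show False using no_backtrack[OF t _ n(1) _ un] by blast
qed

lemma leads_back:
  assumes "s \<le> z" and "\<And>x. s < x \<Longrightarrow> x \<le> z \<Longrightarrow> x \<notin> S \<and> x \<noteq> r"
  shows "leads_to (par r S) s z"
  using assms
proof (induction z rule: dec_induct)
  case base
  show ?case by (rule leads_to.here)
next
  case (step z)
  then have "par r S (Suc z) = z" by (auto simp: par_def pred_def)
  then show ?case using step by (auto intro!: leads_to.step[of _ _ "Suc z"])
qed

text \<open>Converse of \<open>greedy_stuck_tree\<close>. From a selected \<open>s\<close> the walk
  goes to \<open>nxt s\<close> and, if that is skipped, back down to a selected letter, which by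
  greediness lies above \<open>s\<close>. So the walk climbs until it reaches \<open>m - 1\<close>,
  which hangs on the root, or wraps to 0, which hangs on \<open>m - 1\<close>.\<close>

lemma stuck_tree_of_greedy:
  assumes d: "first_d < m - 1" and S: "S \<subseteq> set inner" and g: "greedy c S inner"
  shows "tree first_d (insert (m - 1) S)"
proof -
  define T where "T = insert (m - 1) S"
  define f where "f = par first_d T"
  have SD: "first_d < x" "x < m - 1" if "x \<in> S" for x using S that by (auto simp: set_inner)
  have TD: "first_d < x" "x < m" if "x \<in> T" for x using SD[of x] d that by (auto simp: T_def)
  have down: "leads_to f s z" if "s \<le> z" "\<And>x. s < x \<Longrightarrow> x \<le> z \<Longrightarrow> x \<notin> T \<and> x \<noteq> first_d" for s z
    unfolding f_def by (rule leads_back[OF that])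
  have top: "leads_to f first_d (m - 1)"
  proof (rule leads_to.step)
    have "nxt (m - 1) = first_d" using nxt_wrap[of "m - 1"] m_ge_2 c_last by simp
    then have "f (m - 1) = first_d" using d by (simp add: par_def f_def T_def)
    then show "leads_to f first_d (f (m - 1))" by (simp add: leads_to.here)
  qed
  have low: "leads_to f first_d x" if "x < first_d" for x
  proof -
    have "leads_to f 0 x"
    proof (rule down)
      fix y assume "y \<le> x"
      then show "y \<notin> T \<and> y \<noteq> first_d" using TD(1)[of y] that by auto
    qed simp
    moreover have "leads_to f first_d 0"
    proof (rule leads_to.step)
      have "0 \<notin> T" using TD(1)[of 0] by blast
      then have "f 0 = m - 1" using first_d(3) by (simp add: par_def pred_def f_def)
      then show "leads_to f first_d (f 0)" using top by simp
    qed
    ultimately show ?thesis by (rule leads_to_trans)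
  qed
  have inS: "leads_to f first_d s" if "s \<in> S" for s
    using that
  proof (induction "m - s" arbitrary: s rule: less_induct)
    case less
    note sd = SD[OF less.prems]
    have sm: "s < m" using sd by simp
    have fs: "f s = nxt s" using less.prems sd by (simp add: par_def f_def T_def)
    have IH: "leads_to f first_d x" if "x \<in> S" "s < x" for x
      using less.hyps[of x] that sm by simp
    from sm have "leads_to f first_d (nxt s)"
    proof (cases rule: nxt_cases)
      case wrap
      have "nxt s = 0" using wrap(2) wrap(1)[of "m - 1"] sd c_last by simp
      then show ?thesis using low first_d(3) by simp
    next
      case later
      define z where "z = nxt s"
      show ?thesis
      proof (cases "z \<in> T")
        case True
        then show ?thesis using top IH[of z] later(1) by (auto simp: T_def z_def)
      next
        case False
        then have zS: "z \<notin> S" "z < m - 1" using later(2) by (auto simp: T_def z_def)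
        have "s \<in> {x \<in> S. x < z}" using less.prems later by (simp add: z_def)
        then have "finite {x \<in> S. x < z}" "{x \<in> S. x < z} \<noteq> {}" by auto
        then obtain y where y: "y \<in> {x \<in> S. x < z}"
          and gr: "\<And>x. y < x \<Longrightarrow> x \<notin> {x \<in> S. x < z}" by (rule finite_greatest) blast
        have sy: "s \<le> y" using gr[of s] \<open>s \<in> {x \<in> S. x < z}\<close> by (meson not_le)
        have above: "x \<notin> S" if "y < x" "x < z" for x using gr[of x] that by simp
        \<comment> \<open>If the walk from \<open>z\<close> came back to \<open>s\<close>, then
          \<open>s\<close> would be the last selected letter before \<open>z\<close> and of the same
          kind, against greediness.\<close>
        have "y \<noteq> s"
        proof
          assume ys: "y = s"
          have "Suc first_d \<le> s \<and> s < z \<and> s \<in> S \<and> (\<forall>x. s < x \<and> x < z \<longrightarrow> x \<notin> S)"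
            using sd later(1) less.prems above ys by (simp add: z_def)
          then have "c s \<noteq> c z" using g zS unfolding inner_def greedy_rev_upt by blast
          then show False using c_nxt[OF sm] by (simp add: z_def)
        qed
        then have "leads_to f first_d y" using IH[of y] y sy by simp
        moreover have "leads_to f y z"
        proof (rule down)
          fix x assume x: "y < x" "x \<le> z"
          then have "x \<notin> T" using above[of x] False zS(2) by (cases "x = z") (auto simp: T_def)
          then show "x \<notin> T \<and> x \<noteq> first_d" using x sy sd by simp
        qed (use y in simp)
        ultimately show ?thesis unfolding z_def[symmetric] using leads_to_trans by metis
      qed
    qed
    then show ?case using fs leads_to.step[of f first_d s] by simp
  qed
  have "leads_to f first_d v" if v: "v < m" for v
  proof (cases "v < first_d \<or> v \<in> T")
    case True
    then show ?thesis using low inS top by (auto simp: T_def)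
  next
    case False
    let ?X = "{x. x \<le> v \<and> (x = first_d \<or> x \<in> S)}"
    have "first_d \<in> ?X" using False by simp
    then have "finite ?X" "?X \<noteq> {}" by auto
    then obtain y where y: "y \<in> ?X" and gr: "\<And>x. y < x \<Longrightarrow> x \<notin> ?X" by (rule finite_greatest) blast
    have "leads_to f y v"
    proof (rule down)
      fix x assume x: "y < x" "x \<le> v"
      have "x \<noteq> m - 1" using x v False by (cases "v = m - 1") (auto simp: T_def)
      then show "x \<notin> T \<and> x \<noteq> first_d" using gr[OF x(1)] x(2) by (simp add: T_def)
    qed (use y in simp)
    moreover have "leads_to f first_d y" using y inS leads_to.here[of f first_d] by auto
    ultimately show ?thesis by (rule leads_to_trans)
  qed
  moreover have "T \<subseteq> {..<m} - {first_d}" using TD by (auto dest: TD)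
  ultimately show ?thesis by (simp add: tree_def T_def f_def)
qed

text \<open>The letter \<open>m - 1\<close> lies in every such tree, is of the second kind and is
  not part of the word; hence \<open>Suc j\<close> against \<open>j\<close>.\<close>

lemma card_stuck_le_words:
  "card {S \<in> trees first_d a (Suc j). first_d - 1 \<notin> S} \<le> card (words (map c inner) a j)"
proof (rule card_inj_on_le)
  let ?X = "{S \<in> trees first_d a (Suc j). first_d - 1 \<notin> S}"
  let ?w = "\<lambda>S. map c (filter (\<lambda>x. x \<in> S) inner)"
  have X: "tree first_d S" "m - 1 \<in> S" "\<And>x. x \<in> S \<Longrightarrow> x = m - 1 \<or> x \<in> set inner"
    "card {v \<in> S. c v} = a" "card {v \<in> S. \<not> c v} = Suc j" if "S \<in> ?X" for S
  proof -
    show t: "tree first_d S" and ca: "card {v \<in> S. c v} = a" and cj: "card {v \<in> S. \<not> c v} = Suc j"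
      using that by (auto simp: trees_def)
    have l: "first_d - 1 \<notin> S" using that by blast
    have ne: "S \<noteq> {}" using cj by auto
    show "m - 1 \<in> S" by (rule stuck_tree(1)[OF t l ne])
    show "x = m - 1 \<or> x \<in> set inner" if "x \<in> S" for x
    proof -
      have "\<not> x < first_d" using stuck_tree(2)[OF t l ne] that by blast
      moreover have "x < m" "x \<noteq> first_d" using tree_sub[OF t] that by auto
      ultimately show ?thesis by (auto simp: set_inner)
    qed
  qed
  show "inj_on ?w ?X"
  proof (rule inj_onI)
    fix S T assume ST: "S \<in> ?X" "T \<in> ?X" and eq: "?w S = ?w T"
    have "x \<in> S \<longleftrightarrow> x \<in> T" for x
    proof (cases "x \<in> set inner")
      case True
      then show ?thesis
        by (rule greedy_inj[OF greedy_stuck_tree[OF X(1)[OF ST(1)]] greedy_stuck_tree[OF X(1)[OF ST(2)]] eq])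
    next
      case False
      then have "x \<in> S \<longleftrightarrow> x = m - 1" "x \<in> T \<longleftrightarrow> x = m - 1"
        using X(2)[OF ST(1)] X(2)[OF ST(2)] X(3)[OF ST(1), of x] X(3)[OF ST(2), of x] by fast+
      then show ?thesis by simp
    qed
    then show "S = T" by auto
  qed
  show "?w ` ?X \<subseteq> words (map c inner) a j"
  proof (rule image_subsetI)
    fix S assume S: "S \<in> ?X"
    have di: "distinct inner" by (simp add: inner_def)
    have n: "m - 1 \<notin> set inner" by (simp add: set_inner)
    have fin: "finite (S \<inter> set inner)" by simp
    have c1: "{v \<in> S. c v} = {v \<in> S \<inter> set inner. c v}"
      using X(3)[OF S] c_last by auto
    have d1: "{v \<in> S. \<not> c v} = insert (m - 1) {v \<in> S \<inter> set inner. \<not> c v}"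
      using X(2,3)[OF S] c_last by auto
    have len: "length (filter P (filter (\<lambda>x. x \<in> S) inner)) = card {v \<in> S \<inter> set inner. P v}" for P
    proof -
      have "length (filter P (filter (\<lambda>x. x \<in> S) inner)) = card (set (filter P (filter (\<lambda>x. x \<in> S) inner)))"
        by (rule distinct_card[symmetric]) (use di in simp)
      also have "set (filter P (filter (\<lambda>x. x \<in> S) inner)) = {v \<in> S \<inter> set inner. P v}" by auto
      finally show ?thesis .
    qed
    have "length (filter (\<lambda>x. x) (?w S)) = a"
      using X(4)[OF S] len[of c] unfolding c1 by (simp add: filter_map comp_def)
    moreover have "length (filter Not (?w S)) = j"
      using X(5)[OF S] len[of "\<lambda>v. \<not> c v"] n fin unfolding d1 by (simp add: filter_map comp_def)
    moreover have "subseq (?w S) (map c inner)" by (intro subseq_map subseq_filter_left)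
    ultimately show "?w S \<in> words (map c inner) a j" by (simp add: words_def)
  qed
qed (rule finite_words)

text \<open>Leftmost embeddings turn words back into trees; with \<open>card_stuck_le_words\<close>
  this converts a bound for words into one for trees.\<close>

lemma card_words_le_N:
  assumes d: "first_d < m - 1"
  shows "card (words (map c inner) a j) \<le> N first_d a (Suc j)"
proof -
  let ?w = "\<lambda>S. map c (filter (\<lambda>x. x \<in> S) inner)"
  have di: "distinct inner" by (simp add: inner_def)
  have n: "m - 1 \<notin> set inner" by (simp add: set_inner)
  define emb where "emb v = (SOME S. S \<subseteq> set inner \<and> greedy c S inner \<and> ?w S = v)" for v
  have emb: "emb v \<subseteq> set inner" "greedy c (emb v) inner" "?w (emb v) = v"
    if "v \<in> words (map c inner) a j" for v
  proof -
    have "subseq v (map c inner)" using that by (simp add: words_def)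
    from greedy_ex[OF this di]
    have "emb v \<subseteq> set inner \<and> greedy c (emb v) inner \<and> ?w (emb v) = v"
      unfolding emb_def by (rule someI_ex)
    then show "emb v \<subseteq> set inner" "greedy c (emb v) inner" "?w (emb v) = v" by simp_all
  qed
  show ?thesis
    unfolding N_def
  proof (rule card_inj_on_le)
    show "inj_on (\<lambda>v. insert (m - 1) (emb v)) (words (map c inner) a j)"
    proof (rule inj_onI)
      fix v v' assume v: "v \<in> words (map c inner) a j" "v' \<in> words (map c inner) a j"
        "insert (m - 1) (emb v) = insert (m - 1) (emb v')"
      have "m - 1 \<notin> emb v" "m - 1 \<notin> emb v'" using emb(1)[OF v(1)] emb(1)[OF v(2)] n by auto
      then have eq: "emb v = emb v'" using v(3) by (simp add: insert_ident)
      have "v = ?w (emb v)" by (rule emb(3)[OF v(1), symmetric])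
      also have "\<dots> = v'" unfolding eq by (rule emb(3)[OF v(2)])
      finally show "v = v'" .
    qed
    show "(\<lambda>v. insert (m - 1) (emb v)) ` words (map c inner) a j \<subseteq> trees first_d a (Suc j)"
    proof (rule image_subsetI)
      fix v assume v: "v \<in> words (map c inner) a j"
      let ?S = "emb v"
      have S: "?S \<subseteq> set inner" "greedy c ?S inner" "?w ?S = v" by (fact emb[OF v])+
      have fin: "finite ?S" using S(1) by (rule finite_subset) simp
      have len: "length (filter P (filter (\<lambda>x. x \<in> ?S) inner)) = card {x \<in> ?S. P x}" for P
      proof -
        have "length (filter P (filter (\<lambda>x. x \<in> ?S) inner)) = card (set (filter P (filter (\<lambda>x. x \<in> ?S) inner)))"
          by (rule distinct_card[symmetric]) (use di in simp)
        also have "set (filter P (filter (\<lambda>x. x \<in> ?S) inner)) = {x \<in> ?S. P x}" using S(1) by auto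
        finally show ?thesis .
      qed
      have c1: "{x \<in> insert (m - 1) ?S. c x} = {x \<in> ?S. c x}"
        using c_last by auto
      have d1: "{x \<in> insert (m - 1) ?S. \<not> c x} = insert (m - 1) {x \<in> ?S. \<not> c x}"
        using c_last by auto
      have "length (filter (\<lambda>x. x) (?w ?S)) = a" "length (filter Not (?w ?S)) = j"
        unfolding S(3) using v by (simp_all add: words_def)
      then have "card {x \<in> ?S. c x} = a" "card {x \<in> ?S. \<not> c x} = j"
        using len[of c] len[of "\<lambda>x. \<not> c x"] by (simp_all add: filter_map comp_def)
      moreover have "m - 1 \<notin> ?S" using S(1) n by blast
      ultimately show "insert (m - 1) ?S \<in> trees first_d a (Suc j)"
        using stuck_tree_of_greedy[OF d S(1,2)] fin unfolding trees_def mem_Collect_eq c1 d1 by simp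
    qed
  qed (rule finite_trees)
qed

text \<open>A run of the reversed word begins at a sigma_1 whose successor in the original word is
  not one. The flag is the letter at \<open>B\<close>, which precedes the reversed list.\<close>

lemma nruns_rev_upt: "nruns (c B) (map c (rev [A..<B])) = card {v. A \<le> v \<and> v < B \<and> c v \<and> \<not> c (Suc v)}"
proof (induction B)
  case (Suc B)
  show ?case
  proof (cases "A \<le> B")
    case True
    have "{v. A \<le> v \<and> v < Suc B \<and> c v \<and> \<not> c (Suc v)} =
      (if c B \<and> \<not> c (Suc B) then {B} else {}) \<union> {v. A \<le> v \<and> v < B \<and> c v \<and> \<not> c (Suc v)}"
      using True by (auto simp: less_Suc_eq)
    moreover have "finite {v. A \<le> v \<and> v < B \<and> c v \<and> \<not> c (Suc v)}"
      by (rule finite_subset[of _ "{..<B}"]) auto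
    ultimately have "card {v. A \<le> v \<and> v < Suc B \<and> c v \<and> \<not> c (Suc v)} =
      of_bool (c B \<and> \<not> c (Suc B)) + card {v. A \<le> v \<and> v < B \<and> c v \<and> \<not> c (Suc v)}"
      by (cases "c B \<and> \<not> c (Suc B)") simp_all
    then show ?thesis using Suc True by simp
  next
    case False
    then have "{v. A \<le> v \<and> v < Suc B \<and> c v \<and> \<not> c (Suc v)} = {}" by auto
    then show ?thesis using False by simp
  qed
qed simp

lemma finite_blocks: "finite blocks"
  by (rule finite_subset[of _ "{..<m}"]) (auto simp: blocks_def)

lemma last_in_blocks: "first_d - 1 \<in> blocks"
  using first_d(1,2,3) first_d(4)[of "first_d - 1"] by (simp add: blocks_def)

text \<open>The block ending at \<open>first_d - 1\<close> lies outside \<open>inner\<close>; this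
  is the origin of the factor n - 1.\<close>

lemma nruns_inner: "Suc (nruns False (map c inner)) \<le> card blocks"
proof -
  have "nruns False (map c inner) = card {v. Suc first_d \<le> v \<and> v < m - 1 \<and> c v \<and> \<not> c (Suc v)}"
    using nruns_rev_upt[of "m - 1" "Suc first_d"] c_last by (simp add: inner_def)
  also have "\<dots> \<le> card (blocks - {first_d - 1})"
    by (rule card_mono) (use finite_blocks in \<open>auto simp: blocks_def\<close>)
  also have "\<dots> = card blocks - 1" using last_in_blocks by simp
  finally show ?thesis using last_in_blocks finite_blocks
    by (metis Suc_le_mono Suc_pred' card_gt_0_iff empty_iff)
qed

lemma N_split:
  "N first_d a j = card {S \<in> trees first_d a j. first_d - 1 \<in> S}
                 + card {S \<in> trees first_d a j. first_d - 1 \<notin> S}"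
proof -
  have "trees first_d a j = {S \<in> trees first_d a j. first_d - 1 \<in> S} \<union> {S \<in> trees first_d a j. first_d - 1 \<notin> S}"
    by blast
  then have "N first_d a j = card ({S \<in> trees first_d a j. first_d - 1 \<in> S} \<union> {S \<in> trees first_d a j. first_d - 1 \<notin> S})"
    by (simp add: N_def)
  also have "\<dots> = card {S \<in> trees first_d a j. first_d - 1 \<in> S} + card {S \<in> trees first_d a j. first_d - 1 \<notin> S}"
    by (rule card_Un_disjoint) (use finite_trees in auto)
  finally show ?thesis .
qed

text \<open>In column 0 nothing of the second kind is selected, whereas a tree avoiding the first
  block would contain \<open>m - 1\<close>. Only the injective root move remains, with factor
  1.\<close>

lemma N_Suc_c_0: "N 0 (Suc a) 0 \<le> N 0 a 0"
proof -
  have none: "{S \<in> trees first_d (Suc a) 0. first_d - 1 \<notin> S} = {}"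
  proof (rule equals0I)
    fix S assume S: "S \<in> {S \<in> trees first_d (Suc a) 0. first_d - 1 \<notin> S}"
    then have t: "tree first_d S" and "card {v \<in> S. c v} = Suc a" and "card {v \<in> S. \<not> c v} = 0"
      by (auto simp: trees_def)
    then have "S \<noteq> {}" "{v \<in> S. \<not> c v} = {}" using tree_finite[OF t] by auto
    then show False using stuck_tree(1)[OF t] S c_last by blast
  qed
  then have "N first_d (Suc a) 0 \<le> N (first_d - 1) a 0"
    unfolding N_split[of "Suc a"] none using card_last_in_S[of a 0] by simp
  then show ?thesis using N_root[of first_d 0] N_root[of "first_d - 1" 0] first_d(1) m_ge_2 by simp
qed

lemma N_Suc_c:
  assumes j: "j \<le> a"
  shows "N 0 (Suc a) j \<le> card blocks * N 0 a j"
proof -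
  have root: "N first_d x y = N 0 x y" "N (first_d - 1) x y = N 0 x y" for x y
    by (rule N_root; use first_d(1) m_ge_2 in simp)+
  have pos: "1 \<le> card blocks" using nruns_inner by simp
  have stuck: "card {S \<in> trees first_d (Suc a) j. first_d - 1 \<notin> S} \<le> (card blocks - 1) * N 0 a j"
  proof (cases "{S \<in> trees first_d (Suc a) j. first_d - 1 \<notin> S} = {}")
    case False
    then obtain S where t: "tree first_d S" and S: "card {v \<in> S. c v} = Suc a"
      "card {v \<in> S. \<not> c v} = j" "first_d - 1 \<notin> S" by (auto simp: trees_def)
    then have mS: "m - 1 \<in> S" using stuck_tree(1)[OF t] by force
    then have "m - 1 \<noteq> first_d" "m - 1 < m" using tree_sub[OF t] by auto
    then have d: "first_d < m - 1" using first_d(1) by simp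
    have "{v \<in> S. \<not> c v} \<noteq> {}" using mS c_last by blast
    moreover have "finite {v \<in> S. \<not> c v}" using tree_finite[OF t] by simp
    ultimately have "j \<noteq> 0" using S(2) by (metis card_0_eq)
    then obtain k where k: "j = Suc k" using not0_implies_Suc by blast
    have "card {S \<in> trees first_d (Suc a) j. first_d - 1 \<notin> S} \<le> card (words (map c inner) (Suc a) k)"
      unfolding k by (rule card_stuck_le_words)
    \<comment> \<open>The word has \<open>k = j - 1\<close> letters of the second kind, so the
      surplus condition \<open>k + 1 \<le> a\<close> is precisely \<open>j \<le> a\<close>.\<close>
    also have "\<dots> \<le> nruns False (map c inner) * card (words (map c inner) a k)"
      by (rule card_words_Suc_le) (use j k in simp)
    also have "\<dots> \<le> (card blocks - 1) * N first_d a j"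
      using nruns_inner card_words_le_N[OF d, of a k] unfolding k by (intro mult_le_mono) auto
    finally show ?thesis by (simp add: root)
  qed (simp only: card.empty zero_le)
  have "N 0 (Suc a) j = N first_d (Suc a) j" by (simp add: root)
  also have "\<dots> \<le> N 0 a j + (card blocks - 1) * N 0 a j"
    unfolding N_split by (rule add_mono[OF card_last_in_S[of a j, unfolded root] stuck])
  also have "\<dots> = card blocks * N 0 a j" using pos by (cases "card blocks") auto
  finally show ?thesis .
qed

subsection \<open>Consequences for the sums over antidiagonals\<close>

definition p_num :: nat where "p_num = card {v. v < m \<and> c v}"
definition q_num :: nat where "q_num = card {v. v < m \<and> \<not> c v}"

lemma p_num_pos: "1 \<le> p_num"
proof -
  have "card {0 :: nat} \<le> p_num"
    unfolding p_num_def by (rule card_mono) (use c_first m_ge_2 in auto)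
  then show ?thesis by simp
qed

text \<open>Witness: every sigma_1 hangs on the next one, the last of them on the root, and every
  sigma_2^-1 on its predecessor.\<close>

lemma N_full_pos: "1 \<le> N 0 (p_num - 1) 0"
proof -
  let ?S = "{v. v < m \<and> c v} - {0}"
  have cl: "leads_to (par 0 ?S) 0 v" if "v < m" "c v" for v
    using that
  proof (induction "m - v" arbitrary: v rule: less_induct)
    case less
    show ?case
    proof (cases "v = 0")
      case True
      then show ?thesis by (simp add: leads_to.here)
    next
      case False
      then have pv: "par 0 ?S v = nxt v" using less.prems by (simp add: par_def)
      from less.prems(1) have "leads_to (par 0 ?S) 0 (nxt v)"
      proof (cases rule: nxt_cases)
        case later
        then show ?thesis using less.hyps[of "nxt v"] less.prems c_nxt[of v] by simp
      next
        case wrap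
        then show ?thesis using less.prems leads_to.here by simp
      qed
      then show ?thesis using leads_to.step[of "par 0 ?S" 0 v] pv by simp
    qed
  qed
  have "leads_to (par 0 ?S) 0 v" if "v < m" for v
    using that
  proof (induction v)
    case 0
    show ?case by (rule leads_to.here)
  next
    case (Suc v)
    show ?case
    proof (cases "c (Suc v)")
      case True
      then show ?thesis using cl Suc.prems by blast
    next
      case False
      then have "par 0 ?S (Suc v) = v" by (simp add: par_def pred_def)
      then show ?thesis using Suc leads_to.step[of "par 0 ?S" 0 "Suc v"] by simp
    qed
  qed
  then have t: "tree 0 ?S" by (auto simp: tree_def)
  have "{v \<in> ?S. c v} = ?S" "{v \<in> ?S. \<not> c v} = {}" by auto
  moreover have "card ?S = p_num - 1"
    unfolding p_num_def using c_first m_ge_2 by (subst card_Diff_singleton) auto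
  ultimately have "?S \<in> trees 0 (p_num - 1) 0" using t unfolding trees_def by simp
  then have "N 0 (p_num - 1) 0 \<noteq> 0" unfolding N_def using finite_trees by (metis card_0_eq empty_iff)
  then show ?thesis by simp
qed

text \<open>Positivity spreads from \<open>N_full_pos\<close> along column 0 by
  \<open>N_Suc_c_0\<close>, just as \<open>N_row_pos\<close> carries it along the row by
  \<open>N_Suc_d\<close>.\<close>

lemma N_col_0_pos:
  assumes "a < p_num"
  shows "1 \<le> N 0 a 0"
proof -
  have "N 0 (a + i) 0 \<le> N 0 a 0" for i
  proof (induction i)
    case (Suc i)
    then show ?case using N_Suc_c_0[of "a + i"] by simp
  qed simp
  from this[of "p_num - 1 - a"] show ?thesis using N_full_pos assms by simp
qed

lemma N_row_pos:
  assumes "j < q_num"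
  shows "1 \<le> N 0 (p_num - 1) j"
  using assms
proof (induction j)
  case 0
  show ?case by (rule N_full_pos)
next
  case (Suc j)
  then have "1 \<le> N 0 (p_num - 1) j" by simp
  also have "\<dots> \<le> card blocks * N 0 (p_num - 1) (Suc j)"
    by (rule N_Suc_d) (use Suc.prems in \<open>simp add: q_num_def\<close>)
  finally show ?case by (cases "N 0 (p_num - 1) (Suc j)") auto
qed

definition diag :: "nat \<Rightarrow> nat" where
  "diag k = (\<Sum>i\<le>k. N 0 (p_num - 1 - i) (k - i))"

text \<open>The entry in row \<open>i = 0\<close> of the next antidiagonal has no partner and is the
  extra term; the others are compared one by one. For two or more blocks the entry with
  \<open>j = 0\<close> is strictly smaller, since its factor is 1 and not
  \<open>card blocks\<close>.\<close>

lemma diag_Suc: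
  assumes k: "k + 2 \<le> p_num"
  shows "diag k + card blocks * N 0 (p_num - 1) (Suc k) \<le> card blocks * diag (Suc k)"
    and "2 \<le> card blocks \<Longrightarrow>
      diag k + card blocks * N 0 (p_num - 1) (Suc k) < card blocks * diag (Suc k)"
proof -
  let ?n = "card blocks"
  define g where "g i = N 0 (p_num - 2 - i) (k - i)" for i
  have shift: "diag (Suc k) = N 0 (p_num - 1) (Suc k) + (\<Sum>i\<le>k. g i)"
    unfolding diag_def g_def by (subst sum.atMost_Suc_shift) (auto intro!: sum.cong simp: numeral_2_eq_2)
  have step: "N 0 (p_num - 1 - i) (k - i) \<le> ?n * g i" if "i \<le> k" for i
  proof -
    have "p_num - 1 - i = Suc (p_num - 2 - i)" using that k by simp
    \<comment> \<open>The requirement \<open>k - i \<le> p_num - 2 - i\<close> follows from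
      \<open>k + 2 \<le> p_num\<close> for every \<open>i\<close>.\<close>
    then show ?thesis unfolding g_def using N_Suc_c[of "k - i" "p_num - 2 - i"] that k by simp
  qed
  have "diag k \<le> (\<Sum>i\<le>k. ?n * g i)" unfolding diag_def by (rule sum_mono) (use step in simp)
  then show "diag k + ?n * N 0 (p_num - 1) (Suc k) \<le> ?n * diag (Suc k)"
    unfolding shift by (simp add: distrib_left sum_distrib_left)
  assume n: "2 \<le> ?n"
  have "N 0 (p_num - 1 - k) (k - k) < ?n * g k"
  proof -
    have "p_num - 1 - k = Suc (p_num - 2 - k)" using k by simp
    then have "N 0 (p_num - 1 - k) (k - k) \<le> g k" using N_Suc_c_0 by (simp add: g_def)
    moreover have "1 \<le> g k" unfolding g_def using N_col_0_pos k by simp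
    moreover have "2 * g k \<le> ?n * g k" using n by simp
    ultimately show ?thesis by linarith
  qed
  then have "\<exists>i\<in>{..k}. N 0 (p_num - 1 - i) (k - i) < ?n * g i" by blast
  then have "diag k < (\<Sum>i\<le>k. ?n * g i)"
    unfolding diag_def by (intro sum_strict_mono_ex1) (use step in simp_all)
  then show "diag k + ?n * N 0 (p_num - 1) (Suc k) < ?n * diag (Suc k)"
    unfolding shift by (simp add: distrib_left sum_distrib_left)
qed

text \<open>The number of tree edges of weight x3 or x4; in the Wirtinger digraph these are the
  choices that carry \<open>-t\<close>.\<close>

definition marks :: "nat set \<Rightarrow> nat" where
  "marks S = card {v. 0 < v \<and> v < m \<and> c v \<and> v \<notin> S} + card {v \<in> S. \<not> c v}"

lemma card_unmarked_c:
  assumes "tree 0 S"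
  shows "card {v. 0 < v \<and> v < m \<and> c v \<and> v \<notin> S} + card {v \<in> S. c v} = p_num - 1"
proof -
  have fin: "finite {v \<in> S. c v}" using tree_finite[OF assms] by simp
  have "{v. v < m \<and> c v} - {0} = {v. 0 < v \<and> v < m \<and> c v \<and> v \<notin> S} \<union> {v \<in> S. c v}"
    using tree_sub[OF assms] by (auto intro: gr0I)
  moreover have "card ({v. v < m \<and> c v} - {0}) = p_num - 1"
    unfolding p_num_def using c_first m_ge_2 by (subst card_Diff_singleton) auto
  ultimately show ?thesis using fin by (subst card_Un_disjoint[symmetric]) auto
qed

text \<open>For \<open>i \<le> k < p_num\<close> the difference \<open>p_num - 1 - i\<close> is not
  truncated, so \<open>i\<close> can be read as the number of edges of weight x3.\<close>

lemma card_marks: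
  assumes k: "k < p_num"
  shows "card {S. tree 0 S \<and> marks S = k} = diag k"
proof -
  have "{S. tree 0 S \<and> marks S = k} = (\<Union>i\<in>{..k}. trees 0 (p_num - 1 - i) (k - i))"
  proof (intro Set.set_eqI iffI)
    fix S assume "S \<in> {S. tree 0 S \<and> marks S = k}"
    then have t: "tree 0 S" and mk: "marks S = k" by auto
    have "S \<in> trees 0 (p_num - 1 - card {v. 0 < v \<and> v < m \<and> c v \<and> v \<notin> S})
        (k - card {v. 0 < v \<and> v < m \<and> c v \<and> v \<notin> S})"
      using t mk card_unmarked_c[OF t] unfolding trees_def marks_def mem_Collect_eq by linarith
    moreover have "card {v. 0 < v \<and> v < m \<and> c v \<and> v \<notin> S} \<le> k" using mk by (simp add: marks_def)
    ultimately show "S \<in> (\<Union>i\<in>{..k}. trees 0 (p_num - 1 - i) (k - i))" by blast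
  next
    fix S assume "S \<in> (\<Union>i\<in>{..k}. trees 0 (p_num - 1 - i) (k - i))"
    then obtain i where i: "i \<le> k" "S \<in> trees 0 (p_num - 1 - i) (k - i)" by auto
    then have t: "tree 0 S" and ca: "card {v \<in> S. c v} = p_num - 1 - i" "card {v \<in> S. \<not> c v} = k - i"
      by (auto simp: trees_def)
    then have "marks S = k" using card_unmarked_c[OF t] i k by (simp add: marks_def)
    then show "S \<in> {S. tree 0 S \<and> marks S = k}" using t by simp
  qed
  moreover have "card (\<Union>i\<in>{..k}. trees 0 (p_num - 1 - i) (k - i)) = diag k"
    unfolding diag_def N_def
  proof (rule card_UN_disjoint)
    show "\<forall>i\<in>{..k}. \<forall>j\<in>{..k}. i \<noteq> j \<longrightarrow>
        trees 0 (p_num - 1 - i) (k - i) \<inter> trees 0 (p_num - 1 - j) (k - j) = {}"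
      by (auto simp: trees_def)
  qed (auto simp: finite_trees)
  ultimately show ?thesis by simp
qed

end

section \<open>The refined Crowell polynomial\<close>

definition sigma1_at :: "braid_letter list \<Rightarrow> nat \<Rightarrow> bool" where
  "sigma1_at w v \<longleftrightarrow> w ! v = Sigma 1"

lemma nth_filter_upt:
  assumes "v < n" "P v"
  shows "card {x. x < v \<and> P x} < length (filter P [0..<n])"
    and "filter P [0..<n] ! card {x. x < v \<and> P x} = v"
proof -
  have split: "[0..<n] = [0..<v] @ v # [Suc v..<n]"
    using assms(1) by (metis upt_add_eq_append upt_conv_Cons add_0 le_add_diff_inverse less_imp_le_nat zero_le)
  have "card {x. x < v \<and> P x} = length (filter P [0..<v])"
  proof -
    have "{x. x < v \<and> P x} = set (filter P [0..<v])" by auto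
    then show ?thesis by (simp only: distinct_card distinct_filter distinct_upt)
  qed
  then show "card {x. x < v \<and> P x} < length (filter P [0..<n])"
    and "filter P [0..<n] ! card {x. x < v \<and> P x} = v"
    unfolding split using assms(2) by (simp_all add: nth_append)
qed

lemma length_filter_upt: "length (filter P [0..<n]) = card {x. x < n \<and> P x}"
proof -
  have "{x. x < n \<and> P x} = set (filter P [0..<n])" by auto
  then show ?thesis by (simp only: distinct_card distinct_filter distinct_upt)
qed

context cyclic_word
begin

definition index :: "nat \<Rightarrow> nat" where
  "index v = card {x. x < v \<and> c x = c v}"

lemma index_lt: "v < m \<Longrightarrow> index v < length (filter (\<lambda>x. c x = c v) [0..<m])"
  and nth_index: "v < m \<Longrightarrow> filter (\<lambda>x. c x = c v) [0..<m] ! index v = v"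
  using nth_filter_upt[of v m "\<lambda>x. c x = c v"] by (simp_all add: index_def)

lemma index_nth:
  assumes "k < length (filter (\<lambda>x. c x = b) [0..<m])"
  shows "index (filter (\<lambda>x. c x = b) [0..<m] ! k) = k"
    and "filter (\<lambda>x. c x = b) [0..<m] ! k < m" "c (filter (\<lambda>x. c x = b) [0..<m] ! k) = b"
proof -
  let ?L = "filter (\<lambda>x. c x = b) [0..<m]"
  have "?L ! k \<in> set ?L" using assms by (rule nth_mem)
  then show 1: "?L ! k < m" "c (?L ! k) = b" by auto
  then have "?L ! index (?L ! k) = ?L ! k" "index (?L ! k) < length ?L"
    using nth_index[of "?L ! k"] index_lt[of "?L ! k"] by simp_all
  then show "index (?L ! k) = k"
    using assms by (simp add: nth_eq_iff_index_eq distinct_filter)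
qed

text \<open>Identifies \<open>nxt v\<close> with the tail that \<open>crowell_graph\<close> gives to
  the cycle arc ending at \<open>v\<close>.\<close>

lemma nxt_index:
  assumes v: "v < m"
  defines "L \<equiv> filter (\<lambda>x. c x = c v) [0..<m]"
  shows "L ! (Suc (index v) mod length L) = nxt v"
proof -
  have cn: "c (nxt v) = c v" "nxt v < m" using v c_nxt nxt_lt by auto
  have ins: "card (insert v {x. x < v \<and> c x = c v}) = Suc (index v)"
    unfolding index_def by (subst card_insert_disjoint) auto
  have nth: "L ! index (nxt v) = nxt v" "index (nxt v) < length L"
    using nth_index[OF cn(2)] index_lt[OF cn(2)] unfolding L_def cn(1) by auto
  from v show ?thesis
  proof (cases rule: nxt_cases)
    case later
    have "x < nxt v \<and> c x = c v \<longleftrightarrow> x = v \<or> (x < v \<and> c x = c v)" for x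
      using later(1) later(3)[of x] by (cases "v < x") auto
    then have "{x. x < nxt v \<and> c x = c (nxt v)} = insert v {x. x < v \<and> c x = c v}"
      unfolding cn(1) by blast
    then have "index (nxt v) = Suc (index v)" using ins by (simp add: index_def)
    then show ?thesis using nth by simp
  next
    case wrap
    have "x < m \<and> c x = c v \<longleftrightarrow> x = v \<or> (x < v \<and> c x = c v)" for x
      using v wrap(1)[of x] by (cases "v < x") auto
    then have "{x. x < m \<and> c x = c v} = insert v {x. x < v \<and> c x = c v}" by blast
    then have "length L = Suc (index v)" using ins by (simp add: L_def length_filter_upt)
    moreover have "c x \<noteq> c (nxt v)" if "x < nxt v" for x
      using wrap(2) that first_d(4)[of x] first_d(2) by (cases "c v") auto
    then have "{x. x < nxt v \<and> c x = c (nxt v)} = {}" by blast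
    then have "index (nxt v) = 0" by (simp add: index_def)
    ultimately show ?thesis using nth by simp
  qed
qed

lemma Suc_pred_mod: "v < m \<Longrightarrow> Suc (pred v) mod m = v"
  using m_ge_2 by (auto simp: pred_def)

lemma pred_Suc_mod: "v < m \<Longrightarrow> pred (Suc v mod m) = v"
  by (cases "Suc v = m") (auto simp: pred_def)

end

section \<open>Spanning trees of the Crowell graph and their weights\<close>

locale crowell_word =
  fixes w :: "braid_letter list"
  assumes letters: "set w \<subseteq> {Sigma 1, SigmaInv 2}" and nonempty: "w \<noteq> []"
    and hd_w: "hd w = Sigma 1" and last_w: "last w = SigmaInv 2"

sublocale crowell_word \<subseteq> cyclic_word "length w" "sigma1_at w"
  by unfold_locales
    (use hd_w last_w nonempty in \<open>auto simp: sigma1_at_def hd_conv_nth last_conv_nth\<close>)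

context crowell_word
begin

lemma nth_w: "v < length w \<Longrightarrow> w ! v = (if sigma1_at w v then Sigma 1 else SigmaInv 2)"
  using subsetD[OF letters nth_mem[of v w]] by (auto simp: sigma1_at_def)

lemma crossings1: "crossings w (Sigma 1) = filter (\<lambda>x. sigma1_at w x = True) [0..<length w]"
  by (simp add: crossings_def sigma1_at_def)

lemma crossings2: "crossings w (SigmaInv 2) = filter (\<lambda>x. sigma1_at w x = False) [0..<length w]"
  unfolding crossings_def by (rule filter_cong) (auto simp: nth_w)

lemma length_crossings:
  "length (crossings w (Sigma 1)) = p_num" "length (crossings w (SigmaInv 2)) = q_num"
  unfolding crossings1 crossings2 length_filter_upt p_num_def q_num_def by simp_all

text \<open>\<open>barc v\<close> and \<open>farc v\<close> are the two arcs ending at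
  \<open>v\<close>. They are indexed by their head because a rooted tree selects one incoming arc
  per vertex.\<close>

definition barc :: "nat \<Rightarrow> crowell_arc" where
  "barc v = (if sigma1_at w v then Cycle1 (index v) else Cycle2 (index v))"

definition farc :: "nat \<Rightarrow> crowell_arc" where
  "farc v = Around (pred v)"

definition tree_arc :: "nat set \<Rightarrow> nat \<Rightarrow> crowell_arc" where
  "tree_arc S v = (if v \<in> S then barc v else farc v)"

abbreviation (input) "G \<equiv> crowell_graph w"

lemma verts_G: "verts G = {..<length w}"
  unfolding crowell_graph_def Let_def crossings1 crossings2 by auto

lemma head_tail:
  assumes "v < length w"
  shows "head G (barc v) = v" "tail G (barc v) = nxt v" "head G (farc v) = v" "tail G (farc v) = pred v"
  using nth_index[OF assms] nxt_index[OF assms] Suc_pred_mod[OF assms]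
  unfolding crowell_graph_def Let_def crossings1 crossings2 barc_def farc_def
  by (auto split: if_splits)

lemma arcs_G: "arcs G = barc ` {..<length w} \<union> farc ` {..<length w}"
proof (intro Set.set_eqI iffI)
  fix e assume "e \<in> arcs G"
  then consider k where "e = Cycle1 k" "k < length (crossings w (Sigma 1))"
    | k where "e = Cycle2 k" "k < length (crossings w (SigmaInv 2))"
    | l where "e = Around l" "l < length w"
    unfolding crowell_graph_def Let_def by auto
  then show "e \<in> barc ` {..<length w} \<union> farc ` {..<length w}"
  proof cases
    case 1
    from 1(2) have i: "index (crossings w (Sigma 1) ! k) = k" "crossings w (Sigma 1) ! k < length w"
      "sigma1_at w (crossings w (Sigma 1) ! k) = True"
      unfolding crossings1 using index_nth by blast+
    then have "e = barc (crossings w (Sigma 1) ! k)" using 1(1) by (simp add: barc_def)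
    then show ?thesis using i by blast
  next
    case 2
    from 2(2) have i: "index (crossings w (SigmaInv 2) ! k) = k" "crossings w (SigmaInv 2) ! k < length w"
      "sigma1_at w (crossings w (SigmaInv 2) ! k) = False"
      unfolding crossings2 using index_nth by blast+
    then have "e = barc (crossings w (SigmaInv 2) ! k)" using 2(1) by (simp add: barc_def)
    then show ?thesis using i by blast
  next
    case 3
    then have "e = farc (Suc l mod length w)" using pred_Suc_mod by (simp add: farc_def)
    moreover have "Suc l mod length w < length w" using m_ge_2 by (intro mod_less_divisor) linarith
    ultimately show ?thesis by blast
  qed
next
  fix e assume "e \<in> barc ` {..<length w} \<union> farc ` {..<length w}"
  then show "e \<in> arcs G"
  proof
    assume "e \<in> farc ` {..<length w}"
    then show ?thesis using pred_lt unfolding crowell_graph_def Let_def farc_def by auto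
  next
    assume "e \<in> barc ` {..<length w}"
    then obtain v where v: "v < length w" "e = barc v" by blast
    then show ?thesis using index_lt[OF v(1)]
      unfolding crowell_graph_def Let_def barc_def crossings1 crossings2 by (auto split: if_splits)
  qed
qed

lemma barc_ne_farc: "barc u \<noteq> farc v"
  by (simp add: barc_def farc_def)

lemma head_tail_tree_arc:
  assumes "v < length w" "v \<noteq> r"
  shows "head G (tree_arc S v) = v" "tail G (tree_arc S v) = par r S v"
  using head_tail[OF assms(1)] assms(2) by (auto simp: tree_arc_def par_def)

lemma inj_on_tree_arc: "inj_on (tree_arc S) {..<length w}"
  by (rule inj_on_inverseI[where g = "head G"]) (auto simp: tree_arc_def head_tail)

lemma root_G: "crossings w (Sigma 1) ! 0 = 0"
proof -
  have "index 0 = 0" by (simp add: index_def)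
  moreover have "0 < length w" using m_ge_2 by linarith
  ultimately show ?thesis unfolding crossings1 using nth_index[of 0] c_first by simp
qed

text \<open>Arcs point away from the root while \<open>par\<close> points towards it, so the path
  from the root is built by appending the arc at \<open>v\<close> last.\<close>

lemma tree_imp_spanning:
  assumes t: "tree 0 S"
  shows "tree_arc S ` ({..<length w} - {0}) \<in> rooted_spanning_trees G 0"
proof -
  let ?T = "tree_arc S ` ({..<length w} - {0})"
  have ht: "head G (tree_arc S v) = v" "tail G (tree_arc S v) = par 0 S v"
    if "v < length w" "v \<noteq> 0" for v
    by (rule head_tail_tree_arc[OF that])+
  have sub: "?T \<subseteq> arcs G" unfolding arcs_G by (auto simp: tree_arc_def)
  have ex1: "\<exists>!e. e \<in> ?T \<and> head G e = v" if "v \<in> verts G" "v \<noteq> 0" for v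
  proof (rule ex1I[of _ "tree_arc S v"])
    show "tree_arc S v \<in> ?T \<and> head G (tree_arc S v) = v" using that ht[of v] by (auto simp: verts_G)
    fix e assume e: "e \<in> ?T \<and> head G e = v"
    then obtain u where "u < length w" "u \<noteq> 0" "e = tree_arc S u" by auto
    then show "e = tree_arc S v" using ht(1)[of u] e by simp
  qed
  have reach: "(0, v) \<in> {(tail G e, head G e) | e. e \<in> ?T}\<^sup>*" if "v \<in> verts G" for v
  proof -
    have "leads_to (par 0 S) 0 v" "v < length w" using t that by (auto simp: tree_def verts_G)
    then show ?thesis
    proof (induction rule: leads_to.induct)
      case (step v)
      show ?case
      proof (cases "v = 0")
        case False
        have "(par 0 S v, v) \<in> {(tail G e, head G e) | e. e \<in> ?T}"
        proof -
          have "tree_arc S v \<in> ?T" using step.prems False by simp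
          then show ?thesis using ht[OF step.prems False] by force
        qed
        moreover have "(0, par 0 S v) \<in> {(tail G e, head G e) | e. e \<in> ?T}\<^sup>*"
          using step.IH par_lt[OF step.prems] by simp
        ultimately show ?thesis by (rule rtrancl_into_rtrancl[rotated])
      qed simp
    qed simp
  qed
  have "\<forall>e\<in>?T. head G e \<noteq> 0" using ht by auto
  then show ?thesis unfolding rooted_spanning_trees_def using sub ex1 reach by simp
qed

lemma spanning_imp_tree:
  assumes T: "T \<in> rooted_spanning_trees G 0"
  defines "S \<equiv> {v. v < length w \<and> v \<noteq> 0 \<and> barc v \<in> T}"
  shows "tree 0 S" and "T = tree_arc S ` ({..<length w} - {0})"
proof -
  note T' = T[unfolded rooted_spanning_trees_def mem_Collect_eq verts_G]
  have sub: "T \<subseteq> arcs G" using T' by (rule conjunct1)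
  have nr: "head G e \<noteq> 0" if "e \<in> T" for e
    using T'[THEN conjunct2, THEN conjunct1] that by (rule bspec)
  have ex1: "\<exists>!e. e \<in> T \<and> head G e = v" if "v < length w" "v \<noteq> 0" for v
    using bspec[OF T'[THEN conjunct2, THEN conjunct2, THEN conjunct1], of v] that by simp
  have reach: "(0, v) \<in> {(tail G e, head G e) | e. e \<in> T}\<^sup>*" if "v < length w" for v
    using bspec[OF T'[THEN conjunct2, THEN conjunct2, THEN conjunct2], of v] that by simp
  have cases: "\<exists>v. v < length w \<and> head G e = v \<and> v \<noteq> 0 \<and> (e = barc v \<or> e = farc v)" if "e \<in> T" for e
  proof -
    have "e \<in> barc ` {..<length w} \<union> farc ` {..<length w}" using sub that unfolding arcs_G by blast
    then obtain v where "v < length w" "e = barc v \<or> e = farc v" by blast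
    moreover have "head G e = v" using calculation head_tail(1,3)[of v] by auto
    ultimately show ?thesis using nr[OF that] by auto
  qed
  have in_T: "e = tree_arc S (head G e)" if e: "e \<in> T" for e
  proof -
    obtain v where v: "v < length w" "head G e = v" "v \<noteq> 0" "e = barc v \<or> e = farc v"
      using cases[OF e] by blast
    show ?thesis
    proof (cases "e = barc v")
      case True
      then have "v \<in> S" using v e by (simp add: S_def)
      then show ?thesis using True v by (simp add: tree_arc_def)
    next
      case False
      then have ef: "e = farc v" using v by blast
      have "barc v \<notin> T"
      proof
        assume "barc v \<in> T"
        moreover note head_tail(1)[OF v(1)] e v(2)
        ultimately have "barc v = e" using ex1[OF v(1,3)] by (auto elim!: ex1E)
        then show False using False by simp
      qed
      then have "v \<notin> S" by (simp add: S_def)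
      then show ?thesis using ef v by (simp add: tree_arc_def)
    qed
  qed
  show T_eq: "T = tree_arc S ` ({..<length w} - {0})"
  proof (intro Set.set_eqI iffI)
    fix e assume "e \<in> T"
    then have "e = tree_arc S (head G e)" "head G e \<in> {..<length w} - {0}"
      using in_T[of e] cases[of e] by auto
    then show "e \<in> tree_arc S ` ({..<length w} - {0})" by (rule image_eqI)
  next
    fix e assume "e \<in> tree_arc S ` ({..<length w} - {0})"
    then obtain v where v: "v < length w" "v \<noteq> 0" "e = tree_arc S v" by auto
    then obtain e' where e': "e' \<in> T" "head G e' = v" using ex1_implies_ex[OF ex1] by auto
    then show "e \<in> T" using in_T[OF e'(1)] v by simp
  qed
  have "leads_to (par 0 S) 0 v" if "(0, v) \<in> {(tail G e, head G e) | e. e \<in> T}\<^sup>*" for v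
    using that
  proof (induction rule: rtrancl_induct)
    case base
    show ?case by (rule leads_to.here)
  next
    case (step y z)
    then obtain e where e: "e \<in> T" "y = tail G e" "z = head G e" by blast
    obtain u where u: "u < length w" "u \<noteq> 0" "e = tree_arc S u" using e(1) unfolding T_eq by auto
    have "z = u" "y = par 0 S u" using head_tail_tree_arc[OF u(1,2)] e u(3) by auto
    then show ?case using step.IH leads_to.step[of "par 0 S" 0 u] by simp
  qed
  then show "tree 0 S" using reach by (auto simp: tree_def S_def)
qed

lemma all_crowell_var: "(\<forall>x. P x) \<longleftrightarrow> P X1 \<and> P X2 \<and> P X3 \<and> P X4"
  by (rule iffI, blast, rule allI, case_tac x) simp_all

lemma prod_Var:
  assumes "finite A"
  shows "(\<Prod>v\<in>A. Var (g v)) = Poly_Mapping.single (\<Sum>v\<in>A. Poly_Mapping.single (g v) 1) 1"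
  using assms by induction (simp_all add: Var_def mult_single single_one)

lemma lookup_sum_single:
  assumes "finite A"
  shows "Poly_Mapping.lookup (\<Sum>v\<in>A. Poly_Mapping.single (g v) (1 :: nat)) x = card {v \<in> A. g v = x}"
  using assms
proof induction
  case (insert a A)
  have "{v \<in> insert a A. g v = x} = (if g a = x then insert a {v \<in> A. g v = x} else {v \<in> A. g v = x})"
    by auto
  then show ?case using insert by (simp add: lookup_add lookup_single when_def)
qed simp

lemma crowell_coeff_eq:
  assumes i: "i < p_num"
  shows "crowell_coeff w i j = int (N 0 (p_num - 1 - i) j)"
proof -
  let ?V = "{..<length w} - {0}"
  define wt where "wt S v = (if sigma1_at w v then if v \<in> S then X1 else X3
                             else if v \<in> S then X4 else X2)" for S v
  define ex where "ex S = (\<Sum>v\<in>?V. Poly_Mapping.single (wt S v) (1 :: nat))" for S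
  define M where "M = Poly_Mapping.single X1 (p_num - 1 - i) + Poly_Mapping.single X2 (q_num - j) +
         Poly_Mapping.single X3 i + Poly_Mapping.single X4 j"
  have weight: "crowell_weight w (tree_arc S v) = wt S v" if "v < length w" for S v
    using that Suc_pred_mod[OF that] nth_w[OF that]
    by (auto simp: crowell_weight_def tree_arc_def barc_def farc_def wt_def)
  have bij: "bij_betw (\<lambda>S. tree_arc S ` ?V) {S. tree 0 S} (rooted_spanning_trees G 0)"
    unfolding bij_betw_def
  proof
    show "inj_on (\<lambda>S. tree_arc S ` ?V) {S. tree 0 S}"
    proof (rule inj_onI)
      fix S S' assume S: "S \<in> {S. tree 0 S}" "S' \<in> {S. tree 0 S}"
        and eq: "tree_arc S ` ?V = tree_arc S' ` ?V"
      have "S = {v. v < length w \<and> v \<noteq> 0 \<and> barc v \<in> tree_arc S ` ?V}"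
        if S: "tree 0 S" for S
      proof -
        have "barc v \<in> tree_arc S ` ?V \<longleftrightarrow> v \<in> S" if v: "v < length w" "v \<noteq> 0" for v
        proof
          assume "barc v \<in> tree_arc S ` ?V"
          then obtain u where u: "u < length w" "u \<noteq> 0" "barc v = tree_arc S u" by auto
          then have "v = u" using head_tail(1)[OF v(1)] head_tail_tree_arc(1)[OF u(1,2)] by metis
          then show "v \<in> S" using u(3) barc_ne_farc by (auto simp: tree_arc_def split: if_splits)
        next
          assume "v \<in> S"
          then show "barc v \<in> tree_arc S ` ?V" using v by (auto simp: tree_arc_def intro!: image_eqI[of _ _ v])
        qed
        then show ?thesis using S by (auto simp: tree_def)
      qed
      from this[of S] this[of S'] show "S = S'" using S eq by simp
    qed
    show "(\<lambda>S. tree_arc S ` ?V) ` {S. tree 0 S} = rooted_spanning_trees G 0"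
      using tree_imp_spanning spanning_imp_tree by blast
  qed
  have fin: "finite {S. tree 0 S}"
    by (rule finite_subset[of _ "Pow {..<length w}"]) (auto simp: tree_def)
  have "crowell_poly w = (\<Sum>S | tree 0 S. \<Prod>e\<in>tree_arc S ` ?V. Var (crowell_weight w e))"
    unfolding crowell_poly_def root_G by (rule sum.reindex_bij_betw[OF bij, symmetric])
  also have "\<dots> = (\<Sum>S | tree 0 S. Poly_Mapping.single (ex S) 1)"
  proof (rule sum.cong[OF refl])
    fix S
    have "inj_on (tree_arc S) ?V" using inj_on_tree_arc by (rule inj_on_subset) auto
    then have "(\<Prod>e\<in>tree_arc S ` ?V. Var (crowell_weight w e))
        = (\<Prod>v\<in>?V. Var (crowell_weight w (tree_arc S v)))"
      by (simp add: prod.reindex)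
    also have "\<dots> = (\<Prod>v\<in>?V. Var (wt S v))" by (rule prod.cong) (auto simp: weight)
    finally show "(\<Prod>e\<in>tree_arc S ` ?V. Var (crowell_weight w e)) = Poly_Mapping.single (ex S) 1"
      unfolding ex_def by (simp only: prod_Var finite_Diff finite_lessThan)
  qed
  finally have poly: "crowell_poly w = (\<Sum>S | tree 0 S. Poly_Mapping.single (ex S) 1)" .
  have "crowell_coeff w i j = Poly_Mapping.lookup (crowell_poly w) M"
    unfolding crowell_coeff_def Let_def length_crossings M_def by (rule refl)
  also have "\<dots> = (\<Sum>S | tree 0 S. if ex S = M then 1 else 0)"
    unfolding poly lookup_sum by (rule sum.cong) (auto simp: lookup_single when_def)
  also have "\<dots> = (\<Sum>S | tree 0 S \<and> ex S = M. 1)"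
    using fin by (intro sum.mono_neutral_cong_right) auto
  also have "\<dots> = int (card {S. tree 0 S \<and> ex S = M})" by simp
  also have "{S. tree 0 S \<and> ex S = M} = trees 0 (p_num - 1 - i) j"
  proof (intro Set.set_eqI)
    fix S
    show "S \<in> {S. tree 0 S \<and> ex S = M} \<longleftrightarrow> S \<in> trees 0 (p_num - 1 - i) j"
    proof (cases "tree 0 S")
      case False
      then show ?thesis by (simp add: trees_def)
    next
      case t: True
      have lk: "Poly_Mapping.lookup (ex S) x = card {v \<in> ?V. wt S v = x}" for x
        unfolding ex_def by (rule lookup_sum_single) simp
      have S: "S \<subseteq> ?V" using t by (auto simp: tree_def)
      have x1: "{v \<in> ?V. wt S v = X1} = {v \<in> S. sigma1_at w v}"
        and x4: "{v \<in> ?V. wt S v = X4} = {v \<in> S. \<not> sigma1_at w v}"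
        and x3: "{v \<in> ?V. wt S v = X3} = {v. 0 < v \<and> v < length w \<and> sigma1_at w v \<and> v \<notin> S}"
        using S by (auto simp: wt_def split: if_splits)
      have nz: "0 < v" if "\<not> sigma1_at w v" for v using c_first that by (cases "v = 0") auto
      have x2: "{v \<in> ?V. wt S v = X2} = {v. v < length w \<and> \<not> sigma1_at w v \<and> v \<notin> S}"
        by (auto simp: wt_def nz split: if_splits)
      have "S \<subseteq> {..<length w}" using S by blast
      then have c2: "card {v \<in> ?V. wt S v = X2} + card {v \<in> S. \<not> sigma1_at w v} = q_num"
        unfolding x2 q_num_def by (rule card_not_c)
      have c3: "card {v \<in> ?V. wt S v = X3} + card {v \<in> S. sigma1_at w v} = p_num - 1"
        unfolding x3 by (rule card_unmarked_c[OF t])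
      have "ex S = M \<longleftrightarrow> (\<forall>x. Poly_Mapping.lookup (ex S) x = Poly_Mapping.lookup M x)"
        by (simp add: poly_mapping_eq_iff fun_eq_iff)
      also have "\<dots> \<longleftrightarrow> card {v \<in> S. sigma1_at w v} = p_num - 1 - i \<and> card {v \<in> ?V. wt S v = X2} = q_num - j
          \<and> card {v \<in> ?V. wt S v = X3} = i \<and> card {v \<in> S. \<not> sigma1_at w v} = j"
        unfolding all_crowell_var lk x1 x4 by (simp add: M_def lookup_add lookup_single)
      \<comment> \<open>There are \<open>q_num\<close> letters of the second kind and
        \<open>p_num - 1\<close> non-root letters of the first, so the exponents of x2 and x3 follow
        from those of x4 and x1.\<close>
      also have "\<dots> \<longleftrightarrow> card {v \<in> S. sigma1_at w v} = p_num - 1 - i \<and> card {v \<in> S. \<not> sigma1_at w v} = j"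
      proof (intro iffI conjI; elim conjE)
        assume eq: "card {v \<in> S. sigma1_at w v} = p_num - 1 - i" "card {v \<in> S. \<not> sigma1_at w v} = j"
        show "card {v \<in> ?V. wt S v = X2} = q_num - j" using c2 unfolding eq by arith
        show "card {v \<in> ?V. wt S v = X3} = i" using c3 i unfolding eq by arith
      qed
      finally show ?thesis using t by (simp add: trees_def)
    qed
  qed
  finally show ?thesis by (simp add: N_def)
qed

end

section \<open>The Alexander polynomial\<close>

text \<open>Brings the Wirtinger relations into the row order and signs of a Laplacian; the sign of
  the determinant is immaterial up to units.\<close>

lemma det_signed_permutation:
  fixes M :: "'a :: comm_ring_1 mat"
  assumes M: "M \<in> carrier_mat n n" and p: "p permutes {0..<n}"
    and e: "\<And>i. i < n \<Longrightarrow> e i = 1 \<or> e i = -1"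
    and B: "\<And>i j. i < n \<Longrightarrow> j < n \<Longrightarrow> B $$ (i, j) = e i * M $$ (p i, j)" "B \<in> carrier_mat n n"
  shows "det B = det M \<or> det B = - det M"
proof -
  have pn: "p i < n" if "i < n" for i using permutes_in_image[OF p, of i] that by simp
  have "(\<Prod>i\<in>X. e i) = 1 \<or> (\<Prod>i\<in>X. e i) = -1" if "finite X" "X \<subseteq> {0..<n}" for X
    using that
  proof (induction X)
    case (insert x X)
    then have "(\<Prod>i\<in>X. e i) = 1 \<or> (\<Prod>i\<in>X. e i) = -1" "e x = 1 \<or> e x = -1" using e[of x] by auto
    then show ?case using insert.hyps by auto
  qed simp
  then have E: "(\<Prod>i=0..<n. e i) = 1 \<or> (\<Prod>i=0..<n. e i) = -1" by simp
  have "det B = (\<Sum>q\<in>{q. q permutes {0..<n}}. of_int (sign q) * (\<Prod>i=0..<n. B $$ (i, q i)))"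
    by (rule det_def'[OF B(2)])
  also have "\<dots> = (\<Sum>q\<in>{q. q permutes {0..<n}}. (\<Prod>i=0..<n. e i) *
      (of_int (sign q) * (\<Prod>i=0..<n. mat n n (\<lambda>(i, j). M $$ (p i, j)) $$ (i, q i))))"
  proof (rule sum.cong[OF refl])
    fix q assume "q \<in> {q. q permutes {0..<n}}"
    then have qn: "q i < n" if "i < n" for i using permutes_in_image[of q "{0..<n}" i] that by simp
    have "(\<Prod>i=0..<n. B $$ (i, q i)) = (\<Prod>i=0..<n. e i * mat n n (\<lambda>(i, j). M $$ (p i, j)) $$ (i, q i))"
      by (rule prod.cong) (use B(1) qn in auto)
    then show "of_int (sign q) * (\<Prod>i=0..<n. B $$ (i, q i)) = (\<Prod>i=0..<n. e i) *
      (of_int (sign q) * (\<Prod>i=0..<n. mat n n (\<lambda>(i, j). M $$ (p i, j)) $$ (i, q i)))"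
      by (simp only: prod.distrib mult_ac)
  qed
  also have "\<dots> = (\<Prod>i=0..<n. e i) * det (mat n n (\<lambda>(i, j). M $$ (p i, j)))"
    by (simp only: sum_distrib_left det_def'[OF mat_carrier])
  also have "\<dots> = (\<Prod>i=0..<n. e i) * (of_int (sign p) * det M)"
    by (simp only: det_permute_rows[OF M p])
  finally have "det B = (\<Prod>i=0..<n. e i) * (of_int (sign p) * det M)" .
  moreover have "sign p = 1 \<or> sign p = -1" by (auto simp: sign_def)
  ultimately show ?thesis using E by auto
qed

lemma Gcd_least_element:
  fixes D :: "int poly"
  assumes "D \<in> X" "\<And>x. x \<in> X \<Longrightarrow> D dvd x"
  shows "Gcd X = D \<or> Gcd X = - D"
proof -
  have "Gcd X dvd D" using assms(1) by (rule Gcd_dvd)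
  then obtain k where k: "D = Gcd X * k" by (rule dvdE)
  have "D dvd Gcd X" using assms(2) by (rule Gcd_greatest)
  then obtain l where l: "Gcd X = D * l" by (rule dvdE)
  show ?thesis
  proof (cases "D = 0")
    case True
    then show ?thesis using l by simp
  next
    case False
    have "D * (l * k) = D * 1" using k unfolding l by (simp add: mult.assoc)
    then have "l * k = 1" using mult_left_cancel[OF False] by blast
    then have "l dvd 1" by (metis dvdI)
    then obtain u where u: "l = [:u:]" "u dvd 1" by (auto simp: is_unit_poly_iff)
    then have "u = 1 \<or> u = -1" by auto
    then show ?thesis using l u(1) by auto
  qed
qed

lemma coeff_0_at_minus_t: "coeff (at_minus_t f) 0 = coeff f 0"
  by (simp add: at_minus_t_def poly_0_coeff_0[symmetric] poly_pcompose)

text \<open>Two normalized representatives differ by a unit: their nonzero constant terms rule out a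
  power of t, and the positivity of these terms rules out the sign.\<close>

lemma alexander_poly_eqI:
  assumes eq: "equal_up_to_units f (alexander_gcd n w)"
    and nonneg: "\<And>k. 0 \<le> coeff (at_minus_t f) k" and nz: "coeff (at_minus_t f) 0 \<noteq> 0"
  shows "alexander_poly n w = f"
  unfolding alexander_poly_def
proof (rule the_equality)
  show "equal_up_to_units f (alexander_gcd n w) \<and> (\<forall>k. 0 \<le> coeff (at_minus_t f) k) \<and>
    coeff (at_minus_t f) 0 \<noteq> 0" using assms by blast
  fix f' assume f': "equal_up_to_units f' (alexander_gcd n w) \<and> (\<forall>k. 0 \<le> coeff (at_minus_t f') k) \<and>
    coeff (at_minus_t f') 0 \<noteq> 0"
  let ?g = "alexander_gcd n w"
  obtain a b where ab: "monom 1 a * f = monom 1 b * ?g \<or> monom 1 a * f = - (monom 1 b * ?g)"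
    using eq unfolding equal_up_to_units_def by blast
  obtain a' b' where ab': "monom 1 a' * f' = monom 1 b' * ?g \<or> monom 1 a' * f' = - (monom 1 b' * ?g)"
    using f' unfolding equal_up_to_units_def by blast
  have split: "monom 1 (x + y) * (h :: int poly) = monom 1 x * (monom 1 y * h)" for x y h
    by (simp add: mult_monom mult.assoc[symmetric])
  have signs: "x = h \<or> x = - h \<Longrightarrow> y = h \<or> y = - h \<Longrightarrow> x = y \<or> x = - y" for x y h :: "int poly"
    by (elim disjE) simp_all
  have rel: "monom 1 (b' + a) * f = monom 1 (b + a') * f' \<or> monom 1 (b' + a) * f = - (monom 1 (b + a') * f')"
    unfolding split[of b' a f] split[of b a' f']
  proof (rule signs)
    let ?h = "monom 1 b' * (monom 1 b * ?g)"
    show "monom 1 b' * (monom 1 a * f) = ?h \<or> monom 1 b' * (monom 1 a * f) = - ?h"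
      using ab by (metis mult_minus_right)
    have "?h = monom 1 b * (monom 1 b' * ?g)" by (rule mult.left_commute)
    then show "monom 1 b * (monom 1 a' * f') = ?h \<or> monom 1 b * (monom 1 a' * f') = - ?h"
      using ab' by (metis mult_minus_right)
  qed
  have c0: "coeff f 0 \<noteq> 0" "coeff f' 0 \<noteq> 0" using nz f' by (simp_all add: coeff_0_at_minus_t)
  have cf: "coeff (monom 1 k * (h :: int poly)) l = (if l < k then 0 else coeff h (l - k))" for k h l
    by (simp add: coeff_monom_mult)
  define L where "L = monom 1 (b' + a) * f"
  define R where "R = monom 1 (b + a') * f'"
  have LR: "L = R \<or> L = - R" using rel unfolding L_def R_def .
  then have coeffs: "coeff L k = coeff R k \<or> coeff L k = - coeff R k" for k
    by (metis coeff_minus)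
  have same: "b' + a = b + a'"
  proof (rule linorder_cases)
    assume "b' + a < b + a'"
    then have "coeff R (b' + a) = 0" unfolding R_def cf by simp
    moreover have "coeff L (b' + a) = coeff f 0" unfolding L_def cf by simp
    ultimately show ?thesis using coeffs[of "b' + a"] c0(1) by simp
  next
    assume "b + a' < b' + a"
    then have "coeff L (b + a') = 0" unfolding L_def cf by simp
    moreover have "coeff R (b + a') = coeff f' 0" unfolding R_def cf by simp
    ultimately show ?thesis using coeffs[of "b + a'"] c0(2) by simp
  qed
  have nzm: "monom 1 (b + a') \<noteq> (0 :: int poly)" by simp
  have Lf: "L = monom 1 (b + a') * f" unfolding L_def same ..
  from LR have "f' = f \<or> f' = - f"
  proof
    assume "L = R"
    then have "monom 1 (b + a') * f = monom 1 (b + a') * f'" unfolding Lf R_def .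
    then have "f = f'" by (rule mult_left_cancel[OF nzm, THEN iffD1])
    then show ?thesis by simp
  next
    assume "L = - R"
    then have "monom 1 (b + a') * f = monom 1 (b + a') * (- f')"
      unfolding Lf R_def by (simp only: mult_minus_right)
    then have "f = - f'" by (rule mult_left_cancel[OF nzm, THEN iffD1])
    then show ?thesis by simp
  qed
  moreover have "f' \<noteq> - f"
  proof
    assume "f' = - f"
    then have "coeff f' 0 = - coeff f 0" by simp
    moreover have "0 \<le> coeff (at_minus_t f) 0" "0 \<le> coeff (at_minus_t f') 0"
      using nonneg[of 0] f' by blast+
    then have "0 \<le> coeff f 0" "0 \<le> coeff f' 0" unfolding coeff_0_at_minus_t .
    ultimately show False using c0 by linarith
  qed
  ultimately show "f' = f" by blast
qed

context crowell_word
begin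

text \<open>Vertex \<open>l * 3 + s\<close> is the generator \<open>x l s\<close> of the Wirtinger presentation.  The overcrossing arc
  of letter \<open>l\<close> is \<open>cross l\<close>; every other arc has a single outgoing edge, to an arc carrying the same
  generator, and following these edges from any arc leads to \<open>cross\<close> of its letter \<open>arc_letter\<close>.\<close>

definition cross :: "nat \<Rightarrow> nat" where
  "cross l = l * 3 + (if sigma1_at w l then 0 else 2)"

text \<open>At a crossing this arc goes to position 1 of the same level. The over strand of either
  kind of letter ends in position 1, so the next step is always \<open>cross\<close> of the previous
  letter.\<close>

definition wf :: "nat \<Rightarrow> nat" where
  "wf v = (if v mod 3 = 0 then if sigma1_at w (v div 3) then v div 3 * 3 + 1 else Suc (v div 3) mod length w * 3
           else if v mod 3 = 1 then cross (pred (v div 3))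
           else if sigma1_at w (v div 3) then Suc (v div 3) mod length w * 3 + 2 else v div 3 * 3 + 1)"

definition wg :: "nat \<Rightarrow> nat" where
  "wg v = (if v mod 3 = 0 then Suc (v div 3) mod length w * 3
           else if v mod 3 = 1 then v
           else Suc (v div 3) mod length w * 3 + 2)"

text \<open>The coefficient \<open>1 - t\<close> of the overcrossing generator is read as a sum of
  two arc weights, 1 and \<open>-t\<close>; which arc gets \<open>-t\<close> depends on the
  kind.\<close>

definition w\<alpha> :: "nat \<Rightarrow> int poly" where
  "w\<alpha> v = (if v mod 3 = 0 \<and> sigma1_at w (v div 3) then - [:0, 1:] else 1)"

definition w\<beta> :: "nat \<Rightarrow> int poly" where
  "w\<beta> v = (if v mod 3 = 0 \<and> sigma1_at w (v div 3) then 1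
           else if v mod 3 = 2 \<and> \<not> sigma1_at w (v div 3) then - [:0, 1:] else 0)"

text \<open>Each relation is the Laplacian row of one generator. The relation at position 1 copies
  the over strand to the next level and is charged to the generator it produces there; hence the
  shift.\<close>

definition row_vertex :: "nat \<Rightarrow> nat" where
  "row_vertex r = (if r mod 3 = 1 then Suc (r div 3) mod length w * 3 + 1 else r)"

definition row_sign :: "nat \<Rightarrow> int poly" where
  "row_sign r = (if r mod 3 = 1 then 1 else -1)"

lemma node_cases:
  assumes "v < length w * 3"
  obtains l where "l < length w" "v = l * 3" | l where "l < length w" "v = l * 3 + 1"
    | l where "l < length w" "v = l * 3 + 2"
proof -
  have "v div 3 < length w" using assms by (simp add: less_mult_imp_div_less)
  moreover have "v = v div 3 * 3 + v mod 3" by simp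
  moreover have "v mod 3 = 0 \<or> v mod 3 = 1 \<or> v mod 3 = 2" by arith
  ultimately show ?thesis using that by (metis add.right_neutral)
qed

lemma divmod3 [simp]:
  "(l * 3 + 1) div 3 = (l :: nat)" "(l * 3 + 2) div 3 = l" "Suc (l * 3) div 3 = l" "Suc (Suc (l * 3)) div 3 = l"
  "(l * 3 + 1) mod 3 = 1" "(l * 3 + 2) mod 3 = 2" "Suc (l * 3) mod 3 = 1" "Suc (Suc (l * 3)) mod 3 = 2"
  "Suc (3 * l) div 3 = l" "Suc (Suc (3 * l)) div 3 = l" "Suc (3 * l) mod 3 = 1" "Suc (Suc (3 * l)) mod 3 = 2"
  by presburger+

lemma mod_w_lt: "k mod length w < length w"
  using m_ge_2 by (intro mod_less_divisor) linarith

lemma cross_lt: "l < length w \<Longrightarrow> cross l < length w * 3"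
  by (simp add: cross_def)

lemma cross_div: "cross l div 3 = l" and cross_mod: "cross l mod 3 = (if sigma1_at w l then 0 else 2)"
  by (simp_all add: cross_def)

lemma cross_inj: "cross l = cross l' \<longleftrightarrow> l = l'"
  using cross_div by metis

lemma cross_0: "cross 0 = 0"
  using c_first by (simp add: cross_def)

lemma wf_lt: "v < length w * 3 \<Longrightarrow> wf v < length w * 3"
  and wg_lt: "v < length w * 3 \<Longrightarrow> wg v < length w * 3"
proof -
  assume v: "v < length w * 3"
  then have l: "v div 3 < length w" by (simp add: less_mult_imp_div_less)
  have "x < length w \<Longrightarrow> y < 3 \<Longrightarrow> x * 3 + y < length w * 3" for x y :: nat by linarith
  from this[OF l, of 1] this[OF mod_w_lt[of "Suc (v div 3)"], of 0] this[OF mod_w_lt[of "Suc (v div 3)"], of 2]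
  show "wf v < length w * 3" "wg v < length w * 3"
    using cross_lt[OF pred_lt[OF l]] v by (simp_all add: wf_def wg_def)
qed

abbreviation (input) "AM \<equiv> alexander_matrix 3 w"

lemma AM_carrier: "AM \<in> carrier_mat (length w * 3) (length w * 3)"
  by (simp add: alexander_matrix_def Let_def)

lemma AM_entry:
  assumes r: "r < length w * 3" and k: "k < length w * 3"
  shows "AM $$ (r, k) = row_sign r *
    (w\<alpha> (row_vertex r) * (of_bool (k = row_vertex r) - of_bool (k = wf (row_vertex r)))
   + w\<beta> (row_vertex r) * (of_bool (k = row_vertex r) - of_bool (k = wg (row_vertex r))))"
  using r
proof (cases rule: node_cases)
  case (1 l)
  then show ?thesis using k nth_w[OF 1(1)]
    by (cases "sigma1_at w l")
      (simp_all add: alexander_matrix_def Let_def row_sign_def row_vertex_def w\<alpha>_def w\<beta>_def wf_def wg_def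
        of_bool_def algebra_simps)
next
  case (2 l)
  then show ?thesis using k nth_w[OF 2(1)] pred_Suc_mod[OF 2(1)]
    by (cases "sigma1_at w l")
      (simp_all add: alexander_matrix_def Let_def row_sign_def row_vertex_def w\<alpha>_def w\<beta>_def wf_def wg_def
        of_bool_def algebra_simps cross_def)
next
  case (3 l)
  then show ?thesis using k nth_w[OF 3(1)]
    by (cases "sigma1_at w l")
      (simp_all add: alexander_matrix_def Let_def row_sign_def row_vertex_def w\<alpha>_def w\<beta>_def wf_def wg_def
        of_bool_def algebra_simps)
qed

section \<open>Following a generator to an overcrossing arc\<close>

definition next_c :: "nat \<Rightarrow> nat" where
  "next_c l = (if \<exists>z\<ge>l. z < length w \<and> sigma1_at w z
     then LEAST z. l \<le> z \<and> z < length w \<and> sigma1_at w z else 0)"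

text \<open>The last letter is of this kind, so the search cannot run past the end. For
  \<open>next_c\<close> it can, and then continues at letter 0, the first sigma_1.\<close>

definition next_d :: "nat \<Rightarrow> nat" where
  "next_d l = (LEAST z. l \<le> z \<and> z < length w \<and> \<not> sigma1_at w z)"

definition arc_letter :: "nat \<Rightarrow> nat" where
  "arc_letter v = (if v mod 3 = 0 then next_c (v div 3)
                   else if v mod 3 = 1 then pred (v div 3) else next_d (v div 3))"

lemma Suc_le_if_d: "l < length w \<Longrightarrow> sigma1_at w l \<Longrightarrow> Suc l < length w"
  using c_last by (metis Suc_lessI diff_Suc_1)

lemma next_c_here: "l < length w \<Longrightarrow> sigma1_at w l \<Longrightarrow> next_c l = l"
  unfolding next_c_def by (auto intro!: Least_equality)

lemma next_d_here: "l < length w \<Longrightarrow> \<not> sigma1_at w l \<Longrightarrow> next_d l = l"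
  unfolding next_d_def by (auto intro!: Least_equality)

lemma next_c_Suc:
  assumes "\<not> sigma1_at w l"
  shows "next_c (Suc l) = next_c l"
proof -
  have h: "l \<le> z \<and> z < length w \<and> sigma1_at w z \<longleftrightarrow> Suc l \<le> z \<and> z < length w \<and> sigma1_at w z" for z
    using assms by (auto simp: Suc_le_eq order_le_less)
  show ?thesis unfolding next_c_def by (simp only: h)
qed

lemma next_d_Suc:
  assumes "sigma1_at w l"
  shows "next_d (Suc l) = next_d l"
proof -
  have h: "l \<le> z \<and> z < length w \<and> \<not> sigma1_at w z \<longleftrightarrow> Suc l \<le> z \<and> z < length w \<and> \<not> sigma1_at w z" for z
    using assms by (auto simp: Suc_le_eq order_le_less)
  show ?thesis unfolding next_d_def by (simp only: h)
qed

lemma next_c_length: "next_c (length w) = 0"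
  unfolding next_c_def by auto

lemma next_c_Suc_mod:
  assumes "l < length w" "\<not> sigma1_at w l"
  shows "next_c (Suc l mod length w) = next_c l"
proof (cases "Suc l = length w")
  case True
  then have "next_c l = 0" using next_c_Suc[OF assms(2)] next_c_length by simp
  moreover have "next_c 0 = 0" using next_c_here[of 0] c_first assms(1) by (cases "length w") auto
  ultimately show ?thesis using True by simp
next
  case False
  then show ?thesis using next_c_Suc[OF assms(2)] assms(1) by simp
qed

lemma nxt_next_c:
  assumes "l < length w" "sigma1_at w l"
  shows "nxt l = next_c (Suc l mod length w)"
proof -
  have "Suc l < length w" using Suc_le_if_d assms by blast
  moreover have "nxt l = next_c (Suc l)"
  proof (cases "\<exists>x>l. x < length w \<and> sigma1_at w x")
    case True
    then show ?thesis using assms unfolding nxt_def next_c_def by (simp add: Suc_le_eq)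
  next
    case False
    then have "nxt l = 0" using nxt_wrap[OF assms(1)] assms(2) by auto
    then show ?thesis using False unfolding next_c_def by (auto simp: Suc_le_eq)
  qed
  ultimately show ?thesis by simp
qed

lemma nxt_next_d:
  assumes "l < length w" "\<not> sigma1_at w l"
  shows "nxt l = next_d (Suc l mod length w)"
proof (cases "Suc l < length w")
  case True
  have "\<exists>x>l. x < length w \<and> \<not> sigma1_at w x"
    by (intro exI[of _ "length w - 1"] conjI c_last) (use True in linarith)+
  then show ?thesis using assms True unfolding nxt_def next_d_def by (simp add: Suc_le_eq)
next
  case False
  then have l: "Suc l = length w" using assms by simp
  then have "nxt l = first_d" using nxt_wrap[OF assms(1)] assms(2) by auto
  then show ?thesis unfolding l next_d_def first_d_def by simp
qed

lemma next_d_lt: "l < length w \<Longrightarrow> next_d l < length w"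
proof -
  assume "l < length w"
  then have "l \<le> length w - 1 \<and> length w - 1 < length w \<and> \<not> sigma1_at w (length w - 1)"
    by (intro conjI c_last) linarith+
  from LeastI[of "\<lambda>z. l \<le> z \<and> z < length w \<and> \<not> sigma1_at w z", OF this]
  show ?thesis by (simp add: next_d_def)
qed

lemma next_c_lt: "next_c l < length w"
proof (cases "\<exists>z\<ge>l. z < length w \<and> sigma1_at w z")
  case True
  then obtain z where "l \<le> z \<and> z < length w \<and> sigma1_at w z" by blast
  from LeastI[of "\<lambda>z. l \<le> z \<and> z < length w \<and> sigma1_at w z", OF this]
  show ?thesis using True by (simp add: next_c_def)
next
  case False
  then show ?thesis using m_ge_2 by (auto simp: next_c_def)
qed

lemma arc_letter_simps:
  "arc_letter (l * 3) = next_c l" "arc_letter (l * 3 + 1) = pred l" "arc_letter (l * 3 + 2) = next_d l"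
  unfolding arc_letter_def by simp_all

lemma arc_letter_lt:
  assumes "v < length w * 3"
  shows "arc_letter v < length w"
  using assms
proof (cases rule: node_cases)
  case (1 l)
  then show ?thesis using next_c_lt by (simp only: arc_letter_simps)
next
  case (2 l)
  then show ?thesis using pred_lt by (simp only: arc_letter_simps)
next
  case (3 l)
  then show ?thesis using next_d_lt by (simp only: arc_letter_simps)
qed

lemma arc_letter_cross: "l < length w \<Longrightarrow> arc_letter (cross l) = l"
  using arc_letter_simps[of l] next_c_here[of l] next_d_here[of l] by (simp add: cross_def)

lemma arc_letter_0: "arc_letter 0 = 0"
proof -
  have "0 < length w" using m_ge_2 by linarith
  from arc_letter_cross[OF this] show ?thesis unfolding cross_0 .
qed

lemma wf_simps:
  "wf (l * 3) = (if sigma1_at w l then l * 3 + 1 else Suc l mod length w * 3)"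
  "wf (l * 3 + 1) = cross (pred l)"
  "wf (l * 3 + 2) = (if sigma1_at w l then Suc l mod length w * 3 + 2 else l * 3 + 1)"
  unfolding wf_def by simp_all

lemma wg_simps: "wg (l * 3) = Suc l mod length w * 3" "wg (l * 3 + 2) = Suc l mod length w * 3 + 2"
  unfolding wg_def by simp_all

lemma arc_letter_wf:
  assumes "v < length w * 3" "v \<notin> cross ` {..<length w}"
  shows "arc_letter (wf v) = arc_letter v"
  using assms(1)
proof (cases rule: node_cases)
  case (1 l)
  then have "\<not> sigma1_at w l" using assms(2) by (auto simp: cross_def)
  then show ?thesis using 1 next_c_Suc_mod by (simp only: wf_simps arc_letter_simps if_False)
next
  case (2 l)
  then show ?thesis using arc_letter_cross[OF pred_lt] by (simp only: wf_simps arc_letter_simps)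
next
  case (3 l)
  then have c: "sigma1_at w l" using assms(2) by (auto simp: cross_def)
  then have "Suc l mod length w = Suc l" using Suc_le_if_d 3(1) by simp
  then show ?thesis using 3 c next_d_Suc[OF c] by (simp only: wf_simps arc_letter_simps if_True)
qed

lemma arc_letter_cross_step:
  assumes l: "l < length w"
  shows "arc_letter (wf (cross l)) = pred l" "arc_letter (wg (cross l)) = nxt l"
proof -
  show "arc_letter (wf (cross l)) = pred l"
    by (cases "sigma1_at w l") (simp_all only: cross_def if_True if_False add_0_right wf_simps arc_letter_simps)
  show "arc_letter (wg (cross l)) = nxt l"
    using nxt_next_c[OF l] nxt_next_d[OF l]
    by (cases "sigma1_at w l") (simp_all only: cross_def if_True if_False add_0_right wg_simps arc_letter_simps simp_thms)
qed

definition wstep :: "nat set \<Rightarrow> nat \<Rightarrow> nat" where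
  "wstep S v = (if v \<in> cross ` S then wg v else wf v)"

lemma wstep_lt: "v < length w * 3 \<Longrightarrow> wstep S v < length w * 3"
  using wf_lt wg_lt by (simp add: wstep_def)

lemma arc_letter_wstep:
  assumes "v < length w * 3" "v \<noteq> 0" "S \<subseteq> {..<length w}"
  shows "arc_letter (wstep S v) = (if v \<in> cross ` {..<length w} then par 0 S (arc_letter v) else arc_letter v)"
proof (cases "v \<in> cross ` {..<length w}")
  case True
  then obtain l where l: "l < length w" "v = cross l" by blast
  have "l \<noteq> 0" using assms(2) cross_0 l(2) by metis
  moreover have "v \<in> cross ` S \<longleftrightarrow> l \<in> S" using l(2) cross_inj by auto
  ultimately show ?thesis
    using True arc_letter_cross_step[OF l(1)] arc_letter_cross[OF l(1)] l(2)
    by (simp add: wstep_def par_def)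
next
  case False
  then have "v \<notin> cross ` S" using assms(3) by blast
  then show ?thesis using False arc_letter_wf[OF assms(1)] by (simp add: wstep_def)
qed

lemma leads_to_cross_c:
  assumes S: "S \<subseteq> {..<length w}" and l: "l < length w"
  shows "leads_to (wstep S) (cross (next_c l)) (l * 3)"
  using l
proof (induction "length w - l" arbitrary: l rule: less_induct)
  case less
  show ?case
  proof (cases "sigma1_at w l")
    case True
    then have "cross (next_c l) = l * 3" using next_c_here less.prems by (simp add: cross_def)
    then show ?thesis by (simp only: leads_to.here)
  next
    case False
    have "l * 3 \<noteq> cross k" for k using cross_div[of k] cross_mod[of k] False
      by (metis div_mult_self_is_m mod_mult_self2_is_0 zero_less_numeral zero_neq_numeral)
    then have "l * 3 \<notin> cross ` S" by blast
    then have st: "wstep S (l * 3) = Suc l mod length w * 3" using False by (simp only: wstep_def wf_simps if_False)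
    have "leads_to (wstep S) (cross (next_c l)) (Suc l mod length w * 3)"
    proof (cases "Suc l < length w")
      case True
      then show ?thesis
        using less.hyps[of "Suc l"] less.prems next_c_Suc[OF False] by simp
    next
      case end_w: False
      then have "Suc l mod length w = 0" using less.prems by (metis Suc_lessI mod_self)
      moreover have "next_c l = next_c 0" using next_c_Suc_mod[OF less.prems False] calculation by simp
      moreover have "next_c 0 = 0" using next_c_here[of 0] c_first less.prems by (cases "length w") auto
      ultimately show ?thesis using cross_0 by (simp add: leads_to.here)
    qed
    then show ?thesis using st leads_to.step[of "wstep S" _ "l * 3"] by simp
  qed
qed

lemma leads_to_cross_d:
  assumes S: "S \<subseteq> {..<length w}" and l: "l < length w"
  shows "leads_to (wstep S) (cross (next_d l)) (l * 3 + 2)"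
  using l
proof (induction "length w - l" arbitrary: l rule: less_induct)
  case less
  show ?case
  proof (cases "sigma1_at w l")
    case False
    then have "cross (next_d l) = l * 3 + 2" using next_d_here less.prems by (simp add: cross_def)
    then show ?thesis by (simp only: leads_to.here)
  next
    case True
    have "l * 3 + 2 \<noteq> cross k" for k using cross_div[of k] cross_mod[of k] True divmod3(2,6)[of l]
      by (metis zero_neq_numeral)
    then have "l * 3 + 2 \<notin> cross ` S" by blast
    then have st: "wstep S (l * 3 + 2) = Suc l mod length w * 3 + 2" using True by (simp only: wstep_def wf_simps if_True if_False)
    have sl: "Suc l < length w" using Suc_le_if_d[OF less.prems True] .
    then have "leads_to (wstep S) (cross (next_d l)) (Suc l mod length w * 3 + 2)"
      using less.hyps[of "Suc l"] less.prems next_d_Suc[OF True] by simp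
    then show ?thesis using st leads_to.step[of "wstep S" _ "l * 3 + 2"] by simp
  qed
qed

text \<open>The choice \<open>S\<close> has no influence here: before its first overcrossing
  generator, a walk meets only vertices that follow \<open>wf\<close>.\<close>

lemma leads_to_arc_letter:
  assumes S: "S \<subseteq> {..<length w}" and v: "v < length w * 3"
  shows "leads_to (wstep S) (cross (arc_letter v)) v"
  using v
proof (cases rule: node_cases)
  case (1 l)
  then show ?thesis using leads_to_cross_c[OF S] by (simp only: arc_letter_simps)
next
  case (2 l)
  have "l * 3 + 1 \<noteq> cross k" for k using cross_mod[of k] divmod3(5)[of l]
    by (metis one_neq_zero numeral_One numeral_eq_iff semiring_norm(85))
  then have "l * 3 + 1 \<notin> cross ` S" by blast
  then have "wstep S (l * 3 + 1) = cross (pred l)" by (simp only: wstep_def wf_simps if_False)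
  then have "leads_to (wstep S) (cross (pred l)) (wstep S (l * 3 + 1))" by (simp only: leads_to.here)
  then show ?thesis unfolding 2(2) arc_letter_simps by (rule leads_to.step)
next
  case (3 l)
  then show ?thesis using leads_to_cross_d[OF S] by (simp only: arc_letter_simps)
qed

text \<open>\<open>arc_letter\<close> projects a walk in the Wirtinger digraph to a walk in the
  tree; conversely every tree step lifts to a walk between overcrossing generators. The roots match
  since \<open>cross 0 = 0\<close>.\<close>

lemma wirtinger_reach:
  assumes S: "S \<subseteq> {..<length w} - {0}"
  shows "(\<forall>v<length w * 3. leads_to (wstep S) 0 v) \<longleftrightarrow> tree 0 S"
proof
  have S': "S \<subseteq> {..<length w}" using S by blast
  have down: "leads_to (par 0 S) 0 (arc_letter v)" if "leads_to (wstep S) 0 v" "v < length w * 3" for v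
    using that
  proof (induction rule: leads_to.induct)
    case here
    show ?case by (simp add: arc_letter_0 leads_to.here)
  next
    case (step v)
    show ?case
    proof (cases "v = 0")
      case True
      then show ?thesis by (simp add: arc_letter_0 leads_to.here)
    next
      case False
      have "leads_to (par 0 S) 0 (arc_letter (wstep S v))" using step wstep_lt by blast
      then show ?thesis unfolding arc_letter_wstep[OF step.prems False S']
        by (auto intro: leads_to.step split: if_splits)
    qed
  qed
  assume all: "\<forall>v<length w * 3. leads_to (wstep S) 0 v"
  have "leads_to (par 0 S) 0 l" if l: "l < length w" for l
    using down[of "cross l"] all cross_lt[OF l] arc_letter_cross[OF l] by simp
  then show "tree 0 S" using S by (simp add: tree_def)
next
  have S': "S \<subseteq> {..<length w}" using S by blast
  assume t: "tree 0 S"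
  have up: "leads_to (wstep S) 0 (cross l)" if "leads_to (par 0 S) 0 l" "l < length w" for l
    using that
  proof (induction rule: leads_to.induct)
    case here
    show ?case by (simp add: cross_0 leads_to.here)
  next
    case (step l)
    show ?case
    proof (cases "l = 0")
      case True
      then show ?thesis by (simp add: cross_0 leads_to.here)
    next
      case False
      have c0: "cross l \<noteq> 0" using False cross_0 cross_inj by metis
      have "arc_letter (wstep S (cross l)) = par 0 S l"
        unfolding arc_letter_wstep[OF cross_lt[OF step.prems] c0 S'] using step.prems arc_letter_cross by simp
      then have "leads_to (wstep S) (cross (par 0 S l)) (wstep S (cross l))"
        using leads_to_arc_letter[OF S' wstep_lt[OF cross_lt[OF step.prems]]] by metis
      moreover have "leads_to (wstep S) 0 (cross (par 0 S l))" using step par_lt by blast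
      ultimately have "leads_to (wstep S) 0 (wstep S (cross l))" by (rule leads_to_trans)
      then show ?thesis by (rule leads_to.step)
    qed
  qed
  show "\<forall>v<length w * 3. leads_to (wstep S) 0 v"
  proof (intro allI impI)
    fix v assume v: "v < length w * 3"
    have "leads_to (par 0 S) 0 (arc_letter v)" using t arc_letter_lt[OF v] by (simp add: tree_def)
    then have "leads_to (wstep S) 0 (cross (arc_letter v))" using up arc_letter_lt[OF v] by blast
    then show "leads_to (wstep S) 0 v" using leads_to_trans[OF leads_to_arc_letter[OF S' v]] by blast
  qed
qed

lemma row_vertex_mod: "row_vertex r mod 3 = r mod 3"
  by (simp add: row_vertex_def)

lemma row_vertex_lt: "r < length w * 3 \<Longrightarrow> row_vertex r < length w * 3"
proof -
  assume r: "r < length w * 3"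
  have "x < length w \<Longrightarrow> x * 3 + 1 < length w * 3" for x :: nat by linarith
  from this[OF mod_w_lt[of "Suc (r div 3)"]] show ?thesis using r by (simp add: row_vertex_def)
qed

lemma row_vertex_eq_0: "row_vertex r = 0 \<longleftrightarrow> r = 0"
  using row_vertex_mod[of r] by (auto simp: row_vertex_def)

lemma inj_on_row_vertex: "inj_on row_vertex {0..<length w * 3}"
proof (rule inj_onI)
  fix r r' assume r: "r \<in> {0..<length w * 3}" "r' \<in> {0..<length w * 3}" and eq: "row_vertex r = row_vertex r'"
  have m: "r mod 3 = r' mod 3" using row_vertex_mod[of r] row_vertex_mod[of r'] eq by simp
  show "r = r'"
  proof (cases "r mod 3 = 1")
    case False
    then show ?thesis using eq m by (simp add: row_vertex_def)
  next
    case True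
    have l: "r div 3 < length w" "r' div 3 < length w" using r by (auto simp: less_mult_imp_div_less)
    have "Suc (r div 3) mod length w = Suc (r' div 3) mod length w"
      using eq True m by (simp add: row_vertex_def)
    then have "r div 3 = r' div 3" using pred_Suc_mod[OF l(1)] pred_Suc_mod[OF l(2)] by metis
    then show ?thesis using m by (metis div_mod_decomp)
  qed
qed

text \<open>A factor \<open>-t\<close> arises where a sigma_1 keeps its arc to the previous letter
  or a sigma_2^-1 takes its arc to the next of its kind; all other factors are 1.\<close>

lemma mark_weight:
  assumes "S \<subseteq> {..<length w} - {0}"
  shows "(\<Prod>v\<in>{..<length w * 3} - {0}. if v \<in> cross ` S then w\<beta> v else w\<alpha> v) = (- [:0, 1:]) ^ marks S"
proof -
  let ?V = "{..<length w} - {0}"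
  let ?P = "\<lambda>l. if sigma1_at w l then l \<notin> S else l \<in> S"
  have noncross: "w\<alpha> v = 1" if "v \<notin> cross ` ?V" "v < length w * 3" "v \<noteq> 0" for v
  proof (rule ccontr)
    assume "w\<alpha> v \<noteq> 1"
    then have v: "v mod 3 = 0" "sigma1_at w (v div 3)" by (auto simp: w\<alpha>_def split: if_splits)
    then have "v = cross (v div 3)" by (auto simp: cross_def)
    moreover have "v div 3 \<in> ?V" using that v(1) by (auto simp: less_mult_imp_div_less)
    ultimately show False using that(1) by blast
  qed
  have "cross ` ?V \<subseteq> {..<length w * 3} - {0}"
  proof
    fix v assume "v \<in> cross ` ?V"
    then obtain l where l: "l < length w" "l \<noteq> 0" "v = cross l" by auto
    then have "v \<noteq> 0" using cross_inj cross_0 by metis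
    then show "v \<in> {..<length w * 3} - {0}" using l cross_lt by auto
  qed
  then have "(\<Prod>v\<in>{..<length w * 3} - {0}. if v \<in> cross ` S then w\<beta> v else w\<alpha> v)
      = (\<Prod>v\<in>cross ` ?V. if v \<in> cross ` S then w\<beta> v else w\<alpha> v)"
    using assms noncross by (intro prod.mono_neutral_right) auto
  also have "\<dots> = (\<Prod>l\<in>?V. if cross l \<in> cross ` S then w\<beta> (cross l) else w\<alpha> (cross l))"
    by (rule prod.reindex_cong[where l = cross]) (auto simp: inj_on_def cross_inj)
  also have "\<dots> = (\<Prod>l\<in>?V. if ?P l then - [:0, 1:] else 1)"
  proof (rule prod.cong[OF refl])
    fix l
    have "cross l \<in> cross ` S \<longleftrightarrow> l \<in> S" using cross_inj by auto
    then show "(if cross l \<in> cross ` S then w\<beta> (cross l) else w\<alpha> (cross l)) = (if ?P l then - [:0, 1:] else 1)"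
      by (simp add: w\<alpha>_def w\<beta>_def cross_div cross_mod)
  qed
  also have "\<dots> = (\<Prod>l\<in>{l \<in> ?V. ?P l}. - [:0, 1:])"
    by (rule prod.inter_filter[symmetric]) simp
  also have "\<dots> = (- [:0, 1:]) ^ card {l \<in> ?V. ?P l}" by (rule prod_constant)
  also have "{l \<in> ?V. ?P l} = {v. 0 < v \<and> v < length w \<and> sigma1_at w v \<and> v \<notin> S} \<union> {v \<in> S. \<not> sigma1_at w v}"
    using assms by (auto split: if_splits)
  also have "card \<dots> = marks S"
  proof -
    have "finite {v \<in> S. \<not> sigma1_at w v}" using assms by (auto intro: finite_subset)
    then show ?thesis unfolding marks_def by (intro card_Un_disjoint) auto
  qed
  finally show ?thesis .
qed

definition tree_poly :: "int poly" where
  "tree_poly = (\<Sum>S | tree 0 S. (- [:0, 1:]) ^ marks S)"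

lemma cofactor_AM: "cofactor AM 0 0 = tree_poly \<or> cofactor AM 0 0 = - tree_poly"
proof -
  let ?K = "length w * 3"
  have K: "0 < ?K" using m_ge_2 by linarith
  define M where "M = mat ?K ?K (\<lambda>(v, k). if v = 0 then of_bool (k = 0)
           else w\<alpha> v * (of_bool (k = v) - of_bool (k = wf v))
              + w\<beta> v * (of_bool (k = v) - of_bool (k = wg v)))"
  define B where "B = mat ?K ?K (\<lambda>(i, j). if i = 0 then of_bool (j = 0) else AM $$ (i, j))"
  define p where "p r = (if r < ?K then row_vertex r else r)" for r
  define e where "e r = (if r = 0 then 1 else row_sign r)" for r
  have "det B = det M \<or> det B = - det M"
  proof (rule det_signed_permutation[where p = p and e = e])
    show "M \<in> carrier_mat ?K ?K" unfolding M_def by (rule mat_carrier)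
    show "B \<in> carrier_mat ?K ?K" unfolding B_def by (rule mat_carrier)
    show "p permutes {0..<?K}"
    proof (rule bij_imp_permutes)
      have "row_vertex ` {0..<?K} = {0..<?K}"
      proof (rule endo_inj_surj[OF finite_atLeastLessThan _ inj_on_row_vertex], rule image_subsetI)
        fix r assume "r \<in> {0..<?K}"
        then show "row_vertex r \<in> {0..<?K}" using row_vertex_lt[of r] by (simp only: atLeastLessThan_iff zero_le)
      qed
      then have "bij_betw row_vertex {0..<?K} {0..<?K}"
        unfolding bij_betw_def using inj_on_row_vertex by blast
      moreover have "bij_betw p {0..<?K} {0..<?K} \<longleftrightarrow> bij_betw row_vertex {0..<?K} {0..<?K}"
        by (rule bij_betw_cong) (simp add: p_def)
      ultimately show "bij_betw p {0..<?K} {0..<?K}" by (simp only:)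
    qed (simp add: p_def)
    show "e i = 1 \<or> e i = -1" for i by (simp add: e_def row_sign_def)
    fix i j assume ij: "i < ?K" "j < ?K"
    show "B $$ (i, j) = e i * M $$ (p i, j)"
    proof (cases "i = 0")
      case True
      have "row_vertex 0 = 0" by (simp add: row_vertex_def)
      then have "p i = 0" unfolding True p_def by (simp only: if_cancel)
      then have "M $$ (p i, j) = of_bool (j = 0)" "B $$ (i, j) = of_bool (j = 0)"
        using ij True K by (simp_all only: M_def B_def index_mat(1) case_prod_conv if_True simp_thms)
      then show ?thesis using True by (simp only: e_def if_True mult_1 simp_thms)
    next
      case False
      then have nz: "row_vertex i \<noteq> 0" unfolding row_vertex_eq_0 .
      have pi: "p i = row_vertex i" using ij by (simp add: p_def)
      have "B $$ (i, j) = AM $$ (i, j)" 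
        unfolding B_def using ij False by (simp only: index_mat(1) case_prod_conv if_False)
      also have "\<dots> = e i * M $$ (p i, j)"
        unfolding AM_entry[OF ij] pi M_def index_mat(1)[OF row_vertex_lt[OF ij(1)] ij(2)]
        using nz False by (simp only: e_def if_False case_prod_conv)
      finally show ?thesis .
    qed
  qed
  moreover have "det B = cofactor AM 0 0"
    unfolding B_def by (rule det_unit_row[OF AM_carrier K K])
  moreover have "det M = tree_poly"
  proof -
    let ?W = "\<lambda>T. \<Prod>v\<in>{..<?K} - {0}. if v \<in> T then w\<beta> v else w\<alpha> v"
    let ?X = "{T. T \<subseteq> {..<?K} - {0} \<and> (\<forall>v<?K. leads_to (\<lambda>v. if v \<in> T then wg v else wf v) 0 v)}"
    have finX: "finite ?X" by (rule finite_subset[of _ "Pow {..<?K}"]) auto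
    have "det M = (\<Sum>T\<in>?X. ?W T)"
      unfolding M_def by (rule matrix_tree[OF K wf_lt wg_lt])
    also have "\<dots> = (\<Sum>T\<in>(`) cross ` {S. tree 0 S}. ?W T)"
    proof (rule sum.mono_neutral_right[OF finX])
      show "(`) cross ` {S. tree 0 S} \<subseteq> ?X"
      proof (rule image_subsetI)
        fix S assume "S \<in> {S. tree 0 S}"
        then have t: "tree 0 S" by simp
        then have S: "S \<subseteq> {..<length w} - {0}" by (simp add: tree_def)
        have "\<forall>v<?K. leads_to (\<lambda>v. if v \<in> cross ` S then wg v else wf v) 0 v"
          using wirtinger_reach[OF S] t unfolding wstep_def[abs_def] by blast
        moreover have "cross ` S \<subseteq> {..<?K} - {0}"
        proof
          fix v assume "v \<in> cross ` S"
          then obtain l where l: "l \<in> S" "v = cross l" by blast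
          then have "l < length w" "l \<noteq> 0" using S by auto
          then show "v \<in> {..<?K} - {0}" using l cross_lt[of l] cross_inj[of l 0] cross_0 by simp
        qed
        ultimately show "cross ` S \<in> ?X" by simp
      qed
      show "\<forall>T \<in> ?X - (`) cross ` {S. tree 0 S}. ?W T = 0"
      proof
        fix T assume T: "T \<in> ?X - (`) cross ` {S. tree 0 S}"
        \<comment> \<open>\<open>w\<beta>\<close> vanishes away from the overcrossing generators, so
          only choices of the form \<open>cross\<close> applied to a set of letters
          contribute.\<close>
        have "\<exists>v\<in>T. w\<beta> v = 0"
        proof (rule ccontr)
          assume nz: "\<not> ?thesis"
          define S where "S = (\<lambda>v. v div 3) ` T"
          have vc: "cross (v div 3) = v" "v div 3 < length w" "v div 3 \<noteq> 0" if "v \<in> T" for v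
          proof -
            have v: "v < ?K" "v \<noteq> 0" "w\<beta> v \<noteq> 0" using that T nz by auto
            have "v mod 3 = (if sigma1_at w (v div 3) then 0 else 2)"
              using v(3) by (auto simp: w\<beta>_def split: if_splits)
            then show 1: "cross (v div 3) = v"
              using div_mult_mod_eq[of v 3] by (simp only: cross_def)
            show "v div 3 < length w" using v(1) by (simp add: less_mult_imp_div_less)
            show "v div 3 \<noteq> 0" using 1 v(2) cross_0 by metis
          qed
          have "(\<lambda>v. cross (v div 3)) ` T = (\<lambda>v. v) ` T" by (rule image_cong[OF refl vc(1)])
          then have TS: "T = cross ` S" by (simp add: S_def image_image)
          have S: "S \<subseteq> {..<length w} - {0}" unfolding S_def
          proof (rule image_subsetI)
            fix v assume "v \<in> T"
            then show "v div 3 \<in> {..<length w} - {0}" using vc(2,3) by blast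
          qed
          have "\<forall>v<?K. leads_to (wstep S) 0 v"
            using T unfolding wstep_def[abs_def] TS[symmetric] by blast
          then have "tree 0 S" using wirtinger_reach[OF S] by blast
          then show False using T TS by blast
        qed
        then obtain v where v: "v \<in> T" "w\<beta> v = 0" by (rule bexE)
        have "v \<in> {..<?K} - {0}" using v(1) T by blast
        moreover have "(if v \<in> T then w\<beta> v else w\<alpha> v) = 0" using v by (simp only: if_True)
        ultimately show "?W T = 0" by (intro prod_zero finite_Diff finite_lessThan bexI)
      qed
    qed
    also have "\<dots> = (\<Sum>S | tree 0 S. ?W (cross ` S))"
    proof (rule sum.reindex_cong[OF _ refl refl])
      have "inj cross" by (rule injI) (simp add: cross_inj)
      then show "inj_on ((`) cross) {S. tree 0 S}" by (intro inj_onI) (simp add: inj_image_eq_iff)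
    qed
    also have "\<dots> = tree_poly"
      unfolding tree_poly_def 
    proof (rule sum.cong[OF refl])
      fix S assume "S \<in> {S. tree 0 S}"
      then have "S \<subseteq> {..<length w} - {0}" by (simp add: tree_def)
      then show "?W (cross ` S) = (- [:0, 1:]) ^ marks S" by (rule mark_weight)
    qed
    finally show ?thesis .
  qed
  ultimately show ?thesis by (simp only:)
qed

section \<open>All minors of the Alexander matrix\<close>

definition row_weight :: "nat \<Rightarrow> int poly" where
  "row_weight r = (if r mod 3 = 0 then 1 else if r mod 3 = 1 then [:0, 1:]
     else if sigma1_at w (r div 3) then [:0, 1:]\<^sup>2 else - [:0, 1:])"

lemma AM_row_sum:
  assumes r: "r < length w * 3"
  shows "(\<Sum>k<length w * 3. AM $$ (r, k)) = 0"
proof -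
  let ?v = "row_vertex r"
  have one: "(\<Sum>k<length w * 3. of_bool (k = x) :: int poly) = 1" if "x < length w * 3" for x
    using that by (simp add: of_bool_def)
  have "(\<Sum>k<length w * 3. AM $$ (r, k)) = (\<Sum>k<length w * 3. row_sign r *
    (w\<alpha> ?v * (of_bool (k = ?v) - of_bool (k = wf ?v)) + w\<beta> ?v * (of_bool (k = ?v) - of_bool (k = wg ?v))))"
    by (rule sum.cong) (use AM_entry[OF r] in auto)
  also have "\<dots> = row_sign r * (w\<alpha> ?v * ((\<Sum>k<length w * 3. of_bool (k = ?v)) - (\<Sum>k<length w * 3. of_bool (k = wf ?v)))
    + w\<beta> ?v * ((\<Sum>k<length w * 3. of_bool (k = ?v)) - (\<Sum>k<length w * 3. of_bool (k = wg ?v))))"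
    by (simp only: sum_distrib_left[symmetric] sum.distrib sum_subtractf)
  finally show ?thesis
    using one row_vertex_lt[OF r] wf_lt[OF row_vertex_lt[OF r]] wg_lt[OF row_vertex_lt[OF r]] by simp
qed

lemma AM_row:
  fixes k :: nat
  defines "x \<equiv> \<lambda>l s. of_bool (k = l mod length w * 3 + s) :: int poly"
  assumes l: "l < length w" and k: "k < length w * 3"
  shows "AM $$ (l * 3, k) = (if sigma1_at w l then x (Suc l) 0 - (1 - [:0, 1:]) * x l 0 - [:0, 1:] * x l 1
      else x (Suc l) 0 - x l 0)"
    and "AM $$ (l * 3 + 1, k) = (if sigma1_at w l then x (Suc l) 1 - x l 0 else x (Suc l) 1 - x l 2)"
    and "AM $$ (l * 3 + 2, k) = (if sigma1_at w l then x (Suc l) 2 - x l 2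
      else x l 1 - (1 - [:0, 1:]) * x l 2 - [:0, 1:] * x (Suc l) 2)"
  using l k nth_w[OF l]
  by (cases "sigma1_at w l"; simp add: alexander_matrix_def Let_def x_def of_bool_def)+

text \<open>The product of the three generators at a level is the same at all levels. Its Fox
  derivative is \<open>h l\<close>; the weights combine the relations of letter \<open>l\<close> to
  \<open>h (Suc l) - h l\<close>, and the closure makes the sum telescope to zero.\<close>

lemma AM_col_sum:
  assumes k: "k < length w * 3"
  shows "(\<Sum>r<length w * 3. row_weight r * AM $$ (r, k)) = 0"
proof -
  define t :: "int poly" where "t = [:0, 1:]"
  define x where "x l s = (of_bool (k = l mod length w * 3 + s) :: int poly)" for l s
  define h where "h l = x l 0 + t * x l 1 + t\<^sup>2 * x l 2" for l
  have rw: "row_weight (l * 3) = 1" "row_weight (l * 3 + 1) = t"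
    "row_weight (l * 3 + 2) = (if sigma1_at w l then t\<^sup>2 else - t)" for l
    unfolding row_weight_def t_def by simp_all
  have "(\<Sum>r<length w * 3. row_weight r * AM $$ (r, k))
      = (\<Sum>l<length w. \<Sum>r\<in>{l * 3..<l * 3 + 3}. row_weight r * AM $$ (r, k))"
    by (rule sum.nat_group[symmetric])
  also have "\<dots> = (\<Sum>l<length w. h (Suc l) - h l)"
  proof (rule sum.cong[OF refl])
    fix l assume "l \<in> {..<length w}"
    then have l: "l < length w" by simp
    have set: "{l * 3..<l * 3 + 3} = {l * 3, l * 3 + 1, l * 3 + 2}" by auto
    have "(\<Sum>r\<in>{l * 3..<l * 3 + 3}. row_weight r * AM $$ (r, k))
        = row_weight (l * 3) * AM $$ (l * 3, k) + row_weight (l * 3 + 1) * AM $$ (l * 3 + 1, k)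
        + row_weight (l * 3 + 2) * AM $$ (l * 3 + 2, k)"
      unfolding set by (subst sum.insert; simp)+
    also have "\<dots> = h (Suc l) - h l"
      unfolding rw AM_row[OF l k] x_def[symmetric] t_def[symmetric] h_def
      by (cases "sigma1_at w l") (simp_all add: algebra_simps power2_eq_square)
    finally show "(\<Sum>r\<in>{l * 3..<l * 3 + 3}. row_weight r * AM $$ (r, k)) = h (Suc l) - h l" .
  qed
  also have "\<dots> = h (length w) - h 0" by (rule sum_lessThan_telescope)
  also have "\<dots> = 0" by (simp add: h_def x_def)
  finally show ?thesis .
qed

text \<open>Row 0 has weight 1, so its cofactor divides all the others and generates the ideal of
  minors.\<close>

lemma minor_AM:
  assumes r: "r < length w * 3" "k < length w * 3"
  shows "cofactor AM r k = row_weight r * cofactor AM 0 0"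
proof -
  have K: "0 < length w * 3" using m_ge_2 by linarith
  have "row_weight 0 * cofactor AM r k = row_weight r * cofactor AM 0 k"
    by (rule cofactor_row_proportional[OF AM_carrier AM_col_sum]) (use r K in \<open>auto simp: row_weight_def\<close>)
  moreover have "cofactor AM 0 k = cofactor AM 0 0"
    by (rule cofactor_col_indep[OF AM_carrier AM_row_sum]) (use r K in auto)
  ultimately show ?thesis by (simp add: row_weight_def)
qed

lemma alexander_gcd_eq: "alexander_gcd 3 w = tree_poly \<or> alexander_gcd 3 w = - tree_poly"
proof -
  let ?K = "length w * 3"
  let ?D = "det (mat_delete AM 0 0)"
  let ?X = "{det (mat_delete AM r c) | r c. r < dim_row AM \<and> c < dim_col AM}"
  have K: "0 < ?K" using m_ge_2 by linarith
  have D: "?D = cofactor AM 0 0" by (simp add: cofactor_def)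
  have "Gcd ?X = ?D \<or> Gcd ?X = - ?D"
  proof (rule Gcd_least_element)
    have "dim_row AM = ?K" "dim_col AM = ?K" using AM_carrier by auto
    then show "?D \<in> ?X"
      unfolding mem_Collect_eq by (intro exI[of _ 0] conjI refl) (use K in simp_all)
    fix y assume "y \<in> ?X"
    then obtain r c where rc: "r < ?K" "c < ?K" "y = det (mat_delete AM r c)" using AM_carrier by auto
    have "y = (-1) ^ (r + c) * cofactor AM r c"
      unfolding cofactor_def rc(3) by (simp add: mult.assoc[symmetric] power_add[symmetric])
    then show "?D dvd y" unfolding minor_AM[OF rc(1,2)] D by simp
  qed
  then show ?thesis unfolding alexander_gcd_def Let_def D using cofactor_AM by auto
qed

lemma at_minus_t_tree_poly: "coeff (at_minus_t tree_poly) k = int (card {S. tree 0 S \<and> marks S = k})"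
proof -
  have fin: "finite {S. tree 0 S}"
    by (rule finite_subset[of _ "Pow {..<length w}"]) (auto simp: tree_def)
  have pw: "pcompose ((- [:0, 1:]) ^ j) [:0, -1:] = (monom 1 j :: int poly)" for j
  proof (induction j)
    case (Suc j)
    have "pcompose (- [:0, 1:]) [:0, -1:] = (monom 1 1 :: int poly)"
      by (simp add: pcompose_pCons monom_Suc monom_0)
    then show ?case using Suc by (simp only: power_Suc pcompose_mult mult_monom) simp
  qed (simp add: monom_0 one_pCons)
  have "at_minus_t tree_poly = (\<Sum>S | tree 0 S. monom 1 (marks S))"
    unfolding at_minus_t_def tree_poly_def pcompose_sum pw ..
  then have "coeff (at_minus_t tree_poly) k = (\<Sum>S | tree 0 S. if marks S = k then 1 else 0)"
    by (simp add: coeff_sum)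
  also have "\<dots> = (\<Sum>S | tree 0 S \<and> marks S = k. 1)"
    using fin by (intro sum.mono_neutral_cong_right) auto
  finally show ?thesis by simp
qed

lemma alexander_poly_eq: "alexander_poly 3 w = tree_poly"
proof (rule alexander_poly_eqI)
  show "equal_up_to_units tree_poly (alexander_gcd 3 w)"
    unfolding equal_up_to_units_def
  proof (rule exI[of _ 0], rule exI[of _ 0])
    have "- (- tree_poly) = tree_poly" by simp
    then show "monom 1 0 * tree_poly = monom 1 0 * alexander_gcd 3 w \<or>
        monom 1 0 * tree_poly = - (monom 1 0 * alexander_gcd 3 w)"
      using alexander_gcd_eq by (metis mult_minus_right)
  qed
  show "0 \<le> coeff (at_minus_t tree_poly) k" for k by (simp add: at_minus_t_tree_poly)
  have "card {S. tree 0 S \<and> marks S = 0} = N 0 (p_num - 1) 0"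
    using card_marks[of 0] p_num_pos by (simp add: diag_def)
  then show "coeff (at_minus_t tree_poly) 0 \<noteq> 0"
    unfolding at_minus_t_tree_poly using N_full_pos by simp
qed

lemma coeff_alexander_poly:
  "k < p_num \<Longrightarrow> coeff (at_minus_t (alexander_poly 3 w)) k = int (diag k)"
  by (simp add: alexander_poly_eq at_minus_t_tree_poly card_marks)

end

section \<open>Alternating closed 3-braids\<close>

lemma alternating_3braid_0: "alternating_3braid 0 p q = []"
  by (simp add: alternating_3braid_def)

lemma alternating_3braid_Suc:
  "alternating_3braid (Suc n) p q = alternating_3braid n p q @
     replicate (p (Suc n)) (Sigma 1) @ replicate (q (Suc n)) (SigmaInv 2)"
  by (simp add: alternating_3braid_def)

lemma set_alternating_3braid: "set (alternating_3braid n p q) \<subseteq> {Sigma 1, SigmaInv 2}"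
  by (auto simp: alternating_3braid_def)

lemma count_alternating_3braid:
  "length (filter (\<lambda>x. x = Sigma 1) (alternating_3braid n p q)) = (\<Sum>i=1..n. p i)"
  "length (filter (\<lambda>x. x \<noteq> Sigma 1) (alternating_3braid n p q)) = (\<Sum>i=1..n. q i)"
  by (induction n) (simp_all add: alternating_3braid_0 alternating_3braid_Suc filter_replicate)

lemma ends_alternating_3braid:
  assumes "\<forall>i\<in>{1..n}. p i > 0 \<and> q i > 0" "1 \<le> n"
  shows "alternating_3braid n p q \<noteq> []" "hd (alternating_3braid n p q) = Sigma 1"
    "last (alternating_3braid n p q) = SigmaInv 2"
proof -
  have "alternating_3braid n p q \<noteq> [] \<and> hd (alternating_3braid n p q) = Sigma 1 \<and>
    last (alternating_3braid n p q) = SigmaInv 2"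
    using assms(2,1)
  proof (induction n rule: nat_induct_at_least)
    case base
    then show ?case using alternating_3braid_Suc[of 0 p q]
      by (simp add: alternating_3braid_0 hd_append last_append)
  next
    case (Suc n)
    then have "alternating_3braid n p q \<noteq> [] \<and> hd (alternating_3braid n p q) = Sigma 1" by simp
    moreover have "q (Suc n) > 0" using Suc.prems by simp
    ultimately show ?case unfolding alternating_3braid_Suc by (simp add: last_append)
  qed
  then show "alternating_3braid n p q \<noteq> []" "hd (alternating_3braid n p q) = Sigma 1"
    "last (alternating_3braid n p q) = SigmaInv 2" by auto
qed

section \<open>Counting the blocks of an alternating braid word\<close>

definition descents :: "braid_letter list \<Rightarrow> nat set" where
  "descents xs = {v. Suc v < length xs \<and> xs ! v = Sigma 1 \<and> xs ! Suc v \<noteq> Sigma 1}"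

text \<open>The new descent is the last letter of the appended sigma_1 block; the junction creates
  none because \<open>xs\<close> does not end in sigma_1.\<close>

lemma descents_append:
  assumes xs: "xs = [] \<or> last xs \<noteq> Sigma 1" and a: "0 < a" and b: "0 < b"
  shows "descents (xs @ replicate a (Sigma 1) @ replicate b (SigmaInv 2))
    = insert (length xs + (a - 1)) (descents xs)" (is "descents ?w = _")
proof -
  have low: "?w ! v = xs ! v" if "v < length xs" for v using that by (simp add: nth_append)
  have high: "?w ! v = (if v < length xs + a then Sigma 1 else SigmaInv 2)"
    if "length xs \<le> v" "v < length xs + a + b" for v
    using that by (auto simp: nth_append)
  have len: "length ?w = length xs + a + b" by simp
  show ?thesis
  proof (rule Set.set_eqI)
    fix v
    consider "Suc v < length xs" | "Suc v = length xs" | "length xs \<le> v" by linarith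
    then show "v \<in> descents ?w \<longleftrightarrow> v \<in> insert (length xs + (a - 1)) (descents xs)"
    proof cases
      case 1
      have eq: "?w ! v = xs ! v" "?w ! Suc v = xs ! Suc v" using low 1 by simp_all
      show ?thesis unfolding descents_def insert_iff mem_Collect_eq len eq using 1 by simp
    next
      case 2
      then have "last xs = xs ! v" by (metis diff_Suc_1 last_conv_nth length_0_conv nat.distinct(1))
      moreover have "xs \<noteq> []" using 2 by auto
      moreover have "?w ! v = xs ! v" using low 2 by simp
      ultimately have "?w ! v \<noteq> Sigma 1" using xs by simp
      then show ?thesis unfolding descents_def insert_iff mem_Collect_eq using 2 by simp
    next
      case 3
      have "v \<in> descents ?w \<longleftrightarrow> Suc v < length xs + a + b \<and> v < length xs + a \<and> \<not> Suc v < length xs + a"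
      proof (cases "Suc v < length xs + a + b")
        case True
        then have "?w ! v = (if v < length xs + a then Sigma 1 else SigmaInv 2)"
          "?w ! Suc v = (if Suc v < length xs + a then Sigma 1 else SigmaInv 2)"
          using high 3 by simp_all
        then show ?thesis unfolding descents_def mem_Collect_eq len by simp
      next
        case False
        then show ?thesis unfolding descents_def mem_Collect_eq len by (simp only: simp_thms)
      qed
      also have "\<dots> \<longleftrightarrow> v = length xs + (a - 1)" using a b by linarith
      also have "\<dots> \<longleftrightarrow> v \<in> insert (length xs + (a - 1)) (descents xs)"
        using 3 by (simp add: descents_def)
      finally show ?thesis .
    qed
  qed
qed

lemma card_descents_alternating_3braid:
  assumes "\<forall>i\<in>{1..n}. p i > 0 \<and> q i > 0"
  shows "card (descents (alternating_3braid n p q)) = n"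
  using assms
proof (induction n)
  case 0
  show ?case by (simp add: alternating_3braid_0 descents_def)
next
  case (Suc n)
  let ?w = "alternating_3braid n p q"
  have "?w = [] \<or> last ?w \<noteq> Sigma 1"
    using ends_alternating_3braid(3)[of n p q] Suc.prems by (cases n) (simp_all add: alternating_3braid_0)
  then have eq: "descents (alternating_3braid (Suc n) p q)
      = insert (length ?w + (p (Suc n) - 1)) (descents ?w)"
    unfolding alternating_3braid_Suc using Suc.prems by (intro descents_append) auto
  have "finite (descents ?w)"
    by (rule finite_subset[of _ "{..<length ?w}"]) (auto simp: descents_def)
  moreover have "length ?w + (p (Suc n) - 1) \<notin> descents ?w" by (auto simp: descents_def)
  ultimately show ?case unfolding eq using Suc by simp
qed

theorem theorem2p29:
  fixes n P Q :: nat and p q :: "nat \<Rightarrow> nat" and w :: "braid_letter list"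
    and A :: "nat \<Rightarrow> nat \<Rightarrow> int" and a :: "nat \<Rightarrow> int"
  assumes "n \<ge> 1"
    and "\<forall>i\<in>{1..n}. p i > 0 \<and> q i > 0"
    and "P = (\<Sum>i=1..n. p i)" and "Q = (\<Sum>i=1..n. q i)"
    and "w = alternating_3braid n p q"
    and "A = crowell_coeff w"
    and "a = coeff (at_minus_t (alexander_poly 3 w))"
  shows "(\<forall>i j. i < P \<and> Suc j < Q \<longrightarrow> int n * A i (Suc j) \<ge> A i j) \<and>
         (\<forall>k. k + 2 \<le> P \<longrightarrow>
            real_of_int (a (Suc k)) \<ge> real_of_int (a k) / real n + real_of_int (A 0 (Suc k)) \<and>
            (Suc k < Q \<longrightarrow>
               real_of_int (a k) / real n + real_of_int (A 0 (Suc k)) > real_of_int (a k) / real n) \<and>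
            (n \<ge> 2 \<longrightarrow> real_of_int (a (Suc k)) > real_of_int (a k) / real n))"
proof -
  interpret crowell_word w
    unfolding assms(5) using set_alternating_3braid ends_alternating_3braid[OF assms(2,1)]
    by unfold_locales
  have "p_num = length (filter (\<lambda>x. x = Sigma 1) w)"
    unfolding p_num_def sigma1_at_def length_filter_conv_card ..
  also have "\<dots> = P" unfolding assms(3,5) by (rule count_alternating_3braid)
  finally have P: "p_num = P" .
  have "q_num = length (filter (\<lambda>x. x \<noteq> Sigma 1) w)"
    unfolding q_num_def sigma1_at_def length_filter_conv_card ..
  also have "\<dots> = Q" unfolding assms(4,5) by (rule count_alternating_3braid)
  finally have Q: "q_num = Q" .
  have "blocks = descents w"
    unfolding blocks_def descents_def sigma1_at_def ..
  then have n: "card blocks = n"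
    using card_descents_alternating_3braid[OF assms(2)] assms(5) by (simp only:)
  have A: "A i j = int (N 0 (P - 1 - i) j)" if "i < P" for i j
    using crowell_coeff_eq[of i j] that unfolding assms(6) P by simp
  have a: "a k = int (diag k)" if "k < P" for k
    using coeff_alexander_poly[of k] that unfolding assms(7) P by simp
  show ?thesis
  proof (intro conjI allI impI)
    fix i j assume ij: "i < P \<and> Suc j < Q"
    then have "N 0 (P - 1 - i) j \<le> n * N 0 (P - 1 - i) (Suc j)"
      using N_Suc_d[of j "P - 1 - i"] unfolding n q_num_def[symmetric] Q by simp
    then show "int n * A i (Suc j) \<ge> A i j"
      using ij unfolding of_nat_mult[symmetric] by (simp add: A flip: of_nat_mult)
  next
    fix k assume k: "k + 2 \<le> P"
    then have k': "k < P" "Suc k < P" "0 < P" by auto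
    have n0: "real n > 0" using assms(1) by simp
    have ineq: "diag k + n * N 0 (P - 1) (Suc k) \<le> n * diag (Suc k)"
      using diag_Suc(1)[of k] k unfolding n P by simp
    then have "real (diag k) + real n * real (N 0 (P - 1) (Suc k)) \<le> real n * real (diag (Suc k))"
      unfolding of_nat_mult[symmetric] of_nat_add[symmetric] of_nat_le_iff .
    then show "real_of_int (a (Suc k)) \<ge> real_of_int (a k) / real n + real_of_int (A 0 (Suc k))"
      using n0 k' by (simp add: A a field_simps)
    show "real_of_int (a k) / real n + real_of_int (A 0 (Suc k)) > real_of_int (a k) / real n"
      if "Suc k < Q"
      using N_row_pos[of "Suc k"] that k' unfolding P Q by (simp add: A)
    \<comment> \<open>For \<open>Suc k \<ge> Q\<close> the entry \<open>A 0 (Suc k)\<close> is zero;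
      strictness then rests on the antidiagonal entry with \<open>j = 0\<close>.\<close>
    assume "n \<ge> 2"
    then have "diag k < n * diag (Suc k)"
      using diag_Suc(2)[of k] k unfolding n P by simp
    then have "real (diag k) < real n * real (diag (Suc k))"
      unfolding of_nat_mult[symmetric] of_nat_less_iff .
    then show "real_of_int (a (Suc k)) > real_of_int (a k) / real n"
      using n0 k' by (simp add: a field_simps)
  qed
qed

end
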